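(* Let $(M_1,\tilde g_1)$ and $(M_2,\tilde g_2)$ be pseudo-Riemannian manifolds with cometrics $g_1,g_2$, let $\Pi_i$ be a bivector field on $M_i$ ($i=1,2$), let $f$ be a positive smooth function on $M_1$ and $\mu$ a smooth function on $M_1$. If $f$ is a Casimir function (of $\Pi_1$) and $\mu$ is a nonzero essentially constant function, then the triple $(M_1\times M_2,g^f,\Pi^\mu)$ is a pseudo-Riemannian Poisson manifold if and only if $(M_1,g_1,\Pi_1)$ and $(M_2,g_2,\Pi_2)$ are pseudo-Riemannian Poisson manifolds.
   Context: For a bivector field $\Pi$ on $M$, the anchor map $\sharp_\Pi:T^*M\to TM$ is given by $\beta(\sharp_\Pi(\alpha))=\Pi(\alpha,\beta)$, and the Koszul bracket of 1-forms is $[\alpha,\beta]_\Pi=\mathcal L_{\sharp_\Pi(\alpha)}\beta-\mathcal L_{\sharp_\Pi(\beta)}\alpha-d(\Pi(\alpha,\beta))$. A function $\varphi$ is Casimir if $\sharp_\Pi(d\varphi)=0$. A function is essentially constant if it is constant on each connected component. A contravariant connection with respect to $\Pi$ is an $\mathbb R$-bilinear map $\mathcal D:\Gamma(T^*M)\times\Gamma(T^*M)\to\Gamma(T^*M)$ with $\mathcal D_{\varphi\alpha}\beta=\varphi\mathcal D_\alpha\beta$ and $\mathcal D_\alpha(\varphi\beta)=\varphi\mathcal D_\alpha\beta+\sharp_\Pi(\alpha)(\varphi)\beta$. The cometric of a pseudo-Riemannian metric $\tilde g$ is the induced metric $g$ on $T^*M$. The Levi-Civita contravariant connection of $(g,\Pi)$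 is the unique contravariant connection with respect to $\Pi$ satisfying $\sharp_\Pi(\alpha).g(\beta,\gamma)=g(\mathcal D_\alpha\beta,\gamma)+g(\beta,\mathcal D_\alpha\gamma)$ and $\mathcal D_\alpha\beta-\mathcal D_\beta\alpha=[\alpha,\beta]_\Pi$. The triple $(M,g,\Pi)$ is a pseudo-Riemannian Poisson manifold if $\mathcal D\Pi=0$, i.e. $\sharp_\Pi(\alpha).\Pi(\beta,\gamma)-\Pi(\mathcal D_\alpha\beta,\gamma)-\Pi(\beta,\mathcal D_\alpha\gamma)=0$ for all 1-forms $\alpha,\beta,\gamma$, where $\mathcal D$ is the Levi-Civita contravariant connection of $(g,\Pi)$. With $\sigma_i:M_1\times M_2\to M_i$ the projections, lifts of functions and forms are $\omega_1^h=\sigma_1^*\omega_1$, $\omega_2^v=\sigma_2^*\omega_2$. The warped bivector field $\Pi^\mu$ is determined by $\Pi^\mu(\alpha_1^h,\beta_1^h)=\Pi_1(\alpha_1,\beta_1)^h$, $\Pi^\mu(\alpha_2^v,\beta_2^v)=\mu^h\Pi_2(\alpha_2,\beta_2)^v$, $\Pi^\mu(\alpha_1^h,\beta_2^v)=0$, and the contravariant warped metric $g^f$ by $g^f(\alpha_1^h,\beta_1^h)=g_1(\alpha_1,\beta_1)^h$, $g^f(\alpha_2^v,\beta_2^v)=f^hg_2(\alpha_2,\beta_2)^v$, $g^f(\alpha_1^h,\alpha_2^v)=0$. *)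

theory Defs
  imports "HOL-Analysis.Analysis"
begin

section \<open>Smooth manifolds\<close>

text \<open>
  A smooth manifold is a Hausdorff second countable topological space, given as a type \<open>'a\<close>,
  with an atlas \<open>A\<close> of charts into a Euclidean space \<open>'e\<close>. A chart is a pair \<open>(U, \<phi>)\<close> where
  only the values of \<open>\<phi>\<close> on \<open>U\<close> matter. The atlas need not be maximal.
\<close>

fun Ck_on :: "nat \<Rightarrow> 'e::euclidean_space set \<Rightarrow> ('e \<Rightarrow> 'f::real_normed_vector) \<Rightarrow> bool" where
  "Ck_on 0 S h \<longleftrightarrow> continuous_on S h"
| "Ck_on (Suc k) S h \<longleftrightarrow>
     (\<forall>x\<in>S. h differentiable (at x)) \<and> (\<forall>v. Ck_on k S (\<lambda>x. frechet_derivative h (at x) v))"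

text \<open>Only used for open sets \<open>S\<close>, where it does not depend on the values of \<open>h\<close> outside \<open>S\<close>.\<close>

definition smooth_on :: "'e::euclidean_space set \<Rightarrow> ('e \<Rightarrow> 'f::real_normed_vector) \<Rightarrow> bool" where
  "smooth_on S h \<longleftrightarrow> (\<forall>k. Ck_on k S h)"

type_synonym ('a, 'e) atlas = "('a set \<times> ('a \<Rightarrow> 'e)) set"

definition smooth_atlas ::
    "('a::{t2_space, second_countable_topology}, 'e::euclidean_space) atlas \<Rightarrow> bool" where
  "smooth_atlas A \<longleftrightarrow>
     (\<forall>(U, \<phi>)\<in>A. open U \<and> open (\<phi> ` U) \<and> homeomorphism U (\<phi> ` U) \<phi> (inv_into U \<phi>)) \<and>
     (\<Union>(U, \<phi>)\<in>A. U) = UNIV \<and>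
     (\<forall>(U, \<phi>)\<in>A. \<forall>(V, \<psi>)\<in>A. smooth_on (\<phi> ` (U \<inter> V)) (\<psi> \<circ> inv_into U \<phi>))"

definition smooth_funs :: "('a, 'e::euclidean_space) atlas \<Rightarrow> ('a \<Rightarrow> real) set" where
  "smooth_funs A = {h. \<forall>(U, \<phi>)\<in>A. smooth_on (\<phi> ` U) (h \<circ> inv_into U \<phi>)}"

definition prod_atlas ::
    "('a, 'e) atlas \<Rightarrow> ('b, 'f) atlas \<Rightarrow> ('a \<times> 'b, 'e \<times> 'f) atlas" where
  "prod_atlas A B = {(U \<times> V, map_prod \<phi> \<psi>) | U \<phi> V \<psi>. (U, \<phi>) \<in> A \<and> (V, \<psi>) \<in> B}"

definition essentially_constant :: "('a::topological_space \<Rightarrow> real) \<Rightarrow> bool" where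
  "essentially_constant h \<longleftrightarrow> (\<forall>K\<in>components UNIV. h constant_on K)"


section \<open>Vector fields and 1-forms\<close>

text \<open>
  Tangent vectors at \<open>p\<close> are the derivations at \<open>p\<close> of the algebra of smooth functions, and
  covectors at \<open>p\<close> are the linear functionals on the tangent space. So that equality of tangent
  vectors, covectors and fields is equality in HOL, tangent vectors vanish on non-smooth
  functions and covectors at \<open>p\<close> vanish outside the tangent space at \<open>p\<close>.
\<close>

type_synonym 'a tvec = "('a \<Rightarrow> real) \<Rightarrow> real"
type_synonym 'a covec = "'a tvec \<Rightarrow> real"

definition tangent_space :: "('a, 'e::euclidean_space) atlas \<Rightarrow> 'a \<Rightarrow> 'a tvec set" where
  "tangent_space A p = {v.
     (\<forall>h\<in>smooth_funs A. \<forall>k\<in>smooth_funs A. v (\<lambda>x. h x + k x) = v h + v k) \<and>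
     (\<forall>c. \<forall>h\<in>smooth_funs A. v (\<lambda>x. c * h x) = c * v h) \<and>
     (\<forall>h\<in>smooth_funs A. \<forall>k\<in>smooth_funs A. v (\<lambda>x. h x * k x) = h p * v k + k p * v h) \<and>
     (\<forall>h. h \<notin> smooth_funs A \<longrightarrow> v h = 0)}"

definition cotangent_space :: "('a, 'e::euclidean_space) atlas \<Rightarrow> 'a \<Rightarrow> 'a covec set" where
  "cotangent_space A p = {\<omega>.
     (\<forall>v\<in>tangent_space A p. \<forall>w\<in>tangent_space A p. \<omega> (\<lambda>h. v h + w h) = \<omega> v + \<omega> w) \<and>
     (\<forall>c. \<forall>v\<in>tangent_space A p. \<omega> (\<lambda>h. c * v h) = c * \<omega> v) \<and>
     (\<forall>v. v \<notin> tangent_space A p \<longrightarrow> \<omega> v = 0)}"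

definition vector_fields :: "('a, 'e::euclidean_space) atlas \<Rightarrow> ('a \<Rightarrow> 'a tvec) set" where
  "vector_fields A = {X.
     (\<forall>p. X p \<in> tangent_space A p) \<and> (\<forall>h\<in>smooth_funs A. (\<lambda>p. X p h) \<in> smooth_funs A)}"

definition one_forms :: "('a, 'e::euclidean_space) atlas \<Rightarrow> ('a \<Rightarrow> 'a covec) set" where
  "one_forms A = {\<omega>.
     (\<forall>p. \<omega> p \<in> cotangent_space A p) \<and>
     (\<forall>X\<in>vector_fields A. (\<lambda>p. \<omega> p (X p)) \<in> smooth_funs A)}"

definition differential ::
    "('a, 'e::euclidean_space) atlas \<Rightarrow> ('a \<Rightarrow> real) \<Rightarrow> 'a \<Rightarrow> 'a covec" where
  "differential A h = (\<lambda>p v. if v \<in> tangent_space A p then v h else 0)"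

definition lie_bracket ::
    "('a, 'e::euclidean_space) atlas \<Rightarrow> ('a \<Rightarrow> 'a tvec) \<Rightarrow> ('a \<Rightarrow> 'a tvec) \<Rightarrow> 'a \<Rightarrow> 'a tvec" where
  "lie_bracket A X Y = (\<lambda>p h.
     if h \<in> smooth_funs A then X p (\<lambda>q. Y q h) - Y p (\<lambda>q. X q h) else 0)"

text \<open>\<open>(L\<^sub>X \<beta>)(Y) = X(\<beta>(Y)) - \<beta>([X, Y])\<close>\<close>

definition lie_derivative ::
    "('a, 'e::euclidean_space) atlas \<Rightarrow> ('a \<Rightarrow> 'a tvec) \<Rightarrow> ('a \<Rightarrow> 'a covec) \<Rightarrow> 'a \<Rightarrow> 'a covec" where
  "lie_derivative A X \<beta> = (THE \<omega>. \<omega> \<in> one_forms A \<and>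
     (\<forall>Y\<in>vector_fields A. \<forall>p. \<omega> p (Y p) = X p (\<lambda>q. \<beta> q (Y q)) - \<beta> p (lie_bracket A X Y p)))"

definition pushforward :: "('b, 'f::euclidean_space) atlas \<Rightarrow> ('a \<Rightarrow> 'b) \<Rightarrow> 'a tvec \<Rightarrow> 'b tvec" where
  "pushforward B F v = (\<lambda>h. if h \<in> smooth_funs B then v (h \<circ> F) else 0)"

definition pullback ::
    "('a, 'e::euclidean_space) atlas \<Rightarrow> ('b, 'f::euclidean_space) atlas \<Rightarrow> ('a \<Rightarrow> 'b) \<Rightarrow>
     ('b \<Rightarrow> 'b covec) \<Rightarrow> 'a \<Rightarrow> 'a covec" where
  "pullback A B F \<omega> = (\<lambda>p v. if v \<in> tangent_space A p then \<omega> (F p) (pushforward B F v) else 0)"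


section \<open>Contravariant tensors, metrics and cometrics\<close>

text \<open>
  A contravariant 2-tensor field gives at each \<open>p\<close> a bilinear form on the cotangent space at
  \<open>p\<close>, a covariant one a bilinear form on the tangent space; values elsewhere are irrelevant.
\<close>

definition contra_eval ::
    "('a \<Rightarrow> 'a covec \<Rightarrow> 'a covec \<Rightarrow> real) \<Rightarrow> ('a \<Rightarrow> 'a covec) \<Rightarrow> ('a \<Rightarrow> 'a covec) \<Rightarrow> 'a \<Rightarrow> real" where
  "contra_eval T \<alpha> \<beta> = (\<lambda>p. T p (\<alpha> p) (\<beta> p))"

definition contravariant_tensor2 ::
    "('a, 'e::euclidean_space) atlas \<Rightarrow> ('a \<Rightarrow> 'a covec \<Rightarrow> 'a covec \<Rightarrow> real) \<Rightarrow> bool" where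
  "contravariant_tensor2 A T \<longleftrightarrow>
     (\<forall>p. \<forall>a\<in>cotangent_space A p. \<forall>b\<in>cotangent_space A p. \<forall>c\<in>cotangent_space A p. \<forall>r s.
        T p (\<lambda>v. r * a v + s * b v) c = r * T p a c + s * T p b c \<and>
        T p c (\<lambda>v. r * a v + s * b v) = r * T p c a + s * T p c b) \<and>
     (\<forall>\<alpha>\<in>one_forms A. \<forall>\<beta>\<in>one_forms A. contra_eval T \<alpha> \<beta> \<in> smooth_funs A)"

definition bivector_field ::
    "('a, 'e::euclidean_space) atlas \<Rightarrow> ('a \<Rightarrow> 'a covec \<Rightarrow> 'a covec \<Rightarrow> real) \<Rightarrow> bool" where
  "bivector_field A P \<longleftrightarrow> contravariant_tensor2 A P \<and>
     (\<forall>p. \<forall>a\<in>cotangent_space A p. \<forall>b\<in>cotangent_space A p. P p a b = - P p b a)"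

definition contravariant_metric ::
    "('a, 'e::euclidean_space) atlas \<Rightarrow> ('a \<Rightarrow> 'a covec \<Rightarrow> 'a covec \<Rightarrow> real) \<Rightarrow> bool" where
  "contravariant_metric A g \<longleftrightarrow> contravariant_tensor2 A g \<and>
     (\<forall>p. \<forall>a\<in>cotangent_space A p. \<forall>b\<in>cotangent_space A p. g p a b = g p b a) \<and>
     (\<forall>p. \<forall>a\<in>cotangent_space A p. (\<forall>b\<in>cotangent_space A p. g p a b = 0) \<longrightarrow> a = (\<lambda>_. 0))"

definition pseudo_riemannian_metric ::
    "('a, 'e::euclidean_space) atlas \<Rightarrow> ('a \<Rightarrow> 'a tvec \<Rightarrow> 'a tvec \<Rightarrow> real) \<Rightarrow> bool" where
  "pseudo_riemannian_metric A G \<longleftrightarrow>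
     (\<forall>p. \<forall>u\<in>tangent_space A p. \<forall>v\<in>tangent_space A p. \<forall>w\<in>tangent_space A p. \<forall>r s.
        G p (\<lambda>h. r * u h + s * v h) w = r * G p u w + s * G p v w) \<and>
     (\<forall>p. \<forall>u\<in>tangent_space A p. \<forall>v\<in>tangent_space A p. G p u v = G p v u) \<and>
     (\<forall>p. \<forall>u\<in>tangent_space A p. (\<forall>v\<in>tangent_space A p. G p u v = 0) \<longrightarrow> u = (\<lambda>_. 0)) \<and>
     (\<forall>X\<in>vector_fields A. \<forall>Y\<in>vector_fields A. (\<lambda>p. G p (X p) (Y p)) \<in> smooth_funs A)"

definition metric_sharp ::
    "('a, 'e::euclidean_space) atlas \<Rightarrow> ('a \<Rightarrow> 'a tvec \<Rightarrow> 'a tvec \<Rightarrow> real) \<Rightarrow> 'a \<Rightarrow> 'a covec \<Rightarrow> 'a tvec" where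
  "metric_sharp A G p a =
     (THE u. u \<in> tangent_space A p \<and> (\<forall>v\<in>tangent_space A p. G p u v = a v))"

definition cometric ::
    "('a, 'e::euclidean_space) atlas \<Rightarrow> ('a \<Rightarrow> 'a tvec \<Rightarrow> 'a tvec \<Rightarrow> real) \<Rightarrow>
     'a \<Rightarrow> 'a covec \<Rightarrow> 'a covec \<Rightarrow> real" where
  "cometric A G = (\<lambda>p a b. G p (metric_sharp A G p a) (metric_sharp A G p b))"


section \<open>Contravariant connections and pseudo-Riemannian Poisson manifolds\<close>

definition anchor ::
    "('a, 'e::euclidean_space) atlas \<Rightarrow> ('a \<Rightarrow> 'a covec \<Rightarrow> 'a covec \<Rightarrow> real) \<Rightarrow>
     ('a \<Rightarrow> 'a covec) \<Rightarrow> 'a \<Rightarrow> 'a tvec" where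
  "anchor A P \<alpha> = (\<lambda>p.
     THE v. v \<in> tangent_space A p \<and> (\<forall>b\<in>cotangent_space A p. b v = P p (\<alpha> p) b))"

definition koszul_bracket ::
    "('a, 'e::euclidean_space) atlas \<Rightarrow> ('a \<Rightarrow> 'a covec \<Rightarrow> 'a covec \<Rightarrow> real) \<Rightarrow>
     ('a \<Rightarrow> 'a covec) \<Rightarrow> ('a \<Rightarrow> 'a covec) \<Rightarrow> 'a \<Rightarrow> 'a covec" where
  "koszul_bracket A P \<alpha> \<beta> = (\<lambda>p v.
     lie_derivative A (anchor A P \<alpha>) \<beta> p v - lie_derivative A (anchor A P \<beta>) \<alpha> p v
       - differential A (contra_eval P \<alpha> \<beta>) p v)"

definition casimir ::
    "('a, 'e::euclidean_space) atlas \<Rightarrow> ('a \<Rightarrow> 'a covec \<Rightarrow> 'a covec \<Rightarrow> real) \<Rightarrow> ('a \<Rightarrow> real) \<Rightarrow> bool" where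
  "casimir A P h \<longleftrightarrow> h \<in> smooth_funs A \<and> anchor A P (differential A h) = (\<lambda>p k. 0)"

definition contravariant_connection ::
    "('a, 'e::euclidean_space) atlas \<Rightarrow> ('a \<Rightarrow> 'a covec \<Rightarrow> 'a covec \<Rightarrow> real) \<Rightarrow>
     (('a \<Rightarrow> 'a covec) \<Rightarrow> ('a \<Rightarrow> 'a covec) \<Rightarrow> 'a \<Rightarrow> 'a covec) \<Rightarrow> bool" where
  "contravariant_connection A P D \<longleftrightarrow>
     (\<forall>\<alpha>\<in>one_forms A. \<forall>\<beta>\<in>one_forms A. D \<alpha> \<beta> \<in> one_forms A) \<and>
     (\<forall>\<alpha>\<in>one_forms A. \<forall>\<beta>\<in>one_forms A. \<forall>\<gamma>\<in>one_forms A. \<forall>r s.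
        D (\<lambda>p v. r * \<alpha> p v + s * \<beta> p v) \<gamma> = (\<lambda>p v. r * D \<alpha> \<gamma> p v + s * D \<beta> \<gamma> p v) \<and>
        D \<gamma> (\<lambda>p v. r * \<alpha> p v + s * \<beta> p v) = (\<lambda>p v. r * D \<gamma> \<alpha> p v + s * D \<gamma> \<beta> p v)) \<and>
     (\<forall>h\<in>smooth_funs A. \<forall>\<alpha>\<in>one_forms A. \<forall>\<beta>\<in>one_forms A.
        D (\<lambda>p v. h p * \<alpha> p v) \<beta> = (\<lambda>p v. h p * D \<alpha> \<beta> p v) \<and>
        D \<alpha> (\<lambda>p v. h p * \<beta> p v) = (\<lambda>p v. h p * D \<alpha> \<beta> p v + anchor A P \<alpha> p h * \<beta> p v))"

definition levi_civita_connection ::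
    "('a, 'e::euclidean_space) atlas \<Rightarrow> ('a \<Rightarrow> 'a covec \<Rightarrow> 'a covec \<Rightarrow> real) \<Rightarrow>
     ('a \<Rightarrow> 'a covec \<Rightarrow> 'a covec \<Rightarrow> real) \<Rightarrow>
     (('a \<Rightarrow> 'a covec) \<Rightarrow> ('a \<Rightarrow> 'a covec) \<Rightarrow> 'a \<Rightarrow> 'a covec) \<Rightarrow> bool" where
  "levi_civita_connection A g P D \<longleftrightarrow> contravariant_connection A P D \<and>
     (\<forall>\<alpha>\<in>one_forms A. \<forall>\<beta>\<in>one_forms A. \<forall>\<gamma>\<in>one_forms A. \<forall>p.
        anchor A P \<alpha> p (contra_eval g \<beta> \<gamma>) =
          contra_eval g (D \<alpha> \<beta>) \<gamma> p + contra_eval g \<beta> (D \<alpha> \<gamma>) p) \<and>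
     (\<forall>\<alpha>\<in>one_forms A. \<forall>\<beta>\<in>one_forms A.
        (\<lambda>p v. D \<alpha> \<beta> p v - D \<beta> \<alpha> p v) = koszul_bracket A P \<alpha> \<beta>)"

definition parallel_bivector ::
    "('a, 'e::euclidean_space) atlas \<Rightarrow> ('a \<Rightarrow> 'a covec \<Rightarrow> 'a covec \<Rightarrow> real) \<Rightarrow>
     (('a \<Rightarrow> 'a covec) \<Rightarrow> ('a \<Rightarrow> 'a covec) \<Rightarrow> 'a \<Rightarrow> 'a covec) \<Rightarrow> bool" where
  "parallel_bivector A P D \<longleftrightarrow>
     (\<forall>\<alpha>\<in>one_forms A. \<forall>\<beta>\<in>one_forms A. \<forall>\<gamma>\<in>one_forms A. \<forall>p.
        anchor A P \<alpha> p (contra_eval P \<beta> \<gamma>)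
          - contra_eval P (D \<alpha> \<beta>) \<gamma> p - contra_eval P \<beta> (D \<alpha> \<gamma>) p = 0)"

text \<open>
  As usual, \<open>g\<close> is meant to be a contravariant (pseudo-Riemannian) metric and \<open>P\<close> a bivector
  field. Then there is a Levi-Civita connection and any two of them agree on 1-forms, so that the
  existential quantifier refers to the Levi-Civita connection.
\<close>

definition pseudo_riemannian_poisson ::
    "('a, 'e::euclidean_space) atlas \<Rightarrow> ('a \<Rightarrow> 'a covec \<Rightarrow> 'a covec \<Rightarrow> real) \<Rightarrow>
     ('a \<Rightarrow> 'a covec \<Rightarrow> 'a covec \<Rightarrow> real) \<Rightarrow> bool" where
  "pseudo_riemannian_poisson A g P \<longleftrightarrow>
     (\<exists>D. levi_civita_connection A g P D \<and> parallel_bivector A P D)"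


section \<open>Lifts and warped products\<close>

definition hlift_form ::
    "('a, 'e::euclidean_space) atlas \<Rightarrow> ('b, 'f::euclidean_space) atlas \<Rightarrow>
     ('a \<Rightarrow> 'a covec) \<Rightarrow> 'a \<times> 'b \<Rightarrow> ('a \<times> 'b) covec" where
  "hlift_form A B = pullback (prod_atlas A B) A fst"

definition vlift_form ::
    "('a, 'e::euclidean_space) atlas \<Rightarrow> ('b, 'f::euclidean_space) atlas \<Rightarrow>
     ('b \<Rightarrow> 'b covec) \<Rightarrow> 'a \<times> 'b \<Rightarrow> ('a \<times> 'b) covec" where
  "vlift_form A B = pullback (prod_atlas A B) B snd"

text \<open>
  The lifts of 1-forms of the two factors span every cotangent space of the product, so each of
  the following predicates determines its last argument on the cotangent spaces.
\<close>

definition is_warped_bivector ::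
    "('a, 'e::euclidean_space) atlas \<Rightarrow> ('b, 'f::euclidean_space) atlas \<Rightarrow>
     ('a \<Rightarrow> real) \<Rightarrow> ('a \<Rightarrow> 'a covec \<Rightarrow> 'a covec \<Rightarrow> real) \<Rightarrow> ('b \<Rightarrow> 'b covec \<Rightarrow> 'b covec \<Rightarrow> real) \<Rightarrow>
     ('a \<times> 'b \<Rightarrow> ('a \<times> 'b) covec \<Rightarrow> ('a \<times> 'b) covec \<Rightarrow> real) \<Rightarrow> bool" where
  "is_warped_bivector A B \<mu> P1 P2 P \<longleftrightarrow> bivector_field (prod_atlas A B) P \<and>
     (\<forall>\<alpha>\<in>one_forms A. \<forall>\<beta>\<in>one_forms A.
        contra_eval P (hlift_form A B \<alpha>) (hlift_form A B \<beta>) = contra_eval P1 \<alpha> \<beta> \<circ> fst) \<and>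
     (\<forall>\<alpha>\<in>one_forms B. \<forall>\<beta>\<in>one_forms B.
        contra_eval P (vlift_form A B \<alpha>) (vlift_form A B \<beta>) =
          (\<lambda>z. (\<mu> \<circ> fst) z * (contra_eval P2 \<alpha> \<beta> \<circ> snd) z)) \<and>
     (\<forall>\<alpha>\<in>one_forms A. \<forall>\<beta>\<in>one_forms B.
        contra_eval P (hlift_form A B \<alpha>) (vlift_form A B \<beta>) = (\<lambda>z. 0))"

definition is_warped_cometric ::
    "('a, 'e::euclidean_space) atlas \<Rightarrow> ('b, 'f::euclidean_space) atlas \<Rightarrow>
     ('a \<Rightarrow> real) \<Rightarrow> ('a \<Rightarrow> 'a covec \<Rightarrow> 'a covec \<Rightarrow> real) \<Rightarrow> ('b \<Rightarrow> 'b covec \<Rightarrow> 'b covec \<Rightarrow> real) \<Rightarrow>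
     ('a \<times> 'b \<Rightarrow> ('a \<times> 'b) covec \<Rightarrow> ('a \<times> 'b) covec \<Rightarrow> real) \<Rightarrow> bool" where
  "is_warped_cometric A B f g1 g2 g \<longleftrightarrow> contravariant_metric (prod_atlas A B) g \<and>
     (\<forall>\<alpha>\<in>one_forms A. \<forall>\<beta>\<in>one_forms A.
        contra_eval g (hlift_form A B \<alpha>) (hlift_form A B \<beta>) = contra_eval g1 \<alpha> \<beta> \<circ> fst) \<and>
     (\<forall>\<alpha>\<in>one_forms B. \<forall>\<beta>\<in>one_forms B.
        contra_eval g (vlift_form A B \<alpha>) (vlift_form A B \<beta>) =
          (\<lambda>z. (f \<circ> fst) z * (contra_eval g2 \<alpha> \<beta> \<circ> snd) z)) \<and>
     (\<forall>\<alpha>\<in>one_forms A. \<forall>\<beta>\<in>one_forms B.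
        contra_eval g (hlift_form A B \<alpha>) (vlift_form A B \<beta>) = (\<lambda>z. 0))"

end

(* The statement is proved without frames on the product. A 1-form on the product restricts to
   the slices through a point, and a covector is determined by its two restrictions. With respect to
   these restrictions g^f and Pi^mu are weighted sums of the tensors of the factors. Given the
   connections D_1, D_2 of the factors, the Levi-Civita connection of the product in a direction of a
   factor is the weighted connection of that factor applied to the slices, plus the derivative of
   the slice of the second argument along the anchor in the other factor. The Casimir condition on f
   and the local constancy of mu say that the anchor annihilates the weights, so that the axioms for
   the product split into those for the factors. Conversely, restricting the connection of the
   product, applied to lifts, to a slice on which the weight of Pi^mu is a nonzero constant and dividing
   by this constant gives the connection of a factor; for the second factor the slice lies over a
   point where mu does not vanish. *)

theory Submission
  imports Defs
begin

section \<open>Calculus of smooth functions\<close>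

text \<open>Tangent vectors are derivations of the global smooth functions, and the anchor and the
  Lie derivative are given by \<open>THE\<close>. They, and with them the Koszul bracket, can be
  computed only once tangent spaces have coordinate frames and every vector and covector extends to
  a global field; cutoffs and the Hadamard lemma serve this end. The obstacle on the product is that
  a 1-form is in general not a sum of lifts: its slices in one factor move with the point of the
  other. At a fixed point these slices lie in one vector space, so they can be differentiated
  without a connection. The Koszul bracket of the product contains exactly such derivatives as cross
  terms, and these dictate the extra term of the product connection. Local constancy of \<mu> keeps
  derivatives of the weights out of the bracket, whereas f enters only through the metric and
  therefore has to be constant only along the anchor. Being pseudo-Riemannian Poisson asks for a
  connection to exist, so each implication exhibits one.\<close>

lemma Ck_on_subset: "Ck_on k S f \<Longrightarrow> T \<subseteq> S \<Longrightarrow> Ck_on k T f"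
  by (induction k arbitrary: f) (auto intro: continuous_on_subset)

lemma Ck_on_SucD: "Ck_on (Suc k) S f \<Longrightarrow> Ck_on k S f"
proof (induction k arbitrary: f)
  case 0
  then show ?case
    by (simp add: continuous_at_imp_continuous_on differentiable_imp_continuous_within)
next
  case (Suc k)
  have "Ck_on k S (\<lambda>x. frechet_derivative f (at x) v)" for v
    using Suc.prems by (intro Suc.IH) (simp only: Ck_on.simps(2)[of "Suc k"])
  moreover have "\<forall>x\<in>S. f differentiable at x"
    using Suc.prems by simp
  ultimately show ?case by simp
qed

lemma has_derivative_cong_open:
  assumes "open S" "x \<in> S" "\<And>y. y \<in> S \<Longrightarrow> f y = g y"
  shows "(f has_derivative D) (at x) \<longleftrightarrow> (g has_derivative D) (at x)"
proof
  show "(g has_derivative D) (at x)" if "(f has_derivative D) (at x)"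
    using that assms by (rule has_derivative_transform_within_open)
  show "(f has_derivative D) (at x)" if "(g has_derivative D) (at x)"
    using that assms(1,2) assms(3)[symmetric] by (rule has_derivative_transform_within_open)
qed

lemma frechet_derivative_cong_open:
  assumes "open S" "x \<in> S" "\<And>y. y \<in> S \<Longrightarrow> f y = g y"
  shows "frechet_derivative f (at x) = frechet_derivative g (at x)"
proof -
  have "(f has_derivative D) (at x) \<longleftrightarrow> (g has_derivative D) (at x)" for D
    by (rule has_derivative_cong_open[OF assms])
  then show ?thesis by (simp add: frechet_derivative_def)
qed

lemma differentiable_cong_open:
  assumes "open S" "x \<in> S" "\<And>y. y \<in> S \<Longrightarrow> f y = g y"
  shows "f differentiable at x \<longleftrightarrow> g differentiable at x"
proof -
  have "(f has_derivative D) (at x) \<longleftrightarrow> (g has_derivative D) (at x)" for D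
    by (rule has_derivative_cong_open[OF assms])
  then show ?thesis by (simp add: differentiable_def)
qed

lemma Ck_on_cong:
  assumes "open S" "Ck_on k S f" "\<And>x. x \<in> S \<Longrightarrow> f x = g x"
  shows "Ck_on k S g"
  using assms(2,3)
proof (induction k arbitrary: f g)
  case 0
  then show ?case using continuous_on_cong[of S S f g] by simp
next
  case (Suc k)
  have "g differentiable at x" if "x \<in> S" for x
    using differentiable_cong_open[OF assms(1) that, of f g] Suc.prems that by auto
  moreover have "Ck_on k S (\<lambda>x. frechet_derivative g (at x) v)" for v
    by (rule Suc.IH[of "\<lambda>x. frechet_derivative f (at x) v"])
      (use Suc.prems frechet_derivative_cong_open[OF assms(1), of _ f g] in auto)
  ultimately show ?case by simp
qed

lemma Ck_on_local:
  assumes "\<And>x. x \<in> S \<Longrightarrow> \<exists>T. open T \<and> x \<in> T \<and> Ck_on k T f"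
  shows "Ck_on k S f"
  using assms
proof (induction k arbitrary: f)
  case 0
  have "isCont f x" if "x \<in> S" for x
    using 0[OF that] by (auto simp: continuous_on_eq_continuous_at)
  then show ?case by (simp add: continuous_at_imp_continuous_on)
next
  case (Suc k)
  have "f differentiable at x" if "x \<in> S" for x
    using Suc.prems[OF that] by auto
  moreover have "Ck_on k S (\<lambda>x. frechet_derivative f (at x) v)" for v
  proof (rule Suc.IH)
    show "\<exists>T. open T \<and> x \<in> T \<and> Ck_on k T (\<lambda>x. frechet_derivative f (at x) v)" if "x \<in> S" for x
      using Suc.prems[OF that] by auto
  qed
  ultimately show ?case by simp
qed

text \<open>\<open>frechet_derivative\<close> is a choice that is pinned down only where the map is
  differentiable. On the open set \<open>S\<close> it equals the explicit \<open>f'\<close>, so the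
  closure rules below merely have to name a derivative.\<close>

lemma Ck_onI_deriv:
  assumes "open S" "\<And>x. x \<in> S \<Longrightarrow> (f has_derivative f' x) (at x)"
    and "\<And>v. Ck_on k S (\<lambda>x. f' x v)"
  shows "Ck_on (Suc k) S f"
proof -
  have "frechet_derivative f (at x) = f' x" if "x \<in> S" for x
    using frechet_derivative_at[OF assms(2)[OF that]] by simp
  then show ?thesis
    using assms Ck_on_cong[OF assms(1), of k "\<lambda>x. f' x _" "\<lambda>x. frechet_derivative f (at x) _"]
    by (auto simp: differentiable_def)
qed

lemma Ck_on_has_derivative:
  assumes "Ck_on (Suc k) S f" "x \<in> S"
  shows "(f has_derivative frechet_derivative f (at x)) (at x)"
  using assms frechet_derivative_works by auto

lemma Ck_on_const [simp]: "Ck_on k S (\<lambda>x. c)"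
  by (induction k arbitrary: c) auto

lemma Ck_on_linear:
  assumes "bounded_linear L" "open S"
  shows "Ck_on k S L"
proof (cases k)
  case 0
  then show ?thesis using assms by (simp add: linear_continuous_on)
next
  case (Suc j)
  show ?thesis unfolding Suc
    by (rule Ck_onI_deriv[where f' = "\<lambda>x. L"])
      (use assms in \<open>auto simp: bounded_linear_imp_has_derivative\<close>)
qed

lemma Ck_on_bounded_linear:
  assumes "bounded_linear L" "open S" "Ck_on k S f"
  shows "Ck_on k S (\<lambda>x. L (f x))"
  using assms(3)
proof (induction k arbitrary: f)
  case 0
  then show ?case using assms(1)
    by (auto intro: continuous_on_compose2[OF linear_continuous_on[OF assms(1)]])
next
  case (Suc k)
  show ?case
    by (rule Ck_onI_deriv[OF assms(2), where f' = "\<lambda>x v. L (frechet_derivative f (at x) v)"])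
      (use Suc Ck_on_has_derivative[OF Suc.prems] in
        \<open>auto intro: bounded_linear.has_derivative[OF assms(1)]\<close>)
qed

lemma Ck_on_add:
  assumes "open S" "Ck_on k S f" "Ck_on k S g"
  shows "Ck_on k S (\<lambda>x. f x + g x)"
  using assms(2,3)
proof (induction k arbitrary: f g)
  case 0
  then show ?case by (auto intro: continuous_intros)
next
  case (Suc k)
  show ?case
    by (rule Ck_onI_deriv[OF assms(1), where f' = "\<lambda>x v. frechet_derivative f (at x) v + frechet_derivative g (at x) v"])
      (use Suc Ck_on_has_derivative[OF Suc.prems(1)] Ck_on_has_derivative[OF Suc.prems(2)] in
        \<open>auto intro!: has_derivative_add\<close>)
qed

lemma Ck_on_sum:
  assumes "open S" "\<And>i. i \<in> I \<Longrightarrow> Ck_on k S (f i)"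
  shows "Ck_on k S (\<lambda>x. \<Sum>i\<in>I. f i x)"
  using assms(2) by (induction I rule: infinite_finite_induct) (auto intro: Ck_on_add[OF assms(1)])

lemma Ck_on_bilinear:
  assumes "bounded_bilinear B" "open S" "Ck_on k S f" "Ck_on k S g"
  shows "Ck_on k S (\<lambda>x. B (f x) (g x))"
  using assms(3,4)
proof (induction k arbitrary: f g)
  case 0
  then show ?case using bounded_bilinear.continuous_on[OF assms(1)] by auto
next
  case (Suc k)
  note d = Ck_on_has_derivative[OF Suc.prems(1)] Ck_on_has_derivative[OF Suc.prems(2)]
  show ?case
    by (rule Ck_onI_deriv[OF assms(2), where f' = "\<lambda>x v. B (f x) (frechet_derivative g (at x) v)
          + B (frechet_derivative f (at x) v) (g x)"])
      (use Suc d Ck_on_SucD[OF Suc.prems(1)] Ck_on_SucD[OF Suc.prems(2)] in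
        \<open>auto intro!: bounded_bilinear.FDERIV[OF assms(1)] Ck_on_add[OF assms(2)]\<close>)
qed

lemmas Ck_on_scaleR = Ck_on_bilinear[OF bounded_bilinear_scaleR]
lemmas Ck_on_mult = Ck_on_bilinear[OF bounded_bilinear_mult]

lemma Ck_on_compose:
  fixes f :: "'e::euclidean_space \<Rightarrow> 'f::euclidean_space"
  assumes "open S" "open T" "f ` S \<subseteq> T" "Ck_on k T g" "Ck_on k S f"
  shows "Ck_on k S (\<lambda>x. g (f x))"
  using assms(4,5)
proof (induction k arbitrary: g)
  case 0
  then show ?case using assms(3) by (auto intro: continuous_on_compose2)
next
  case (Suc k)
  let ?f' = "\<lambda>x. frechet_derivative f (at x)" and ?g' = "\<lambda>y. frechet_derivative g (at y)"
  have fx: "f x \<in> T" if "x \<in> S" for x using assms(3) that by auto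
  \<comment> \<open>\<open>Ck_on\<close> controls derivatives in fixed directions only. The
    direction \<open>?f' x v\<close> moves with \<open>x\<close>, so it is expanded in the basis and
    the chain rule becomes a finite sum of products.\<close>
  have lin: "?g' y w = (\<Sum>b\<in>Basis. (w \<bullet> b) *\<^sub>R ?g' y b)" if "y \<in> T" for y w
  proof -
    have "linear (?g' y)"
      using Ck_on_has_derivative[OF Suc.prems(1) that] has_derivative_bounded_linear
        bounded_linear.linear by blast
    then have "?g' y (\<Sum>b\<in>Basis. (w \<bullet> b) *\<^sub>R b) = (\<Sum>b\<in>Basis. (w \<bullet> b) *\<^sub>R ?g' y b)"
      by (simp add: linear_sum linear_scale o_def)
    then show ?thesis by (simp add: euclidean_representation)
  qed
  show ?case
  proof (rule Ck_onI_deriv[OF assms(1), where f' = "\<lambda>x v. ?g' (f x) (?f' x v)"])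
    show "((\<lambda>x. g (f x)) has_derivative (\<lambda>v. ?g' (f x) (?f' x v))) (at x)" if "x \<in> S" for x
      using diff_chain_at[OF Ck_on_has_derivative[OF Suc.prems(2) that]
          Ck_on_has_derivative[OF Suc.prems(1) fx[OF that]]]
      by (simp add: o_def)
    have "Ck_on k S (\<lambda>x. \<Sum>b\<in>Basis. (?f' x v \<bullet> b) *\<^sub>R ?g' (f x) b)" for v
    proof (intro Ck_on_sum Ck_on_scaleR assms(1))
      fix b :: 'f assume "b \<in> Basis"
      show "Ck_on k S (\<lambda>x. ?f' x v \<bullet> b)"
        by (rule Ck_on_bounded_linear[OF bounded_linear_inner_left assms(1)]) (use Suc.prems in auto)
      show "Ck_on k S (\<lambda>x. ?g' (f x) b)"
        by (rule Suc.IH) (use Suc.prems Ck_on_SucD[OF Suc.prems(2)] in auto)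
    qed
    then show "Ck_on k S (\<lambda>x. ?g' (f x) (?f' x v))" for v
      by (rule Ck_on_cong[OF assms(1)]) (rule lin[OF fx, symmetric])
  qed
qed

lemma smooth_onD: "smooth_on S f \<Longrightarrow> Ck_on k S f"
  by (simp add: smooth_on_def)

lemma smooth_on_subset: "smooth_on S f \<Longrightarrow> T \<subseteq> S \<Longrightarrow> smooth_on T f"
  unfolding smooth_on_def using Ck_on_subset by blast

lemma smooth_on_cong:
  "open S \<Longrightarrow> smooth_on S f \<Longrightarrow> (\<And>x. x \<in> S \<Longrightarrow> f x = g x) \<Longrightarrow> smooth_on S g"
  unfolding smooth_on_def using Ck_on_cong by blast

lemma smooth_on_local:
  assumes "\<And>x. x \<in> S \<Longrightarrow> \<exists>T. open T \<and> x \<in> T \<and> smooth_on T f"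
  shows "smooth_on S f"
  unfolding smooth_on_def
proof
  fix k
  show "Ck_on k S f"
    by (rule Ck_on_local) (use assms in \<open>unfold smooth_on_def, blast\<close>)
qed

lemma smooth_on_const [simp]: "smooth_on S (\<lambda>x. c)"
  by (simp add: smooth_on_def)

lemma smooth_on_linear: "bounded_linear L \<Longrightarrow> open S \<Longrightarrow> smooth_on S L"
  by (simp add: smooth_on_def Ck_on_linear)

lemma smooth_on_bounded_linear:
  "bounded_linear L \<Longrightarrow> open S \<Longrightarrow> smooth_on S f \<Longrightarrow> smooth_on S (\<lambda>x. L (f x))"
  by (simp add: smooth_on_def Ck_on_bounded_linear)

lemma smooth_on_add:
  "open S \<Longrightarrow> smooth_on S f \<Longrightarrow> smooth_on S g \<Longrightarrow> smooth_on S (\<lambda>x. f x + g x)"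
  by (simp add: smooth_on_def Ck_on_add)

lemma smooth_on_mult:
  fixes f g :: "'e::euclidean_space \<Rightarrow> real"
  shows "open S \<Longrightarrow> smooth_on S f \<Longrightarrow> smooth_on S g \<Longrightarrow> smooth_on S (\<lambda>x. f x * g x)"
  by (simp add: smooth_on_def Ck_on_mult)

lemma smooth_on_compose:
  fixes f :: "'e::euclidean_space \<Rightarrow> 'f::euclidean_space"
  shows "open S \<Longrightarrow> open T \<Longrightarrow> f ` S \<subseteq> T \<Longrightarrow> smooth_on T g \<Longrightarrow> smooth_on S f
    \<Longrightarrow> smooth_on S (\<lambda>x. g (f x))"
  unfolding smooth_on_def using Ck_on_compose by blast

lemma smooth_on_Pair:
  assumes "open S" "smooth_on S f" "smooth_on S g"
  shows "smooth_on S (\<lambda>x. (f x, g x))"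
proof -
  have l: "bounded_linear (\<lambda>u::'b. (u, 0::'c))" "bounded_linear (\<lambda>u::'c. (0::'b, u))"
    by (intro bounded_linear_Pair bounded_linear_ident bounded_linear_zero)+
  have "smooth_on S (\<lambda>x. (f x, 0) + (0, g x))"
    using assms smooth_on_bounded_linear[OF l(1) assms(1,2)]
      smooth_on_bounded_linear[OF l(2) assms(1,3)] smooth_on_add by blast
  then show ?thesis by simp
qed

lemma smooth_on_frechet_derivative:
  "smooth_on S f \<Longrightarrow> smooth_on S (\<lambda>x. frechet_derivative f (at x) v)"
  unfolding smooth_on_def
proof
  fix k assume "\<forall>k. Ck_on k S f"
  then have "Ck_on (Suc k) S f" by blast
  then show "Ck_on k S (\<lambda>x. frechet_derivative f (at x) v)" by simp
qed

lemma smooth_on_has_derivative: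
  "smooth_on S f \<Longrightarrow> x \<in> S \<Longrightarrow> (f has_derivative frechet_derivative f (at x)) (at x)"
  using Ck_on_has_derivative smooth_onD by blast

section \<open>Bump functions and the Hadamard lemma\<close>

text \<open>The polynomial factor makes the family closed under differentiation, so that smoothness
  of all its members is a single induction on the order.\<close>

definition flat :: "real poly \<Rightarrow> real \<Rightarrow> real" where
  "flat p x = (if x > 0 then poly p (1 / x) * exp (- 1 / x) else 0)"

text \<open>The power \<open>t ^ n\<close> is carried along for the induction on the polynomial:
  peeling off a coefficient leaves a factor \<open>t\<close>, which raises \<open>n\<close> by
  one.\<close>

lemma tendsto_poly_mult_exp_minus:
  fixes p :: "real poly"
  shows "((\<lambda>t. t ^ n * poly p t * exp (- t)) \<longlongrightarrow> 0) at_top"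
proof (induction p arbitrary: n)
  case 0
  then show ?case by simp
next
  case (pCons a p)
  have "((\<lambda>t. a * (t ^ n / exp t) + t ^ Suc n * poly p t * exp (- t)) \<longlongrightarrow> a * 0 + 0) at_top"
    by (intro tendsto_intros tendsto_power_div_exp_0 pCons.IH)
  then show ?case by (simp add: algebra_simps exp_minus divide_inverse)
qed

text \<open>With s = 1 / x one has d/dx = - s^2 d/ds, and differentiating p(s) exp(- s) in s gives
  (p' - p)(s) exp(- s). Hence the polynomial s^2 (p - p') on the right.\<close>

lemma flat_has_derivative:
  "(flat p has_real_derivative flat (monom 1 2 * (p - pderiv p)) x) (at x)"
proof -
  consider "x < 0" | "x > 0" | "x = 0" by linarith
  then show ?thesis
  proof cases
    case 1
    have "((\<lambda>x. 0) has_real_derivative 0) (at x)" by simp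
    then have "(flat p has_real_derivative 0) (at x)"
      by (rule has_field_derivative_transform_within_open[where S = "{..<0}"])
        (use 1 in \<open>auto simp: flat_def\<close>)
    then show ?thesis using 1 by (simp add: flat_def)
  next
    case 2
    have "((\<lambda>x. poly p (1 / x) * exp (- 1 / x)) has_real_derivative
        poly (pderiv p) (1 / x) * (- 1 / x\<^sup>2) * exp (- 1 / x) + poly p (1 / x) * (exp (- 1 / x) * (1 / x\<^sup>2))) (at x)"
      using 2 by (auto intro!: derivative_eq_intros DERIV_chain2[OF poly_DERIV] simp: power2_eq_square field_simps)
    then have "(flat p has_real_derivative
        poly (pderiv p) (1 / x) * (- 1 / x\<^sup>2) * exp (- 1 / x) + poly p (1 / x) * (exp (- 1 / x) * (1 / x\<^sup>2))) (at x)"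
      by (rule has_field_derivative_transform_within_open[where S = "{0<..}"])
        (use 2 in \<open>auto simp: flat_def\<close>)
    then show ?thesis using 2 by (simp add: flat_def poly_monom field_simps)
  next
    case 3
    have "((\<lambda>y. (flat p y - flat p 0) / (y - 0)) \<longlongrightarrow> 0) (at_left 0)"
      by (rule tendsto_eventually) (auto simp: flat_def eventually_at_left_field intro!: exI[of _ "-1"])
    \<comment> \<open>The substitution t = 1 / y turns the quotient into t p(t) exp(- t), the case
      \<open>n = 1\<close> of the limit above.\<close>
    moreover have "((\<lambda>y. (flat p y - flat p 0) / (y - 0)) \<longlongrightarrow> 0) (at_right 0)"
    proof -
      have "((\<lambda>y. inverse y ^ 1 * poly p (inverse y) * exp (- inverse y)) \<longlongrightarrow> 0) (at_right 0)"
        by (rule filterlim_compose[OF tendsto_poly_mult_exp_minus filterlim_inverse_at_top_right])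
      then show ?thesis
        by (rule Lim_transform_eventually)
          (auto simp: flat_def eventually_at_right_field divide_inverse ac_simps intro!: exI[of _ 1])
    qed
    ultimately have "((\<lambda>y. (flat p y - flat p 0) / (y - 0)) \<longlongrightarrow> 0) (at 0)"
      by (rule filterlim_split_at)
    then show ?thesis using 3 by (simp add: has_field_derivative_iff flat_def)
  qed
qed

lemma smooth_on_flat: "smooth_on UNIV (flat p)"
proof -
  have "Ck_on k UNIV (flat p)" for k
  proof (induction k arbitrary: p)
    case 0
    have "isCont (flat p) x" for x using flat_has_derivative DERIV_isCont by blast
    then show ?case by (simp add: continuous_at_imp_continuous_on)
  next
    case (Suc k)
    let ?q = "monom 1 2 * (p - pderiv p)"
    show ?case
    proof (rule Ck_onI_deriv[where f' = "\<lambda>x v. flat ?q x * v"])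
      show "(flat p has_derivative (*) (flat ?q x)) (at x)" for x
        using flat_has_derivative by (simp only: has_field_derivative_def)
      show "Ck_on k UNIV (\<lambda>x. flat ?q x * v)" for v
        using Suc by (intro Ck_on_mult) auto
    qed simp
  qed
  then show ?thesis by (simp add: smooth_on_def)
qed

text \<open>Reflecting the flat function below its value at \<open>1\<close> and flattening again gives a smooth
  step without any division of functions.\<close>

lemma smooth_step:
  obtains s :: "real \<Rightarrow> real"
  where "smooth_on UNIV s" "\<And>t. t \<le> 0 \<Longrightarrow> s t = 1" "\<And>t. t \<ge> 1 \<Longrightarrow> s t = 0"
proof
  let ?h = "flat 1"
  let ?s = "\<lambda>t. (1 / ?h (?h 1)) * ?h (?h 1 + - 1 * ?h t)"
  have pos: "?h t > 0" if "t > 0" for t using that by (simp add: flat_def)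
  have "smooth_on UNIV (\<lambda>t. ?h 1 + - 1 * ?h t)"
    by (intro smooth_on_add smooth_on_mult smooth_on_const smooth_on_flat open_UNIV)
  then have "smooth_on UNIV (\<lambda>t. ?h (?h 1 + - 1 * ?h t))"
    by (rule smooth_on_compose[OF open_UNIV open_UNIV subset_UNIV smooth_on_flat])
  then show "smooth_on UNIV ?s"
    by (intro smooth_on_mult smooth_on_const open_UNIV)
  show "?s t = 1" if "t \<le> 0" for t
  proof -
    have "?h t = 0" using that by (simp add: flat_def)
    then show ?thesis using pos[OF pos[of 1]] by simp
  qed
  show "?s t = 0" if "t \<ge> 1" for t
  proof -
    have "?h t \<ge> ?h 1" using that by (simp add: flat_def)
    then show ?thesis by (simp add: flat_def)
  qed
qed

lemma smooth_bump:
  fixes c :: "'e::euclidean_space"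
  assumes "r > 0"
  obtains \<eta> :: "'e \<Rightarrow> real"
  where "smooth_on UNIV \<eta>" "\<And>x. x \<in> ball c (r / 2) \<Longrightarrow> \<eta> x = 1" "\<And>x. x \<notin> ball c r \<Longrightarrow> \<eta> x = 0"
proof -
  obtain s :: "real \<Rightarrow> real" where s: "smooth_on UNIV s" "\<And>t. t \<le> 0 \<Longrightarrow> s t = 1" "\<And>t. t \<ge> 1 \<Longrightarrow> s t = 0"
    using smooth_step by blast
  \<comment> \<open>The squared distance is smooth also at the centre. The constants put the ball of
    radius r/2 below -1/2, where the step is 1, and the complement of the ball of radius r above or
    at 1, where it is 0.\<close>
  let ?a = "\<lambda>x. (2 / r\<^sup>2) * ((x + - c) \<bullet> (x + - c)) + - 1"
  have d: "smooth_on UNIV (\<lambda>x::'e. x + - c)"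
    by (intro smooth_on_add smooth_on_const smooth_on_linear bounded_linear_ident open_UNIV)
  have "smooth_on UNIV (\<lambda>x. (x + - c) \<bullet> (x + - c))"
    unfolding smooth_on_def
    by (intro allI Ck_on_bilinear[OF bounded_bilinear_inner open_UNIV] smooth_onD[OF d])
  then have "smooth_on UNIV ?a" by (intro smooth_on_add smooth_on_mult smooth_on_const open_UNIV)
  then have sm: "smooth_on UNIV (\<lambda>x. s (?a x))"
    by (rule smooth_on_compose[OF open_UNIV open_UNIV subset_UNIV s(1)])
  have a: "?a x = 2 * (dist c x / r)\<^sup>2 - 1" for x
    by (simp add: dist_norm norm_minus_commute power_divide dot_square_norm)
  show thesis
  proof (rule that[OF sm])
    show "s (?a x) = 1" if "x \<in> ball c (r / 2)" for x
    proof (rule s(2))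
      have "dist c x / r \<le> 1 / 2" using that assms by (simp add: field_simps)
      then have "(dist c x / r)\<^sup>2 \<le> (1 / 2)\<^sup>2" using assms by (intro power_mono) auto
      moreover have "(1 / 2)\<^sup>2 = (1 / 4 :: real)" by (simp add: power2_eq_square)
      ultimately show "?a x \<le> 0" unfolding a by linarith
    qed
    show "s (?a x) = 0" if "x \<notin> ball c r" for x
    proof (rule s(3))
      have "1 \<le> dist c x / r" using that assms by (simp add: field_simps)
      then have "1\<^sup>2 \<le> (dist c x / r)\<^sup>2" by (intro power_mono) auto
      then show "?a x \<ge> 1" unfolding a by simp
    qed
  qed
qed

text \<open>Differentiation under the integral sign replaces \<open>w\<close> by a directional
  derivative and, by the chain rule, produces one more factor \<open>t\<close>. The statement is
  therefore general in \<open>m\<close> and \<open>w\<close>.\<close>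

lemma Ck_on_segment_integral:
  fixes w :: "'e::euclidean_space \<Rightarrow> real"
  assumes "\<And>k. Ck_on k UNIV w"
  shows "Ck_on k UNIV (\<lambda>x. integral {0..1} (\<lambda>t. t ^ m * w (c + t *\<^sub>R (x - c))))"
  using assms
proof (induction k arbitrary: m w)
  case 0
  have "continuous_on UNIV w" using 0[of 0] by simp
  then have "continuous_on (UNIV \<times> cbox 0 1) (\<lambda>(x, t). t ^ m * w (c + t *\<^sub>R (x - c)))"
    unfolding split_beta by (auto intro!: continuous_intros continuous_on_compose2[of UNIV w])
  from integral_continuous_on_param[OF this] show ?case by simp
next
  case (Suc k)
  let ?w' = "\<lambda>x. frechet_derivative w (at x)"
  have w': "Ck_on j UNIV (\<lambda>x. ?w' x v)" for j v using Suc.prems[of "Suc j"] by simp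
  have wd: "(w has_derivative ?w' x) (at x)" for x
    using Ck_on_has_derivative[OF Suc.prems[of "Suc 0"]] by simp
  have lin: "bounded_linear (?w' x)" for x using wd has_derivative_bounded_linear by blast
  have ct: "continuous_on UNIV (\<lambda>x. ?w' x v)" for v using w'[of 0] by simp
  have cw: "continuous_on UNIV w" using Suc.prems[of 0] by simp
  let ?y = "\<lambda>x t. c + t *\<^sub>R (x - c)"
  \<comment> \<open>\<open>leibniz_rule\<close> takes the derivative as a continuous family of
    bounded linear maps; in finite dimension its continuity may be checked in each direction
    separately.\<close>
  define F where "F x t = Blinfun (\<lambda>v. t ^ Suc m * ?w' (?y x t) v)" for x t
  have F: "blinfun_apply (F x t) = (\<lambda>v. t ^ Suc m * ?w' (?y x t) v)" for x t
    unfolding F_def by (intro bounded_linear_Blinfun_apply bounded_linear_const_mult lin)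
  have cF: "continuous_on (UNIV \<times> cbox 0 1) (\<lambda>(x, t). F x t)"
    unfolding split_beta
    by (rule continuous_on_blinfun_componentwise)
      (auto simp: F intro!: continuous_intros continuous_on_compose2[OF ct])
  have D: "((\<lambda>x. integral {0..1} (\<lambda>t. t ^ m * w (?y x t))) has_derivative
      (\<lambda>v. integral {0..1} (\<lambda>t. t ^ Suc m * ?w' (?y x t) v))) (at x)" for x
  proof -
    have "((\<lambda>x. integral (cbox 0 1) (\<lambda>t. t ^ m * w (?y x t))) has_derivative
        blinfun_apply (integral (cbox 0 1) (F x))) (at x within UNIV)"
    proof (rule leibniz_rule[OF _ _ cF])
      fix x :: 'e and t :: real
      have "((\<lambda>x. w (?y x t)) has_derivative (\<lambda>v. ?w' (?y x t) (t *\<^sub>R v))) (at x)"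
        by (rule has_derivative_compose[OF _ wd]) (auto intro!: derivative_eq_intros)
      then have "((\<lambda>x. t ^ m * w (?y x t)) has_derivative (\<lambda>v. t ^ m * ?w' (?y x t) (t *\<^sub>R v))) (at x)"
        by (rule has_derivative_mult_right)
      then show "((\<lambda>x. t ^ m * w (?y x t)) has_derivative blinfun_apply (F x t)) (at x within UNIV)"
        by (simp add: F linear_scale[OF bounded_linear.linear[OF lin]] mult.assoc mult.commute[of t])
      show "(\<lambda>t. t ^ m * w (?y x t)) integrable_on cbox 0 1"
        by (intro integrable_continuous continuous_intros continuous_on_compose2[OF cw]) auto
    qed auto
    moreover have "blinfun_apply (integral (cbox 0 1) (F x)) v = integral (cbox 0 1) (\<lambda>t. F x t v)" for v
    proof (rule blinfun_apply_integral)
      show "F x integrable_on cbox 0 1"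
        using continuous_on_compose2[OF cF, of "cbox 0 1" "\<lambda>t. (x, t)"]
        by (intro integrable_continuous) (auto simp: continuous_on_Pair)
    qed
    ultimately show ?thesis by (simp add: F has_derivative_eq_rhs[OF _ ext])
  qed
  show ?case
    by (rule Ck_onI_deriv[OF open_UNIV D]) (rule Suc.IH[OF w'])
qed

text \<open>Integrate the derivative of \<open>u\<close> along the segment from \<open>c\<close> to
  \<open>x\<close> and expand the direction \<open>x - c\<close> in the basis. The coefficients are
  the averages of the partial derivatives over the segment, which are smooth in
  \<open>x\<close>.\<close>

lemma smooth_hadamard:
  fixes u :: "'e::euclidean_space \<Rightarrow> real"
  assumes "smooth_on UNIV u"
  obtains g :: "'e \<Rightarrow> 'e \<Rightarrow> real"
  where "\<And>b. smooth_on UNIV (g b)" "\<And>b. g b c = frechet_derivative u (at c) b"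
    "\<And>x. u x = u c + (\<Sum>b\<in>Basis. ((x - c) \<bullet> b) * g b x)"
proof -
  let ?u' = "\<lambda>x. frechet_derivative u (at x)"
  let ?y = "\<lambda>x t. c + t *\<^sub>R (x - c)"
  \<comment> \<open>The factor \<open>t ^ 0\<close> matches \<open>Ck_on_segment_integral\<close>
    with \<open>m = 0\<close>.\<close>
  define g where "g b x = integral {0..1} (\<lambda>t. t ^ 0 * ?u' (?y x t) b)" for b x
  have u': "smooth_on UNIV (\<lambda>x. ?u' x v)" for v
    using smooth_on_frechet_derivative[OF assms] .
  have d: "(u has_derivative ?u' x) (at x)" for x
    using smooth_on_has_derivative[OF assms] by simp
  have ct: "continuous_on UNIV (\<lambda>x. ?u' x v)" for v using smooth_onD[OF u', of 0] by simp
  have "smooth_on UNIV (g b)" for b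
    unfolding g_def[abs_def] smooth_on_def
    by (intro allI Ck_on_segment_integral) (use u' in \<open>simp add: smooth_on_def\<close>)
  moreover have "g b c = ?u' c b" for b by (simp add: g_def)
  moreover have "u x = u c + (\<Sum>b\<in>Basis. ((x - c) \<bullet> b) * g b x)" for x
  proof -
    have "((\<lambda>t. u (?y x t)) has_vector_derivative ?u' (?y x t) (x - c)) (at t within {0..1})" for t
    proof -
      have "((\<lambda>t. u (?y x t)) has_derivative (\<lambda>s. ?u' (?y x t) (s *\<^sub>R (x - c)))) (at t within {0..1})"
        by (rule has_derivative_compose[OF _ d]) (auto intro!: derivative_eq_intros)
      then show ?thesis
        using linear_scale[OF has_derivative_linear[OF d]] by (simp add: has_vector_derivative_def)
    qed
    then have "((\<lambda>t. ?u' (?y x t) (x - c)) has_integral u (?y x 1) - u (?y x 0)) {0..1}"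
      by (intro fundamental_theorem_of_calculus) auto
    then have 1: "u x - u c = integral {0..1} (\<lambda>t. ?u' (?y x t) (x - c))"
      by (simp add: integral_unique)
    have "?u' z (x - c) = (\<Sum>b\<in>Basis. ((x - c) \<bullet> b) * ?u' z b)" for z
    proof -
      have "?u' z (\<Sum>b\<in>Basis. ((x - c) \<bullet> b) *\<^sub>R b) = (\<Sum>b\<in>Basis. ((x - c) \<bullet> b) * ?u' z b)"
        using has_derivative_linear[OF d] by (simp add: linear_sum linear_scale o_def)
      then show ?thesis by (simp add: euclidean_representation)
    qed
    then have "u x - u c = integral {0..1} (\<lambda>t. \<Sum>b\<in>Basis. ((x - c) \<bullet> b) * ?u' (?y x t) b)"
      using 1 by simp
    also have "\<dots> = (\<Sum>b\<in>Basis. integral {0..1} (\<lambda>t. ((x - c) \<bullet> b) * ?u' (?y x t) b))"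
      by (intro integral_sum integrable_continuous_interval continuous_intros
          continuous_on_compose2[OF ct]) auto
    finally show ?thesis by (simp add: g_def)
  qed
  ultimately show thesis using that by blast
qed

section \<open>Smooth functions on a manifold\<close>

locale smooth_manifold =
  fixes A :: "('a::{t2_space, second_countable_topology}, 'e::euclidean_space) atlas"
  assumes atlas: "smooth_atlas A"
begin

lemma chart:
  assumes "(U, \<phi>) \<in> A"
  shows chart_open: "open U" and chart_image_open: "open (\<phi> ` U)"
    and chart_homeo: "homeomorphism U (\<phi> ` U) \<phi> (inv_into U \<phi>)"
  using atlas assms by (auto simp: smooth_atlas_def)

lemma chart_inv [simp]: "(U, \<phi>) \<in> A \<Longrightarrow> q \<in> U \<Longrightarrow> inv_into U \<phi> (\<phi> q) = q"
  using chart_homeo by (auto simp: homeomorphism_def)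

lemma chart_image_sub_open:
  assumes "(U, \<phi>) \<in> A" "open W"
  shows "open (\<phi> ` (U \<inter> W))"
  by (rule openin_open_trans[OF homeomorphism_imp_open_map[OF chart_homeo] chart_image_open])
    (use assms in \<open>auto intro: openin_open_Int\<close>)

lemma chart_preimage_open: "(U, \<phi>) \<in> A \<Longrightarrow> open N \<Longrightarrow> open {q\<in>U. \<phi> q \<in> N}"
proof -
  assume a: "(U, \<phi>) \<in> A" "open N"
  have "continuous_on U \<phi>" using chart_homeo[OF a(1)] by (simp add: homeomorphism_def)
  then have "open (\<phi> -` N \<inter> U)"
    using a(2) continuous_on_open_vimage[OF chart_open[OF a(1)]] by blast
  then show ?thesis by (simp add: vimage_def Int_def conj_commute)
qed

lemma ex_chart: obtains U \<phi> where "(U, \<phi>) \<in> A" "p \<in> U"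
proof -
  have "p \<in> (\<Union>(U, \<phi>)\<in>A. U)" using atlas by (simp add: smooth_atlas_def)
  then show thesis using that by auto
qed

lemma chart_transition:
  assumes "(U, \<phi>) \<in> A" "(V, \<psi>) \<in> A"
  shows "smooth_on (\<phi> ` (U \<inter> V)) (\<lambda>x. \<psi> (inv_into U \<phi> x))"
proof -
  have "\<forall>(U, \<phi>)\<in>A. \<forall>(V, \<psi>)\<in>A. smooth_on (\<phi> ` (U \<inter> V)) (\<psi> \<circ> inv_into U \<phi>)"
    using atlas unfolding smooth_atlas_def by (elim conjE)
  from bspec[OF bspec[OF this assms(1), simplified] assms(2)] show ?thesis by (simp add: o_def)
qed

lemma smooth_chart:
  "h \<in> smooth_funs A \<Longrightarrow> (U, \<phi>) \<in> A \<Longrightarrow> smooth_on (\<phi> ` U) (\<lambda>x. h (inv_into U \<phi> x))"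
  by (auto simp: smooth_funs_def o_def)

lemma smooth_funsI:
  "(\<And>U \<phi>. (U, \<phi>) \<in> A \<Longrightarrow> smooth_on (\<phi> ` U) (\<lambda>x. h (inv_into U \<phi> x))) \<Longrightarrow> h \<in> smooth_funs A"
  by (auto simp: smooth_funs_def o_def)

lemma smooth_const [simp, intro]: "(\<lambda>x. c) \<in> smooth_funs A"
  by (rule smooth_funsI) simp

lemma smooth_add [intro]:
  "h \<in> smooth_funs A \<Longrightarrow> k \<in> smooth_funs A \<Longrightarrow> (\<lambda>x. h x + k x) \<in> smooth_funs A"
  by (rule smooth_funsI) (rule smooth_on_add[OF chart_image_open smooth_chart smooth_chart])

lemma smooth_mult [intro]:
  "h \<in> smooth_funs A \<Longrightarrow> k \<in> smooth_funs A \<Longrightarrow> (\<lambda>x. h x * k x) \<in> smooth_funs A"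
  by (rule smooth_funsI) (rule smooth_on_mult[OF chart_image_open smooth_chart smooth_chart])

lemma smooth_minus [intro]:
  "h \<in> smooth_funs A \<Longrightarrow> k \<in> smooth_funs A \<Longrightarrow> (\<lambda>x. h x - k x) \<in> smooth_funs A"
  using smooth_add[of h "\<lambda>x. - 1 * k x"] smooth_mult[OF smooth_const[of "- 1"], of k] by simp

lemma smooth_sum [intro]:
  "(\<And>i. i \<in> I \<Longrightarrow> h i \<in> smooth_funs A) \<Longrightarrow> (\<lambda>x. \<Sum>i\<in>I. h i x) \<in> smooth_funs A"
  by (induction I rule: infinite_finite_induct) auto

lemma smooth_funs_local:
  assumes "\<And>p. \<exists>W g. open W \<and> p \<in> W \<and> g \<in> smooth_funs A \<and> (\<forall>q\<in>W. h q = g q)"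
  shows "h \<in> smooth_funs A"
proof (intro smooth_funsI smooth_on_local)
  fix U \<phi> x assume c: "(U, \<phi>) \<in> A" and "x \<in> \<phi> ` U"
  then obtain p where p: "p \<in> U" "x = \<phi> p" by auto
  obtain W g where W: "open W" "p \<in> W" "g \<in> smooth_funs A" "\<And>q. q \<in> W \<Longrightarrow> h q = g q"
    using assms by metis
  have o: "open (\<phi> ` (U \<inter> W))" using chart_image_sub_open[OF c W(1)] .
  have "smooth_on (\<phi> ` (U \<inter> W)) (\<lambda>x. g (inv_into U \<phi> x))"
    by (rule smooth_on_subset[OF smooth_chart[OF W(3) c]]) auto
  then have "smooth_on (\<phi> ` (U \<inter> W)) (\<lambda>x. h (inv_into U \<phi> x))"
    by (rule smooth_on_cong[OF o]) (use c W(4) in auto)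
  then show "\<exists>T. open T \<and> x \<in> T \<and> smooth_on T (\<lambda>x. h (inv_into U \<phi> x))"
    using o p W(2) by blast
qed

text \<open>The closed ball corresponds to a compact set in the chart domain, which is closed in the
  whole manifold because the manifold is Hausdorff. The chart domain and the complement of this
  compact set are thus open and cover the manifold; the extension is smooth on each.\<close>

lemma smooth_extend_zero:
  assumes c: "(U, \<phi>) \<in> A" and cb: "cball c r \<subseteq> \<phi> ` U" and u: "smooth_on (\<phi> ` U) u"
    and z: "\<And>x. x \<notin> cball c r \<Longrightarrow> u x = 0"
  shows "(\<lambda>q. if q \<in> U then u (\<phi> q) else 0) \<in> smooth_funs A" (is "?h \<in> _")
proof (intro smooth_funsI smooth_on_local)
  fix V \<psi> x assume v: "(V, \<psi>) \<in> A" and "x \<in> \<psi> ` V"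
  then obtain q where q: "q \<in> V" "x = \<psi> q" by auto
  show "\<exists>T. open T \<and> x \<in> T \<and> smooth_on T (\<lambda>x. ?h (inv_into V \<psi> x))"
  proof (cases "q \<in> U")
    case True
    have o: "open (\<psi> ` (V \<inter> U))" using chart_image_sub_open[OF v chart_open[OF c]] .
    have "smooth_on (\<psi> ` (V \<inter> U)) (\<lambda>x. u (\<phi> (inv_into V \<psi> x)))"
      by (rule smooth_on_compose[OF o chart_image_open[OF c] _ u chart_transition[OF v c]]) (use v in auto)
    then have "smooth_on (\<psi> ` (V \<inter> U)) (\<lambda>x. ?h (inv_into V \<psi> x))"
      by (rule smooth_on_cong[OF o]) (use v in auto)
    then show ?thesis using o q True by blast
  next
    case False
    let ?K = "inv_into U \<phi> ` cball c r"
    have K: "?K \<subseteq> U" using cb c by auto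
    have "continuous_on (cball c r) (inv_into U \<phi>)"
      using chart_homeo[OF c] cb continuous_on_subset by (auto simp: homeomorphism_def)
    then have "closed ?K" by (intro compact_imp_closed compact_continuous_image compact_cball)
    then have o: "open (\<psi> ` (V \<inter> - ?K))" by (intro chart_image_sub_open[OF v]) auto
    have "smooth_on (\<psi> ` (V \<inter> - ?K)) (\<lambda>x. ?h (inv_into V \<psi> x))"
    proof (rule smooth_on_cong[OF o smooth_on_const])
      fix y assume "y \<in> \<psi> ` (V \<inter> - ?K)"
      then obtain p where p: "p \<in> V" "p \<notin> ?K" "y = \<psi> p" by auto
      have "\<phi> p \<notin> cball c r" if "p \<in> U" using p(2) that chart_inv[OF c that] by force
      then show "0 = ?h (inv_into V \<psi> y)" using p v z by auto
    qed
    then show ?thesis using o q False K by blast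
  qed
qed

text \<open>Two extensions by zero are recorded: to the manifold, since tangent vectors act on
  global functions, and to the whole Euclidean space, since \<open>smooth_hadamard\<close>
  integrates along segments that may leave the chart image.\<close>

definition chart_cutoff :: "'a set \<Rightarrow> ('a \<Rightarrow> 'e) \<Rightarrow> 'a \<Rightarrow> ('e \<Rightarrow> real) \<Rightarrow> 'e set \<Rightarrow> bool" where
  "chart_cutoff U \<phi> p \<eta> N \<longleftrightarrow> open N \<and> \<phi> p \<in> N \<and> N \<subseteq> \<phi> ` U \<and> (\<forall>x\<in>N. \<eta> x = 1) \<and>
    (\<forall>w. smooth_on (\<phi> ` U) w \<longrightarrow>
      (\<lambda>q. if q \<in> U then \<eta> (\<phi> q) * w (\<phi> q) else 0) \<in> smooth_funs A \<and>
      smooth_on UNIV (\<lambda>x. if x \<in> \<phi> ` U then \<eta> x * w x else 0))"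

lemma chart_cutoffD:
  assumes "chart_cutoff U \<phi> p \<eta> N"
  shows "open N" "\<phi> p \<in> N" "N \<subseteq> \<phi> ` U" "\<And>x. x \<in> N \<Longrightarrow> \<eta> x = 1"
    "\<And>w. smooth_on (\<phi> ` U) w \<Longrightarrow> (\<lambda>q. if q \<in> U then \<eta> (\<phi> q) * w (\<phi> q) else 0) \<in> smooth_funs A"
    "\<And>w. smooth_on (\<phi> ` U) w \<Longrightarrow> smooth_on UNIV (\<lambda>x. if x \<in> \<phi> ` U then \<eta> x * w x else 0)"
  using assms by (simp_all add: chart_cutoff_def)

lemma ex_chart_cutoff:
  assumes c: "(U, \<phi>) \<in> A" and p: "p \<in> U"
  obtains \<eta> N where "chart_cutoff U \<phi> p \<eta> N"
proof -
  obtain r where r: "r > 0" "cball (\<phi> p) r \<subseteq> \<phi> ` U"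
    using open_contains_cball chart_image_open[OF c] p by blast
  obtain \<eta> :: "'e \<Rightarrow> real" where \<eta>: "smooth_on UNIV \<eta>" "\<And>x. x \<in> ball (\<phi> p) (r / 2) \<Longrightarrow> \<eta> x = 1"
    "\<And>x. x \<notin> ball (\<phi> p) r \<Longrightarrow> \<eta> x = 0"
    using smooth_bump[OF r(1)] by metis
  note o = chart_image_open[OF c]
  have z: "\<eta> x = 0" if "x \<notin> cball (\<phi> p) r" for x using that \<eta>(3)[of x] by auto
  show thesis
  proof (rule that[of \<eta> "ball (\<phi> p) (r / 2)"], unfold chart_cutoff_def, intro conjI allI impI ballI)
    show "ball (\<phi> p) (r / 2) \<subseteq> \<phi> ` U" using r ball_subset_cball[of "\<phi> p" r] subset_ball[of "r/2" r "\<phi> p"] by force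
    fix w :: "'e \<Rightarrow> real" assume w: "smooth_on (\<phi> ` U) w"
    have m: "smooth_on (\<phi> ` U) (\<lambda>x. \<eta> x * w x)"
      by (intro smooth_on_mult o w smooth_on_subset[OF \<eta>(1)]) auto
    then show "(\<lambda>q. if q \<in> U then \<eta> (\<phi> q) * w (\<phi> q) else 0) \<in> smooth_funs A"
      by (intro smooth_extend_zero[OF c r(2), of "\<lambda>x. \<eta> x * w x"]) (use z in auto)
    show "smooth_on UNIV (\<lambda>x. if x \<in> \<phi> ` U then \<eta> x * w x else 0)" (is "smooth_on UNIV ?f")
    proof (rule smooth_on_local)
      have 1: "smooth_on (\<phi> ` U) ?f" using m by (rule smooth_on_cong[OF o]) auto
      have 2: "smooth_on (- cball (\<phi> p) r) ?f"
        by (rule smooth_on_cong[OF _ smooth_on_const[of _ 0]]) (use z in auto)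
      show "\<exists>T. open T \<and> x \<in> T \<and> smooth_on T ?f" for x
        using 1 2 o r(2) by (cases "x \<in> \<phi> ` U") (blast, metis ComplI closed_cball open_Compl subsetD)
    qed
  qed (use r \<eta> in auto)
qed

lemma bump:
  assumes "open W" "p \<in> W"
  obtains \<rho> where "\<rho> \<in> smooth_funs A" "\<rho> p = 1" "\<And>q. q \<notin> W \<Longrightarrow> \<rho> q = 0"
proof -
  obtain U \<phi> where c: "(U, \<phi>) \<in> A" and p: "p \<in> U" using ex_chart by blast
  have o: "open (\<phi> ` (U \<inter> W))" using chart_image_sub_open[OF c assms(1)] .
  obtain r where r: "r > 0" "cball (\<phi> p) r \<subseteq> \<phi> ` (U \<inter> W)"
    using open_contains_cball o p assms(2) by blast
  obtain \<eta> :: "'e \<Rightarrow> real" where \<eta>: "smooth_on UNIV \<eta>" "\<And>x. x \<in> ball (\<phi> p) (r / 2) \<Longrightarrow> \<eta> x = 1"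
    "\<And>x. x \<notin> ball (\<phi> p) r \<Longrightarrow> \<eta> x = 0"
    using smooth_bump[OF r(1)] by metis
  let ?\<rho> = "\<lambda>q. if q \<in> U then \<eta> (\<phi> q) else 0"
  have "?\<rho> \<in> smooth_funs A"
    by (rule smooth_extend_zero[OF c, of "\<phi> p" r])
      (use r(2) \<eta>(3) smooth_on_subset[OF \<eta>(1)] in \<open>auto simp: less_eq_real_def\<close>)
  moreover have "?\<rho> p = 1" using p \<eta>(2)[of "\<phi> p"] r(1) by simp
  moreover have "?\<rho> q = 0" if "q \<notin> W" for q
  proof (cases "q \<in> U")
    case True
    have "\<phi> q \<notin> \<phi> ` (U \<inter> W)"
      using that True c by (metis (no_types, lifting) Int_iff chart_inv image_iff)
    then have "\<phi> q \<notin> ball (\<phi> p) r" using r(2) ball_subset_cball by blast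
    then show ?thesis using \<eta>(3) by simp
  qed simp
  ultimately show thesis using that by blast
qed

end

section \<open>Tangent vectors and local frames\<close>

definition chart_vec ::
    "('a, 'e::euclidean_space) atlas \<Rightarrow> 'a set \<Rightarrow> ('a \<Rightarrow> 'e) \<Rightarrow> 'a \<Rightarrow> 'e \<Rightarrow> 'a tvec" where
  "chart_vec A U \<phi> p \<xi> = (\<lambda>h. if h \<in> smooth_funs A
     then frechet_derivative (\<lambda>x. h (inv_into U \<phi> x)) (at (\<phi> p)) \<xi> else 0)"

context smooth_manifold begin

lemma tangent_add_fun:
  "v \<in> tangent_space A p \<Longrightarrow> h \<in> smooth_funs A \<Longrightarrow> k \<in> smooth_funs A \<Longrightarrow> v (\<lambda>x. h x + k x) = v h + v k"
  by (simp add: tangent_space_def)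

lemma tangent_scale_fun:
  "v \<in> tangent_space A p \<Longrightarrow> h \<in> smooth_funs A \<Longrightarrow> v (\<lambda>x. c * h x) = c * v h"
  by (simp add: tangent_space_def)

lemma tangent_mult_fun:
  "v \<in> tangent_space A p \<Longrightarrow> h \<in> smooth_funs A \<Longrightarrow> k \<in> smooth_funs A
    \<Longrightarrow> v (\<lambda>x. h x * k x) = h p * v k + k p * v h"
  by (simp add: tangent_space_def)

lemma tangent_nonsmooth: "v \<in> tangent_space A p \<Longrightarrow> h \<notin> smooth_funs A \<Longrightarrow> v h = 0"
  by (simp add: tangent_space_def)

lemma tangent_const:
  assumes "v \<in> tangent_space A p" shows "v (\<lambda>x. c) = 0"
proof -
  have "v (\<lambda>x. 1) = v (\<lambda>x. 1) + v (\<lambda>x. 1)"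
    using tangent_mult_fun[OF assms smooth_const smooth_const, of 1 1] by simp
  then show ?thesis using tangent_scale_fun[OF assms smooth_const, of c 1] by simp
qed

lemma tangent_minus_fun:
  assumes "v \<in> tangent_space A p" "h \<in> smooth_funs A" "k \<in> smooth_funs A"
  shows "v (\<lambda>x. h x - k x) = v h - v k"
proof -
  have "(\<lambda>x. - 1 * k x) \<in> smooth_funs A" using assms by (intro smooth_mult smooth_const)
  then show ?thesis
    using tangent_add_fun[OF assms(1,2), of "\<lambda>x. - 1 * k x"] tangent_scale_fun[OF assms(1,3), of "- 1"]
    by simp
qed

lemma tangent_sum_fun:
  assumes "v \<in> tangent_space A p" "\<And>i. i \<in> I \<Longrightarrow> h i \<in> smooth_funs A"
  shows "v (\<lambda>x. \<Sum>i\<in>I. h i x) = (\<Sum>i\<in>I. v (h i))"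
  using assms(2)
proof (induction I rule: infinite_finite_induct)
  case (insert i I)
  then show ?case using tangent_add_fun[OF assms(1), of "h i" "\<lambda>x. \<Sum>i\<in>I. h i x"]
    by (simp add: smooth_sum)
qed (use tangent_const[OF assms(1)] in auto)

lemma tangent_zero: "(\<lambda>h. 0) \<in> tangent_space A p"
  by (simp add: tangent_space_def)

lemma tangent_add:
  "v \<in> tangent_space A p \<Longrightarrow> w \<in> tangent_space A p \<Longrightarrow> (\<lambda>h. v h + w h) \<in> tangent_space A p"
  by (simp add: tangent_space_def algebra_simps)

lemma tangent_scale: "v \<in> tangent_space A p \<Longrightarrow> (\<lambda>h. c * v h) \<in> tangent_space A p"
  by (simp add: tangent_space_def algebra_simps)

lemma tangent_sum:
  "(\<And>i. i \<in> I \<Longrightarrow> v i \<in> tangent_space A p) \<Longrightarrow> (\<lambda>h. \<Sum>i\<in>I. c i * v i h) \<in> tangent_space A p"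
  by (induction I rule: infinite_finite_induct) (simp_all add: tangent_zero tangent_add tangent_scale)

text \<open>The Leibniz rule at \<open>p\<close> is applied to \<open>\<rho> * (h - k)\<close>,
  which is identically zero when \<rho> is 1 at \<open>p\<close> and vanishes off
  \<open>W\<close>.\<close>

lemma tangent_local:
  assumes v: "v \<in> tangent_space A p" and h: "h \<in> smooth_funs A" and k: "k \<in> smooth_funs A"
    and W: "open W" "p \<in> W" "\<And>q. q \<in> W \<Longrightarrow> h q = k q"
  shows "v h = v k"
proof -
  obtain \<rho> where \<rho>: "\<rho> \<in> smooth_funs A" "\<rho> p = 1" "\<And>q. q \<notin> W \<Longrightarrow> \<rho> q = 0"
    using bump[OF W(1,2)] by metis
  let ?d = "\<lambda>x. h x - k x"
  have d: "?d \<in> smooth_funs A" using h k by (rule smooth_minus)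
  have "(\<lambda>x. \<rho> x * ?d x) = (\<lambda>x. 0)" using W(3) \<rho>(3) by fastforce
  then have "0 = \<rho> p * v ?d + ?d p * v \<rho>"
    using tangent_mult_fun[OF v \<rho>(1) d] tangent_const[OF v, of 0] by simp
  then show ?thesis using \<rho>(2) W(2,3) tangent_minus_fun[OF v h k] by simp
qed

lemma chart_vec_tangent:
  assumes c: "(U, \<phi>) \<in> A" and p: "p \<in> U"
  shows "chart_vec A U \<phi> p \<xi> \<in> tangent_space A p"
proof -
  let ?D = "\<lambda>h. frechet_derivative (\<lambda>x. h (inv_into U \<phi> x)) (at (\<phi> p))"
  have d: "((\<lambda>x. h (inv_into U \<phi> x)) has_derivative ?D h) (at (\<phi> p))" if "h \<in> smooth_funs A" for h
    by (rule smooth_on_has_derivative[OF smooth_chart[OF that c]]) (use p in auto)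
  note e = frechet_derivative_at[symmetric, THEN fun_cong]
  have "?D (\<lambda>x. h x + k x) \<xi> = ?D h \<xi> + ?D k \<xi>" if "h \<in> smooth_funs A" "k \<in> smooth_funs A" for h k
    by (rule e[OF has_derivative_add[OF d d]]) (use that in auto)
  moreover have "?D (\<lambda>x. a * h x) \<xi> = a * ?D h \<xi>" if "h \<in> smooth_funs A" for h a
    by (rule e[OF has_derivative_mult_right[OF d]]) (use that in auto)
  moreover have "?D (\<lambda>x. h x * k x) \<xi> = h p * ?D k \<xi> + k p * ?D h \<xi>"
    if "h \<in> smooth_funs A" "k \<in> smooth_funs A" for h k
    using e[OF has_derivative_mult[OF d d], OF that, of \<xi>] c p by simp
  ultimately show ?thesis
    by (simp add: tangent_space_def chart_vec_def smooth_add smooth_mult)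
qed

text \<open>Tangent vectors act on global functions only, so the coordinates are replaced by
  functions on the whole manifold that agree with them on \<open>W\<close>. The last clause says
  that tangent vectors at points of \<open>W\<close> are combinations of the partial
  derivatives.\<close>

definition chart_coordinates :: "'a set \<Rightarrow> ('a \<Rightarrow> 'e) \<Rightarrow> 'a \<Rightarrow> 'a set \<Rightarrow> ('e \<Rightarrow> 'a \<Rightarrow> real) \<Rightarrow> bool" where
  "chart_coordinates U \<phi> p W x \<longleftrightarrow> open W \<and> p \<in> W \<and> W \<subseteq> U \<and> (\<forall>b. x b \<in> smooth_funs A) \<and>
    (\<forall>q\<in>W. \<forall>b. x b q = \<phi> q \<bullet> b) \<and>
    (\<forall>q\<in>W. \<forall>v\<in>tangent_space A q. \<forall>h\<in>smooth_funs A.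
      v h = (\<Sum>b\<in>Basis. v (x b) * frechet_derivative (\<lambda>x. h (inv_into U \<phi> x)) (at (\<phi> q)) b))"

lemma chart_coordinatesD:
  assumes "chart_coordinates U \<phi> p W x"
  shows "open W" "p \<in> W" "W \<subseteq> U" "\<And>b. x b \<in> smooth_funs A"
    "\<And>b q. q \<in> W \<Longrightarrow> x b q = \<phi> q \<bullet> b"
    "\<And>q v h. q \<in> W \<Longrightarrow> v \<in> tangent_space A q \<Longrightarrow> h \<in> smooth_funs A \<Longrightarrow>
      v h = (\<Sum>b\<in>Basis. v (x b) * frechet_derivative (\<lambda>x. h (inv_into U \<phi> x)) (at (\<phi> q)) b)"
  using assms unfolding chart_coordinates_def by blast+

text \<open>Near \<open>q\<close> the Hadamard lemma writes \<open>h\<close> as a constant plus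
  products of a coordinate difference, which vanishes at \<open>q\<close>, with a smooth function
  whose value at \<open>q\<close> is a partial derivative. A derivation at \<open>q\<close> sees
  nothing else.\<close>

lemma ex_chart_coordinates:
  assumes c: "(U, \<phi>) \<in> A" and p: "p \<in> U"
  obtains W x where "chart_coordinates U \<phi> p W x"
proof -
  obtain \<eta> N where \<eta>N: "chart_cutoff U \<phi> p \<eta> N" using ex_chart_cutoff[OF c p] .
  note N = chart_cutoffD(1-4)[OF \<eta>N] and \<eta> = chart_cutoffD(5,6)[OF \<eta>N]
  define W where "W = {q\<in>U. \<phi> q \<in> N}"
  define x where "x b = (\<lambda>q. if q \<in> U then \<eta> (\<phi> q) * (\<phi> q \<bullet> b) else 0)" for b
  have W: "open W" unfolding W_def by (rule chart_preimage_open[OF c N(1)])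
  have x: "x b \<in> smooth_funs A" for b
    unfolding x_def by (rule \<eta>(1)) (intro smooth_on_linear bounded_linear_inner_left chart_image_open[OF c])
  have xW: "x b q = \<phi> q \<bullet> b" if "q \<in> W" for b q
    using that N(4) by (auto simp: x_def W_def)
  have "v h = (\<Sum>b\<in>Basis. v (x b) * frechet_derivative (\<lambda>x. h (inv_into U \<phi> x)) (at (\<phi> q)) b)"
    if q: "q \<in> W" and v: "v \<in> tangent_space A q" and h: "h \<in> smooth_funs A" for q v h
  proof -
    have qU: "q \<in> U" using q by (simp add: W_def)
    obtain \<theta> M where \<theta>M: "chart_cutoff U \<phi> q \<theta> M" using ex_chart_cutoff[OF c qU] .
    note M = chart_cutoffD(1-4)[OF \<theta>M] and \<theta> = chart_cutoffD(5)[OF \<theta>M] and \<theta>' = chart_cutoffD(6)[OF \<theta>M]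
    \<comment> \<open>This is \<open>h\<close> read in the chart and cut off so as to be smooth on
      the whole Euclidean space; near the image of \<open>q\<close> nothing has changed.\<close>
    define u where "u = (\<lambda>x. if x \<in> \<phi> ` U then \<theta> x * h (inv_into U \<phi> x) else 0)"
    have u: "smooth_on UNIV u" unfolding u_def by (rule \<theta>'[OF smooth_chart[OF h c]])
    obtain g where g: "\<And>b. smooth_on UNIV (g b)" "\<And>b. g b (\<phi> q) = frechet_derivative u (at (\<phi> q)) b"
      "\<And>y. u y = u (\<phi> q) + (\<Sum>b\<in>Basis. ((y - \<phi> q) \<bullet> b) * g b y)"
      using smooth_hadamard[OF u, of "\<phi> q"] by blast
    define k where "k b = (\<lambda>q. if q \<in> U then \<theta> (\<phi> q) * g b (\<phi> q) else 0)" for b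
    have k: "k b \<in> smooth_funs A" for b
      unfolding k_def by (intro \<theta> smooth_on_subset[OF g(1)]) simp
    have uM: "u y = h (inv_into U \<phi> y)" if "y \<in> M" for y using that M by (auto simp: u_def)
    let ?s = "\<lambda>b r. x b r - \<phi> q \<bullet> b"
    let ?W = "W \<inter> {r\<in>U. \<phi> r \<in> M}"
    have s: "?s b \<in> smooth_funs A" for b by (intro smooth_minus x smooth_const)
    have kq: "k b q = frechet_derivative (\<lambda>x. h (inv_into U \<phi> x)) (at (\<phi> q)) b" for b
      using M qU by (simp add: k_def g(2) frechet_derivative_cong_open[OF M(1,2) uM])
    have "v h = v (\<lambda>r. h q + (\<Sum>b\<in>Basis. ?s b r * k b r))"
    proof (rule tangent_local[OF v h])
      show "(\<lambda>r. h q + (\<Sum>b\<in>Basis. ?s b r * k b r)) \<in> smooth_funs A"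
        by (intro smooth_add smooth_const smooth_sum smooth_mult s k)
      show "open ?W" "q \<in> ?W" using W chart_preimage_open[OF c M(1)] q qU M(2) by auto
      fix r assume r: "r \<in> ?W"
      have "h r = u (\<phi> r)" using uM[of "\<phi> r"] c r by simp
      also have "\<dots> = u (\<phi> q) + (\<Sum>b\<in>Basis. ((\<phi> r - \<phi> q) \<bullet> b) * g b (\<phi> r))" by (rule g(3))
      also have "u (\<phi> q) = h q" using uM[of "\<phi> q"] M(2) c qU by simp
      also have "(\<Sum>b\<in>Basis. ((\<phi> r - \<phi> q) \<bullet> b) * g b (\<phi> r)) = (\<Sum>b\<in>Basis. ?s b r * k b r)"
        using r M(4) by (intro sum.cong) (auto simp: xW inner_diff_left k_def)
      finally show "h r = h q + (\<Sum>b\<in>Basis. ?s b r * k b r)" .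
    qed
    also have "\<dots> = (\<Sum>b\<in>Basis. v (\<lambda>r. ?s b r * k b r))"
      using tangent_add_fun[OF v smooth_const smooth_sum, of Basis "\<lambda>b r. ?s b r * k b r" "h q"]
        tangent_sum_fun[OF v, of Basis "\<lambda>b r. ?s b r * k b r"] tangent_const[OF v, of "h q"]
        smooth_mult[OF s k] by simp
    \<comment> \<open>In the Leibniz rule at \<open>q\<close> the term containing the value of
      \<open>?s b\<close> drops out, because that value is 0.\<close>
    also have "\<dots> = (\<Sum>b\<in>Basis. v (x b) * k b q)"
    proof (rule sum.cong[OF refl])
      fix b
      show "v (\<lambda>r. ?s b r * k b r) = v (x b) * k b q"
        using tangent_mult_fun[OF v s k, of b b] tangent_minus_fun[OF v x smooth_const, of b "\<phi> q \<bullet> b"]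
          tangent_const[OF v] xW[OF q] by simp
    qed
    finally show ?thesis by (simp add: kq)
  qed
  with W x xW N(2) p show thesis by (intro that[of W x]) (auto simp: W_def chart_coordinates_def)
qed

lemma vector_field_tangent: "X \<in> vector_fields A \<Longrightarrow> X p \<in> tangent_space A p"
  by (simp add: vector_fields_def)

lemma vector_field_smooth: "X \<in> vector_fields A \<Longrightarrow> h \<in> smooth_funs A \<Longrightarrow> (\<lambda>p. X p h) \<in> smooth_funs A"
  by (simp add: vector_fields_def)

lemma vector_field_mult:
  "X \<in> vector_fields A \<Longrightarrow> h \<in> smooth_funs A \<Longrightarrow> (\<lambda>p k. h p * X p k) \<in> vector_fields A"
  by (simp add: vector_fields_def tangent_scale smooth_mult)

lemma vector_field_sum:
  "(\<And>i. i \<in> I \<Longrightarrow> c i \<in> smooth_funs A) \<Longrightarrow> (\<And>i. i \<in> I \<Longrightarrow> X i \<in> vector_fields A)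
    \<Longrightarrow> (\<lambda>p k. \<Sum>i\<in>I. c i p * X i p k) \<in> vector_fields A"
  by (auto simp: vector_fields_def intro!: tangent_sum smooth_sum smooth_mult)

text \<open>The fields and functions are global but form a frame with dual coframe, the
  differentials of \<open>x i\<close>, only over \<open>W\<close>. This is what makes them usable
  both for extending vectors and covectors and for checking smoothness through coefficients.\<close>

definition local_frame :: "'a \<Rightarrow> 'a set \<Rightarrow> ('e \<Rightarrow> 'a \<Rightarrow> real) \<Rightarrow> ('e \<Rightarrow> 'a \<Rightarrow> 'a tvec) \<Rightarrow> bool" where
  "local_frame p W x X \<longleftrightarrow> open W \<and> p \<in> W \<and> (\<forall>i. x i \<in> smooth_funs A) \<and> (\<forall>i. X i \<in> vector_fields A) \<and>
    (\<forall>q\<in>W. \<forall>i\<in>Basis. \<forall>j\<in>Basis. X i q (x j) = (if i = j then 1 else 0)) \<and>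
    (\<forall>q\<in>W. \<forall>v\<in>tangent_space A q. \<forall>h. v h = (\<Sum>i\<in>Basis. v (x i) * X i q h))"

lemma local_frameD:
  assumes "local_frame p W x X"
  shows "open W" "p \<in> W" "\<And>i. x i \<in> smooth_funs A" "\<And>i. X i \<in> vector_fields A"
    "\<And>q i j. q \<in> W \<Longrightarrow> i \<in> Basis \<Longrightarrow> j \<in> Basis \<Longrightarrow> X i q (x j) = (if i = j then 1 else 0)"
    "\<And>q v h. q \<in> W \<Longrightarrow> v \<in> tangent_space A q \<Longrightarrow> v h = (\<Sum>i\<in>Basis. v (x i) * X i q h)"
  using assms unfolding local_frame_def by blast+

text \<open>The coordinate derivations of a chart become global fields after multiplication by a
  cutoff, and they keep their duality with the coordinates where the cutoff is 1.\<close>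

lemma ex_local_frame:
  obtains W x X where "local_frame p W x X"
proof -
  obtain U \<phi> where c: "(U, \<phi>) \<in> A" and p: "p \<in> U" using ex_chart by blast
  obtain W x where Wx: "chart_coordinates U \<phi> p W x" using ex_chart_coordinates[OF c p] .
  note W = chart_coordinatesD(1-4)[OF Wx] and xW = chart_coordinatesD(5)[OF Wx]
    and v = chart_coordinatesD(6)[OF Wx]
  obtain \<eta> N where \<eta>N: "chart_cutoff U \<phi> p \<eta> N" using ex_chart_cutoff[OF c p] .
  note N = chart_cutoffD(1-4)[OF \<eta>N] and \<eta> = chart_cutoffD(5,6)[OF \<eta>N]
  define X where "X i q = (if q \<in> U then (\<lambda>h. \<eta> (\<phi> q) * chart_vec A U \<phi> q i h) else (\<lambda>h. 0))" for i q
  let ?W = "W \<inter> {q\<in>U. \<phi> q \<in> N}"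
  show thesis
  proof (rule that[of ?W x X], unfold local_frame_def, intro conjI allI ballI)
    show "open ?W" "p \<in> ?W" using W(1,2) chart_preimage_open[OF c N(1)] N(2) p by auto
    show "X i \<in> vector_fields A" for i
      unfolding vector_fields_def
    proof (intro CollectI conjI allI ballI)
      show "X i q \<in> tangent_space A q" for q
        by (simp add: X_def tangent_zero tangent_scale chart_vec_tangent[OF c])
      fix h assume h: "h \<in> smooth_funs A"
      have "(\<lambda>q. X i q h) = (\<lambda>q. if q \<in> U then \<eta> (\<phi> q) *
          frechet_derivative (\<lambda>x. h (inv_into U \<phi> x)) (at (\<phi> q)) i else 0)"
        using h by (auto simp: X_def chart_vec_def)
      also have "\<dots> \<in> smooth_funs A"
        by (intro \<eta>(1) smooth_on_frechet_derivative smooth_chart h c)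
      finally show "(\<lambda>q. X i q h) \<in> smooth_funs A" .
    qed
    show "X i q (x j) = (if i = j then 1 else 0)" if q: "q \<in> ?W" and ij: "i \<in> Basis" "j \<in> Basis" for q i j
    proof -
      have o: "open (\<phi> ` (U \<inter> W))" "\<phi> q \<in> \<phi> ` (U \<inter> W)" using chart_image_sub_open[OF c W(1)] q by auto
      have "frechet_derivative (\<lambda>y. x j (inv_into U \<phi> y)) (at (\<phi> q)) = frechet_derivative (\<lambda>y. y \<bullet> j) (at (\<phi> q))"
        by (rule frechet_derivative_cong_open[OF o]) (use c xW in auto)
      also have "\<dots> = (\<lambda>y. y \<bullet> j)"
        by (rule frechet_derivative_at[symmetric]) (rule bounded_linear_imp_has_derivative[OF bounded_linear_inner_left])
      finally show ?thesis using q N(4) ij W(4) by (auto simp: X_def chart_vec_def inner_Basis)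
    qed
    show "w h = (\<Sum>i\<in>Basis. w (x i) * X i q h)" if q: "q \<in> ?W" and w: "w \<in> tangent_space A q" for q w h
      using v[of q w h] q w N(4) tangent_nonsmooth[OF w, of h]
      by (cases "h \<in> smooth_funs A") (auto simp: X_def chart_vec_def)
  qed (rule W(4))
qed

text \<open>Freezing the frame coefficients of \<open>v\<close> gives a global field. Statements
  about fields thereby become statements about single vectors.\<close>

lemma vector_field_extend:
  assumes "v \<in> tangent_space A p"
  obtains X where "X \<in> vector_fields A" "X p = v"
proof -
  obtain W x X where W: "local_frame p W x X" using ex_local_frame .
  let ?X = "\<lambda>q h. \<Sum>i\<in>(Basis::'e set). v (x i) * X i q h"
  have "?X \<in> vector_fields A" by (intro vector_field_sum local_frameD(4)[OF W] smooth_const)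
  moreover have "?X p = v" by (intro ext) (rule local_frameD(6)[OF W local_frameD(2)[OF W] assms, symmetric])
  ultimately show thesis using that by blast
qed

end

section \<open>Covectors, Lie derivatives and anchors\<close>

context smooth_manifold begin

lemma cotangent_add_vec:
  "a \<in> cotangent_space A p \<Longrightarrow> v \<in> tangent_space A p \<Longrightarrow> w \<in> tangent_space A p
    \<Longrightarrow> a (\<lambda>h. v h + w h) = a v + a w"
  by (simp add: cotangent_space_def)

lemma cotangent_scale_vec:
  "a \<in> cotangent_space A p \<Longrightarrow> v \<in> tangent_space A p \<Longrightarrow> a (\<lambda>h. c * v h) = c * a v"
  by (simp add: cotangent_space_def)

lemma cotangent_outside: "a \<in> cotangent_space A p \<Longrightarrow> v \<notin> tangent_space A p \<Longrightarrow> a v = 0"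
  by (simp add: cotangent_space_def)

lemma cotangent_zero_vec: "a \<in> cotangent_space A p \<Longrightarrow> a (\<lambda>h. 0) = 0"
  using cotangent_scale_vec[OF _ tangent_zero, of a p 0] by simp

lemma cotangent_sum_vec:
  assumes "a \<in> cotangent_space A p" "\<And>i. i \<in> I \<Longrightarrow> v i \<in> tangent_space A p"
  shows "a (\<lambda>h. \<Sum>i\<in>I. c i * v i h) = (\<Sum>i\<in>I. c i * a (v i))"
  using assms(2)
proof (induction I rule: infinite_finite_induct)
  case (insert i I)
  then show ?case
    using cotangent_add_vec[OF assms(1) tangent_scale[of "v i" p "c i"] tangent_sum[of I v p c]]
      cotangent_scale_vec[OF assms(1), of "v i" "c i"] by simp
qed (use cotangent_zero_vec[OF assms(1)] in auto)

lemma cotangent_eqI: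
  assumes "a \<in> cotangent_space A p" "b \<in> cotangent_space A p"
    and "\<And>v. v \<in> tangent_space A p \<Longrightarrow> a v = b v"
  shows "a = b"
proof
  fix v show "a v = b v"
    using assms cotangent_outside[of a p v] cotangent_outside[of b p v] by (cases "v \<in> tangent_space A p") auto
qed

lemma cotangent_zero: "(\<lambda>v. 0) \<in> cotangent_space A p"
  by (simp add: cotangent_space_def)

lemma cotangent_add:
  "a \<in> cotangent_space A p \<Longrightarrow> b \<in> cotangent_space A p \<Longrightarrow> (\<lambda>v. a v + b v) \<in> cotangent_space A p"
  by (simp add: cotangent_space_def algebra_simps)

lemma cotangent_scale: "a \<in> cotangent_space A p \<Longrightarrow> (\<lambda>v. c * a v) \<in> cotangent_space A p"
  by (simp add: cotangent_space_def algebra_simps)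

lemma cotangent_sum:
  "(\<And>i. i \<in> I \<Longrightarrow> a i \<in> cotangent_space A p) \<Longrightarrow> (\<lambda>v. \<Sum>i\<in>I. c i * a i v) \<in> cotangent_space A p"
  by (induction I rule: infinite_finite_induct) (simp_all add: cotangent_zero cotangent_add cotangent_scale)

lemma differential_eval: "v \<in> tangent_space A p \<Longrightarrow> differential A h p v = v h"
  by (simp add: differential_def)

lemma differential_cotangent: "differential A h p \<in> cotangent_space A p"
  by (simp add: cotangent_space_def differential_def tangent_add tangent_scale)

lemma one_form_cotangent: "\<alpha> \<in> one_forms A \<Longrightarrow> \<alpha> p \<in> cotangent_space A p"
  by (simp add: one_forms_def)

lemma one_form_smooth:
  "\<alpha> \<in> one_forms A \<Longrightarrow> X \<in> vector_fields A \<Longrightarrow> (\<lambda>p. \<alpha> p (X p)) \<in> smooth_funs A"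
  by (simp add: one_forms_def)

lemma differential_one_form: "h \<in> smooth_funs A \<Longrightarrow> differential A h \<in> one_forms A"
  by (simp add: one_forms_def differential_cotangent differential_eval vector_field_tangent vector_field_smooth)

lemma one_form_sum:
  "(\<And>i. i \<in> I \<Longrightarrow> c i \<in> smooth_funs A) \<Longrightarrow> (\<And>i. i \<in> I \<Longrightarrow> \<alpha> i \<in> one_forms A)
    \<Longrightarrow> (\<lambda>p v. \<Sum>i\<in>I. c i p * \<alpha> i p v) \<in> one_forms A"
  by (auto simp: one_forms_def intro!: cotangent_sum smooth_sum smooth_mult)

lemma one_form_mult: "\<alpha> \<in> one_forms A \<Longrightarrow> h \<in> smooth_funs A \<Longrightarrow> (\<lambda>p v. h p * \<alpha> p v) \<in> one_forms A"
  by (simp add: one_forms_def cotangent_scale smooth_mult)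

lemma one_form_add:
  "\<alpha> \<in> one_forms A \<Longrightarrow> \<beta> \<in> one_forms A \<Longrightarrow> (\<lambda>p v. \<alpha> p v + \<beta> p v) \<in> one_forms A"
  by (simp add: one_forms_def cotangent_add smooth_add)

lemma one_form_lin:
  "\<alpha> \<in> one_forms A \<Longrightarrow> \<beta> \<in> one_forms A \<Longrightarrow> (\<lambda>p v. r * \<alpha> p v + s * \<beta> p v) \<in> one_forms A"
  by (intro one_form_add one_form_mult smooth_const)

lemma cotangent_frame:
  assumes F: "local_frame p W x X" and q: "q \<in> W" and a: "a \<in> cotangent_space A q"
  shows "a = (\<lambda>v. \<Sum>i\<in>Basis. a (X i q) * differential A (x i) q v)"
proof (rule cotangent_eqI[OF a])
  show "(\<lambda>v. \<Sum>i\<in>Basis. a (X i q) * differential A (x i) q v) \<in> cotangent_space A q"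
    by (intro cotangent_sum differential_cotangent)
  fix v assume v: "v \<in> tangent_space A q"
  have "v = (\<lambda>h. \<Sum>i\<in>Basis. v (x i) * X i q h)"
    by (intro ext) (rule local_frameD(6)[OF F q v])
  then have "a v = a (\<lambda>h. \<Sum>i\<in>Basis. v (x i) * X i q h)" by (rule arg_cong)
  also have "\<dots> = (\<Sum>i\<in>Basis. v (x i) * a (X i q))"
    by (rule cotangent_sum_vec[OF a]) (rule vector_field_tangent[OF local_frameD(4)[OF F]])
  finally show "a v = (\<Sum>i\<in>Basis. a (X i q) * differential A (x i) q v)"
    by (simp add: differential_eval[OF v] mult.commute)
qed

lemma one_form_extend:
  assumes a: "a \<in> cotangent_space A p"
  obtains \<alpha> where "\<alpha> \<in> one_forms A" "\<alpha> p = a"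
proof -
  obtain W x X where F: "local_frame p W x X" using ex_local_frame .
  let ?\<alpha> = "\<lambda>q v. \<Sum>i\<in>Basis. a (X i p) * differential A (x i) q v"
  have "?\<alpha> \<in> one_forms A" by (intro one_form_sum smooth_const differential_one_form local_frameD(3)[OF F])
  moreover have "?\<alpha> p = a" by (rule cotangent_frame[OF F local_frameD(2)[OF F] a, symmetric])
  ultimately show thesis using that by blast
qed

lemma one_form_eqI:
  assumes "\<alpha> \<in> one_forms A" "\<beta> \<in> one_forms A"
    and "\<And>Y p. Y \<in> vector_fields A \<Longrightarrow> \<alpha> p (Y p) = \<beta> p (Y p)"
  shows "\<alpha> = \<beta>"
proof
  fix p show "\<alpha> p = \<beta> p"
  proof (rule cotangent_eqI)
    fix v assume "v \<in> tangent_space A p"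
    then obtain Y where "Y \<in> vector_fields A" "Y p = v" by (rule vector_field_extend)
    then show "\<alpha> p v = \<beta> p v" using assms(3)[of Y p] by simp
  qed (use assms one_form_cotangent in auto)
qed

text \<open>Linearity over smooth functions forces \<open>\<Phi> Y p\<close> to depend on
  \<open>Y p\<close> only, through the expansion of \<open>Y\<close> in a frame near
  \<open>p\<close>. This produces the 1-form that the definition of the Lie derivative selects with
  \<open>THE\<close>.\<close>

lemma tensorial_one_form:
  assumes sm: "\<And>Y. Y \<in> vector_fields A \<Longrightarrow> \<Phi> Y \<in> smooth_funs A"
    and add: "\<And>Y Z p. Y \<in> vector_fields A \<Longrightarrow> Z \<in> vector_fields A \<Longrightarrow> \<Phi> (\<lambda>p k. Y p k + Z p k) p = \<Phi> Y p + \<Phi> Z p"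
    and mult: "\<And>h Y p. h \<in> smooth_funs A \<Longrightarrow> Y \<in> vector_fields A \<Longrightarrow> \<Phi> (\<lambda>p k. h p * Y p k) p = h p * \<Phi> Y p"
  obtains \<omega> where "\<omega> \<in> one_forms A" "\<And>Y p. Y \<in> vector_fields A \<Longrightarrow> \<omega> p (Y p) = \<Phi> Y p"
proof -
  have zero: "\<Phi> (\<lambda>p k. 0) p = 0" for p
    using mult[OF smooth_const[of 0], of "\<lambda>p k. 0" p] by (simp add: vector_fields_def tangent_zero)
  have sum: "\<Phi> (\<lambda>p k. \<Sum>i\<in>I. c i p * Y i p k) p = (\<Sum>i\<in>I. c i p * \<Phi> (Y i) p)"
    if "\<And>i. c i \<in> smooth_funs A" "\<And>i. Y i \<in> vector_fields A" for I :: "'e set" and c Y p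
    by (induction I rule: infinite_finite_induct)
      (simp_all add: zero add mult that vector_field_mult vector_field_sum)
  have frame: "\<Phi> Y p = (\<Sum>i\<in>Basis. Y p (x i) * \<Phi> (X i) p)"
    if F: "local_frame p W x X" and Y: "Y \<in> vector_fields A" for p W x X Y
  proof -
    note D = local_frameD[OF F]
    obtain \<rho> where \<rho>: "\<rho> \<in> smooth_funs A" "\<rho> p = 1" "\<And>q. q \<notin> W \<Longrightarrow> \<rho> q = 0"
      using bump[OF D(1,2)] by metis
    \<comment> \<open>The frame expansion holds over \<open>W\<close> only; multiplied by \<rho> it
      is an identity of global fields, to which \<Phi> can be applied.\<close>
    have e: "(\<lambda>q k. \<rho> q * Y q k) = (\<lambda>q k. \<Sum>i\<in>Basis. (\<rho> q * Y q (x i)) * X i q k)"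
    proof (intro ext)
      fix q k
      have "Y q k = (\<Sum>i\<in>Basis. Y q (x i) * X i q k)" if "q \<in> W"
        by (rule D(6)[OF that vector_field_tangent[OF Y]])
      then show "\<rho> q * Y q k = (\<Sum>i\<in>Basis. (\<rho> q * Y q (x i)) * X i q k)"
        using \<rho>(3)[of q] by (cases "q \<in> W") (simp_all add: sum_distrib_left mult.assoc)
    qed
    have "\<Phi> Y p = \<Phi> (\<lambda>q k. \<rho> q * Y q k) p" using mult[OF \<rho>(1) Y] \<rho>(2) by simp
    also have "\<dots> = (\<Sum>i\<in>Basis. (\<rho> p * Y p (x i)) * \<Phi> (X i) p)"
      unfolding e by (rule sum[OF smooth_mult[OF \<rho>(1) vector_field_smooth[OF Y D(3)]] D(4)])
    finally show ?thesis using \<rho>(2) by simp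
  qed
  \<comment> \<open>An arbitrary field through \<open>v\<close>; by \<open>frame\<close> the value
    of \<Phi> at \<open>p\<close> is the same for every choice.\<close>
  define E where "E p v = (SOME Y. Y \<in> vector_fields A \<and> Y p = v)" for p v
  have E: "E p v \<in> vector_fields A" "E p v p = v" if "v \<in> tangent_space A p" for p v
    using someI_ex[of "\<lambda>Y. Y \<in> vector_fields A \<and> Y p = v"] vector_field_extend[OF that]
    unfolding E_def by metis+
  define \<omega> where "\<omega> p v = (if v \<in> tangent_space A p then \<Phi> (E p v) p else 0)" for p v
  have \<omega>: "\<omega> p (Y p) = \<Phi> Y p" if Y: "Y \<in> vector_fields A" for Y p
  proof -
    obtain W x X where F: "local_frame p W x X" using ex_local_frame .
    show ?thesis
      using frame[OF F Y] frame[OF F E(1)[OF vector_field_tangent[OF Y]]]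
      by (simp add: \<omega>_def vector_field_tangent[OF Y] E(2))
  qed
  have "\<omega> p \<in> cotangent_space A p" for p
  proof -
    obtain W x X where F: "local_frame p W x X" using ex_local_frame .
    have "\<omega> p v = (\<Sum>i\<in>Basis. v (x i) * \<Phi> (X i) p)" if "v \<in> tangent_space A p" for v
      using frame[OF F E(1)[OF that]] that by (simp add: \<omega>_def E(2))
    then show ?thesis
      by (simp add: cotangent_space_def tangent_add tangent_scale algebra_simps sum.distrib sum_distrib_left)
        (simp add: \<omega>_def)
  qed
  moreover have "(\<lambda>p. \<omega> p (Y p)) \<in> smooth_funs A" if "Y \<in> vector_fields A" for Y
    using sm[OF that] \<omega>[OF that] by (simp add: \<omega>[OF that])
  ultimately have "\<omega> \<in> one_forms A" by (simp add: one_forms_def)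
  then show thesis using that \<omega> by blast
qed

section \<open>Lie derivatives of 1-forms\<close>

lemma lie_bracket_vector_field:
  assumes X: "X \<in> vector_fields A" and Y: "Y \<in> vector_fields A"
  shows "lie_bracket A X Y \<in> vector_fields A"
proof -
  note t = vector_field_tangent[OF X] vector_field_tangent[OF Y]
  note s = vector_field_smooth[OF X] vector_field_smooth[OF Y]
  have "lie_bracket A X Y p \<in> tangent_space A p" for p
    unfolding tangent_space_def lie_bracket_def
    by (auto simp: smooth_add smooth_mult t[THEN tangent_add_fun] t[THEN tangent_scale_fun] t[THEN tangent_mult_fun] s
        algebra_simps)
  then show ?thesis
    by (auto simp: vector_fields_def lie_bracket_def s intro!: smooth_minus)
qed

text \<open>The defining expression is linear over functions in \<open>Y\<close>: when
  \<open>Y\<close> is multiplied by \<open>h\<close>, the derivative of the pairing and the Lie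
  bracket both contribute \<open>X p h\<close> times \<open>\<beta> p (Y p)\<close>, with opposite
  signs.\<close>

lemma lie_derivative:
  assumes X: "X \<in> vector_fields A" and \<beta>: "\<beta> \<in> one_forms A"
  shows lie_derivative_one_form: "lie_derivative A X \<beta> \<in> one_forms A"
    and lie_derivative_eval: "\<And>Y p. Y \<in> vector_fields A \<Longrightarrow>
      lie_derivative A X \<beta> p (Y p) = X p (\<lambda>q. \<beta> q (Y q)) - \<beta> p (lie_bracket A X Y p)"
proof -
  let ?\<Phi> = "\<lambda>Y p. X p (\<lambda>q. \<beta> q (Y q)) - \<beta> p (lie_bracket A X Y p)"
  note tX = vector_field_tangent[OF X] and sX = vector_field_smooth[OF X]
  note c\<beta> = one_form_cotangent[OF \<beta>] and s\<beta> = one_form_smooth[OF \<beta>]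
  obtain \<omega> where \<omega>: "\<omega> \<in> one_forms A" "\<And>Y p. Y \<in> vector_fields A \<Longrightarrow> \<omega> p (Y p) = ?\<Phi> Y p"
  proof (rule tensorial_one_form[of ?\<Phi>])
    show "?\<Phi> Y \<in> smooth_funs A" if "Y \<in> vector_fields A" for Y
      by (intro smooth_minus sX s\<beta> that lie_bracket_vector_field X)
    show "?\<Phi> (\<lambda>p k. Y p k + Z p k) p = ?\<Phi> Y p + ?\<Phi> Z p"
      if Y: "Y \<in> vector_fields A" and Z: "Z \<in> vector_fields A" for Y Z p
    proof -
      have "lie_bracket A X (\<lambda>p k. Y p k + Z p k) p = (\<lambda>h. lie_bracket A X Y p h + lie_bracket A X Z p h)"
        by (auto simp: lie_bracket_def fun_eq_iff tangent_add_fun[OF tX] vector_field_smooth Y Z)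
      then show ?thesis
        by (simp add: cotangent_add_vec[OF c\<beta>] lie_bracket_vector_field X Y Z vector_field_tangent
            tangent_add_fun[OF tX] s\<beta>)
    qed
    show "?\<Phi> (\<lambda>p k. h p * Y p k) p = h p * ?\<Phi> Y p" if h: "h \<in> smooth_funs A" and Y: "Y \<in> vector_fields A" for h Y p
    proof -
      have "lie_bracket A X (\<lambda>p k. h p * Y p k) p = (\<lambda>k. h p * lie_bracket A X Y p k + X p h * Y p k)"
        by (auto simp: lie_bracket_def fun_eq_iff tangent_mult_fun[OF tX] vector_field_smooth Y h algebra_simps
            tangent_nonsmooth[OF vector_field_tangent[OF Y]])
      then show ?thesis
        by (simp add: cotangent_add_vec[OF c\<beta>] cotangent_scale_vec[OF c\<beta>] tangent_scale
            lie_bracket_vector_field X Y h vector_field_tangent tangent_mult_fun[OF tX] s\<beta> algebra_simps)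
    qed
  qed blast
  have "lie_derivative A X \<beta> \<in> one_forms A \<and> (\<forall>Y\<in>vector_fields A. \<forall>p. lie_derivative A X \<beta> p (Y p) = ?\<Phi> Y p)"
    unfolding lie_derivative_def
  proof (rule theI[where a = \<omega>])
    show "\<omega> \<in> one_forms A \<and> (\<forall>Y\<in>vector_fields A. \<forall>p. \<omega> p (Y p) = ?\<Phi> Y p)" using \<omega> by blast
    show "\<omega>' = \<omega>" if "\<omega>' \<in> one_forms A \<and> (\<forall>Y\<in>vector_fields A. \<forall>p. \<omega>' p (Y p) = ?\<Phi> Y p)" for \<omega>'
      by (rule one_form_eqI) (use that \<omega> in auto)
  qed
  then show "lie_derivative A X \<beta> \<in> one_forms A"
    "\<And>Y p. Y \<in> vector_fields A \<Longrightarrow> lie_derivative A X \<beta> p (Y p) = ?\<Phi> Y p" by blast+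
qed

section \<open>Bilinear forms on cotangent spaces and anchors\<close>

definition cobilinear :: "'a \<Rightarrow> ('a covec \<Rightarrow> 'a covec \<Rightarrow> real) \<Rightarrow> bool" where
  "cobilinear p B \<longleftrightarrow> (\<forall>a\<in>cotangent_space A p. \<forall>b\<in>cotangent_space A p. \<forall>c\<in>cotangent_space A p. \<forall>r s.
     B (\<lambda>v. r * a v + s * b v) c = r * B a c + s * B b c \<and>
     B c (\<lambda>v. r * a v + s * b v) = r * B c a + s * B c b)"

lemma cobilinear_add:
  assumes "cobilinear p B" "a \<in> cotangent_space A p" "b \<in> cotangent_space A p" "c \<in> cotangent_space A p"
  shows "B (\<lambda>v. a v + b v) c = B a c + B b c" "B c (\<lambda>v. a v + b v) = B c a + B c b"
proof -
  from assms have "B (\<lambda>v. 1 * a v + 1 * b v) c = 1 * B a c + 1 * B b c" unfolding cobilinear_def by blast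
  then show "B (\<lambda>v. a v + b v) c = B a c + B b c" by simp
  from assms have "B c (\<lambda>v. 1 * a v + 1 * b v) = 1 * B c a + 1 * B c b" unfolding cobilinear_def by blast
  then show "B c (\<lambda>v. a v + b v) = B c a + B c b" by simp
qed

lemma cobilinear_scale:
  assumes "cobilinear p B" "a \<in> cotangent_space A p" "c \<in> cotangent_space A p"
  shows "B (\<lambda>v. r * a v) c = r * B a c" "B c (\<lambda>v. r * a v) = r * B c a"
proof -
  from assms have "B (\<lambda>v. r * a v + 0 * a v) c = r * B a c + 0 * B a c" unfolding cobilinear_def by blast
  then show "B (\<lambda>v. r * a v) c = r * B a c" by simp
  from assms have "B c (\<lambda>v. r * a v + 0 * a v) = r * B c a + 0 * B c a" unfolding cobilinear_def by blast
  then show "B c (\<lambda>v. r * a v) = r * B c a" by simp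
qed

lemma cobilinear_sum:
  assumes B: "cobilinear p B" and a: "\<And>i. i \<in> I \<Longrightarrow> a i \<in> cotangent_space A p" and c: "c \<in> cotangent_space A p"
  shows "B (\<lambda>v. \<Sum>i\<in>I. r i * a i v) c = (\<Sum>i\<in>I. r i * B (a i) c)"
    and "B c (\<lambda>v. \<Sum>i\<in>I. r i * a i v) = (\<Sum>i\<in>I. r i * B c (a i))"
proof -
  have z: "B (\<lambda>v. 0) c = 0" "B c (\<lambda>v. 0) = 0"
    using cobilinear_scale[OF B c c, of 0] cobilinear_scale[OF B cotangent_zero c, of 0] by simp_all
  have "B (\<lambda>v. \<Sum>i\<in>I. r i * a i v) c = (\<Sum>i\<in>I. r i * B (a i) c) \<and>
      B c (\<lambda>v. \<Sum>i\<in>I. r i * a i v) = (\<Sum>i\<in>I. r i * B c (a i))"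
    using a
  proof (induction I rule: infinite_finite_induct)
    case (insert i I)
    then show ?case
      using cobilinear_add[OF B cotangent_scale[of "a i" p "r i"] cotangent_sum[of I a p r] c]
        cobilinear_scale[OF B _ c, of "a i" "r i"] by simp
  qed (use z in auto)
  then show "B (\<lambda>v. \<Sum>i\<in>I. r i * a i v) c = (\<Sum>i\<in>I. r i * B (a i) c)"
    "B c (\<lambda>v. \<Sum>i\<in>I. r i * a i v) = (\<Sum>i\<in>I. r i * B c (a i))" by auto
qed

lemma tensor_cobilinear: "contravariant_tensor2 A T \<Longrightarrow> cobilinear p (T p)"
  unfolding contravariant_tensor2_def cobilinear_def by blast

lemma tensor_smooth:
  "contravariant_tensor2 A T \<Longrightarrow> \<alpha> \<in> one_forms A \<Longrightarrow> \<beta> \<in> one_forms A \<Longrightarrow> (\<lambda>p. T p (\<alpha> p) (\<beta> p)) \<in> smooth_funs A"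
  by (simp add: contravariant_tensor2_def contra_eval_def)

text \<open>The vector with frame coefficients
  \<open>P p (\<alpha> p) (differential A (x i) p)\<close> has the required pairings, and it is the
  only one because differentials of functions separate tangent vectors. So the \<open>THE\<close> in
  the definition is justified.\<close>

lemma anchor:
  assumes P: "contravariant_tensor2 A P" and \<alpha>: "\<alpha> \<in> one_forms A"
  shows anchor_tangent: "anchor A P \<alpha> p \<in> tangent_space A p"
    and anchor_eval: "b \<in> cotangent_space A p \<Longrightarrow> b (anchor A P \<alpha> p) = P p (\<alpha> p) b"
proof -
  obtain W x X where F: "local_frame p W x X" using ex_local_frame .
  note D = local_frameD[OF F]
  let ?v = "\<lambda>h. \<Sum>i\<in>Basis. P p (\<alpha> p) (differential A (x i) p) * X i p h"
  note c = one_form_cotangent[OF \<alpha>]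
  have v: "?v \<in> tangent_space A p" by (intro tangent_sum vector_field_tangent D)
  have ev: "b ?v = P p (\<alpha> p) b" if b: "b \<in> cotangent_space A p" for b
  proof -
    have "P p (\<alpha> p) b = P p (\<alpha> p) (\<lambda>v. \<Sum>i\<in>Basis. b (X i p) * differential A (x i) p v)"
      using cotangent_frame[OF F D(2) b] by (rule arg_cong)
    also have "\<dots> = (\<Sum>i\<in>Basis. b (X i p) * P p (\<alpha> p) (differential A (x i) p))"
      by (rule cobilinear_sum(2)[OF tensor_cobilinear[OF P] differential_cotangent c])
    also have "\<dots> = b ?v"
      by (subst cotangent_sum_vec[OF b]) (simp_all add: vector_field_tangent[OF D(4)] mult.commute)
    finally show ?thesis ..
  qed
  have "anchor A P \<alpha> p \<in> tangent_space A p \<and> (\<forall>b\<in>cotangent_space A p. b (anchor A P \<alpha> p) = P p (\<alpha> p) b)"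
    unfolding anchor_def
  proof (rule theI[where a = ?v])
    show "?v \<in> tangent_space A p \<and> (\<forall>b\<in>cotangent_space A p. b ?v = P p (\<alpha> p) b)" using v ev by blast
    fix w assume w: "w \<in> tangent_space A p \<and> (\<forall>b\<in>cotangent_space A p. b w = P p (\<alpha> p) b)"
    show "w = ?v"
    proof
      fix h
      show "w h = ?v h"
        using w ev[OF differential_cotangent[of h p]] differential_cotangent[of h p]
          differential_eval[OF v, of h] differential_eval[of w p h] by simp
    qed
  qed
  then show "anchor A P \<alpha> p \<in> tangent_space A p"
    "b \<in> cotangent_space A p \<Longrightarrow> b (anchor A P \<alpha> p) = P p (\<alpha> p) b" by blast+
qed

lemma anchor_apply:
  "contravariant_tensor2 A P \<Longrightarrow> \<alpha> \<in> one_forms A \<Longrightarrow> anchor A P \<alpha> p h = P p (\<alpha> p) (differential A h p)"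
  using anchor_eval[OF _ _ differential_cotangent, of P \<alpha> h p] differential_eval[OF anchor_tangent, of P \<alpha> h p]
  by simp

lemma anchor_vector_field:
  assumes "contravariant_tensor2 A P" "\<alpha> \<in> one_forms A"
  shows "anchor A P \<alpha> \<in> vector_fields A"
proof -
  have "(\<lambda>p. anchor A P \<alpha> p h) \<in> smooth_funs A" if "h \<in> smooth_funs A" for h
    using tensor_smooth[OF assms(1,2) differential_one_form[OF that]] by (simp add: anchor_apply[OF assms])
  then show ?thesis by (simp add: vector_fields_def anchor_tangent[OF assms])
qed

lemma koszul_bracket_eval:
  assumes P: "contravariant_tensor2 A P" and \<alpha>: "\<alpha> \<in> one_forms A" and \<beta>: "\<beta> \<in> one_forms A"
    and Y: "Y \<in> vector_fields A"
  shows "koszul_bracket A P \<alpha> \<beta> p (Y p) =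
    (anchor A P \<alpha> p (\<lambda>q. \<beta> q (Y q)) - \<beta> p (lie_bracket A (anchor A P \<alpha>) Y p)) -
    (anchor A P \<beta> p (\<lambda>q. \<alpha> q (Y q)) - \<alpha> p (lie_bracket A (anchor A P \<beta>) Y p)) -
    Y p (\<lambda>q. P q (\<alpha> q) (\<beta> q))"
  using vector_field_tangent[OF Y, of p]
  by (simp add: koszul_bracket_def lie_derivative_eval[OF anchor_vector_field] P \<alpha> \<beta> Y
      differential_eval contra_eval_def)

lemma koszul_bracket_cotangent:
  assumes P: "contravariant_tensor2 A P" and \<alpha>: "\<alpha> \<in> one_forms A" and \<beta>: "\<beta> \<in> one_forms A"
  shows "koszul_bracket A P \<alpha> \<beta> p \<in> cotangent_space A p"
proof -
  note c = one_form_cotangent[OF lie_derivative_one_form[OF anchor_vector_field[OF P \<alpha>] \<beta>]]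
    one_form_cotangent[OF lie_derivative_one_form[OF anchor_vector_field[OF P \<beta>] \<alpha>]]
  have "(\<lambda>v. lie_derivative A (anchor A P \<alpha>) \<beta> p v + ((- 1) * lie_derivative A (anchor A P \<beta>) \<alpha> p v
      + (- 1) * differential A (contra_eval P \<alpha> \<beta>) p v)) \<in> cotangent_space A p"
    by (intro cotangent_add cotangent_scale c differential_cotangent)
  then show ?thesis by (simp add: koszul_bracket_def algebra_simps)
qed

text \<open>The preimage of a small ball in a chart is open and connected, hence lies in one
  component, where \<open>m\<close> is constant. Derivations are local and kill constants.\<close>

lemma essentially_constant_derivative:
  assumes m: "essentially_constant m" and s: "m \<in> smooth_funs A" and v: "v \<in> tangent_space A p"
  shows "v m = 0"
proof -
  obtain U \<phi> where c: "(U, \<phi>) \<in> A" "p \<in> U" using ex_chart by blast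
  obtain r where r: "r > 0" "ball (\<phi> p) r \<subseteq> \<phi> ` U"
    using open_contains_ball chart_image_open[OF c(1)] c(2) by blast
  let ?W = "inv_into U \<phi> ` ball (\<phi> p) r"
  have "continuous_on (ball (\<phi> p) r) (inv_into U \<phi>)"
    using chart_homeo[OF c(1)] r continuous_on_subset by (auto simp: homeomorphism_def)
  then have con: "connected ?W" by (intro connected_continuous_image) auto
  have pW: "p \<in> ?W" using c r(1) by (force simp: image_iff intro!: bexI[of _ "\<phi> p"])
  have "?W = {q\<in>U. \<phi> q \<in> ball (\<phi> p) r}"
  proof (intro equalityI subsetI)
    fix q assume "q \<in> ?W"
    then obtain y where y: "y \<in> ball (\<phi> p) r" "q = inv_into U \<phi> y" by blast
    then obtain u where "u \<in> U" "y = \<phi> u" using r(2) by blast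
    then show "q \<in> {q\<in>U. \<phi> q \<in> ball (\<phi> p) r}" using y c(1) by simp
  next
    fix q assume "q \<in> {q\<in>U. \<phi> q \<in> ball (\<phi> p) r}"
    then show "q \<in> ?W" using c(1) by (metis (mono_tags, lifting) chart_inv image_eqI mem_Collect_eq)
  qed
  then have o: "open ?W" using chart_preimage_open[OF c(1), of "ball (\<phi> p) r"] by simp
  have sub: "?W \<subseteq> connected_component_set UNIV p"
    using con pW by (simp add: connected_component_maximal)
  have "connected_component_set UNIV p \<in> components UNIV" by (auto simp: components_def)
  then have "m constant_on connected_component_set UNIV p" using m by (auto simp: essentially_constant_def)
  then have "m constant_on ?W" using sub by (rule constant_on_subset)
  then have "m q = m p" if "q \<in> ?W" for q using that pW by (auto simp: constant_on_def)
  then have "v m = v (\<lambda>q. m p)"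
    by (intro tangent_local[OF v s smooth_const o pW])
  then show ?thesis using tangent_const[OF v] by simp
qed

end

section \<open>Smooth maps and product manifolds\<close>

text \<open>Smoothness is tested on functions, as fits tangent vectors that are derivations.
  Continuity is recorded because \<open>pullback_one_form\<close> takes preimages of open
  sets.\<close>

definition smooth_map ::
    "('a::topological_space, 'e::euclidean_space) atlas \<Rightarrow> ('b::topological_space, 'f::euclidean_space) atlas \<Rightarrow>
     ('a \<Rightarrow> 'b) \<Rightarrow> bool" where
  "smooth_map A B F \<longleftrightarrow> continuous_on UNIV F \<and> (\<forall>h\<in>smooth_funs B. (\<lambda>x. h (F x)) \<in> smooth_funs A)"

text \<open>The transpose of the differential of \<open>F\<close> at one point. Unlike
  \<open>pullback\<close> it applies to a single covector that is not given as the value of a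
  1-form.\<close>

definition cpull ::
    "('a, 'e::euclidean_space) atlas \<Rightarrow> ('b, 'f::euclidean_space) atlas \<Rightarrow> ('a \<Rightarrow> 'b) \<Rightarrow> 'a \<Rightarrow> 'b covec \<Rightarrow> 'a covec" where
  "cpull A B F p a = (\<lambda>v. if v \<in> tangent_space A p then a (pushforward B F v) else 0)"

lemma pullback_eq_cpull: "pullback A B F \<omega> p = cpull A B F p (\<omega> (F p))"
  by (simp add: pullback_def cpull_def)

lemma cpull_eval: "v \<in> tangent_space A p \<Longrightarrow> cpull A B F p a v = a (pushforward B F v)"
  by (simp add: cpull_def)

lemma cpull_add: "cpull A B F p (\<lambda>v. a v + b v) = (\<lambda>v. cpull A B F p a v + cpull A B F p b v)"
  by (auto simp: cpull_def)

lemma cpull_scale: "cpull A B F p (\<lambda>v. r * a v) = (\<lambda>v. r * cpull A B F p a v)"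
  by (auto simp: cpull_def)

lemma cpull_diff: "cpull A B F p (\<lambda>v. a v - b v) = (\<lambda>v. cpull A B F p a v - cpull A B F p b v)"
  by (auto simp: cpull_def)

lemma pushforward_eval: "h \<in> smooth_funs B \<Longrightarrow> pushforward B F v h = v (\<lambda>x. h (F x))"
  by (simp add: pushforward_def o_def)

lemma pushforward_add: "pushforward B F (\<lambda>h. v h + w h) = (\<lambda>h. pushforward B F v h + pushforward B F w h)"
  by (auto simp: pushforward_def)

lemma pushforward_scale: "pushforward B F (\<lambda>h. c * v h) = (\<lambda>h. c * pushforward B F v h)"
  by (auto simp: pushforward_def)

locale smooth_manifold_map = A: smooth_manifold A + B: smooth_manifold B
  for A :: "('a::{t2_space, second_countable_topology}, 'e::euclidean_space) atlas"
    and B :: "('b::{t2_space, second_countable_topology}, 'f::euclidean_space) atlas" +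
  fixes F :: "'a \<Rightarrow> 'b"
  assumes smooth_map: "smooth_map A B F"
begin

lemma smooth_comp: "h \<in> smooth_funs B \<Longrightarrow> (\<lambda>x. h (F x)) \<in> smooth_funs A"
  using smooth_map by (simp add: smooth_map_def)

lemma pushforward_tangent:
  assumes v: "v \<in> tangent_space A p"
  shows "pushforward B F v \<in> tangent_space B (F p)"
  unfolding tangent_space_def
  by (auto simp: pushforward_def o_def B.smooth_add B.smooth_mult smooth_comp A.tangent_add_fun[OF v]
      A.tangent_scale_fun[OF v] A.tangent_mult_fun[OF v])

lemma cpull_cotangent:
  assumes a: "a \<in> cotangent_space B (F p)"
  shows "cpull A B F p a \<in> cotangent_space A p"
  unfolding cotangent_space_def
  by (auto simp: cpull_def A.tangent_add A.tangent_scale pushforward_add pushforward_scale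
      B.cotangent_add_vec[OF a] B.cotangent_scale_vec[OF a] pushforward_tangent)

text \<open>The vectors pushed forward by \<open>F\<close> need not form a vector field on the
  target. They are expanded in a frame around \<open>F p\<close> instead, with coefficients that are
  smooth functions on the source.\<close>

lemma pullback_one_form:
  assumes \<omega>: "\<omega> \<in> one_forms B"
  shows "pullback A B F \<omega> \<in> one_forms A"
proof -
  have "(\<lambda>p. pullback A B F \<omega> p (X p)) \<in> smooth_funs A" if X: "X \<in> vector_fields A" for X
  proof (rule A.smooth_funs_local)
    fix p
    obtain W y Y where fr: "B.local_frame (F p) W y Y" using B.ex_local_frame .
    note D = B.local_frameD[OF fr]
    let ?g = "\<lambda>q. \<Sum>i\<in>Basis. X q (\<lambda>x. y i (F x)) * \<omega> (F q) (Y i (F q))"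
    have "open (F -` W)"
      using smooth_map D(1) by (auto simp: smooth_map_def continuous_on_open_vimage)
    moreover have "?g \<in> smooth_funs A"
      by (intro A.smooth_sum A.smooth_mult A.vector_field_smooth[OF X] smooth_comp D(3)
          smooth_comp[OF B.one_form_smooth[OF \<omega> D(4)]])
    moreover have "pullback A B F \<omega> q (X q) = ?g q" if q: "q \<in> F -` W" for q
    proof -
      let ?v = "pushforward B F (X q)"
      have t: "X q \<in> tangent_space A q" by (rule A.vector_field_tangent[OF X])
      then have v: "?v \<in> tangent_space B (F q)" by (rule pushforward_tangent)
      have "?v = (\<lambda>h. \<Sum>i\<in>Basis. ?v (y i) * Y i (F q) h)"
        by (intro ext) (rule D(6)[OF _ v], use q in auto)
      then have "\<omega> (F q) ?v = \<omega> (F q) (\<lambda>h. \<Sum>i\<in>Basis. ?v (y i) * Y i (F q) h)" by (rule arg_cong)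
      also have "\<dots> = (\<Sum>i\<in>Basis. ?v (y i) * \<omega> (F q) (Y i (F q)))"
        by (rule B.cotangent_sum_vec[OF B.one_form_cotangent[OF \<omega>] B.vector_field_tangent[OF D(4)]])
      finally show ?thesis using t by (simp add: pullback_def pushforward_eval[OF D(3)])
    qed
    ultimately show "\<exists>W g. open W \<and> p \<in> W \<and> g \<in> smooth_funs A \<and> (\<forall>q\<in>W. pullback A B F \<omega> q (X q) = g q)"
      using D(2) by (intro exI[of _ "F -` W"] exI[of _ ?g]) auto
  qed
  then show ?thesis
    by (simp add: one_forms_def pullback_eq_cpull cpull_cotangent B.one_form_cotangent[OF \<omega>])
qed

end

section \<open>Families of covectors at a fixed point of one manifold, parametrized by
  another\<close>

locale two_manifolds = A: smooth_manifold A + B: smooth_manifold B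
  for A :: "('a::{t2_space, second_countable_topology}, 'e::euclidean_space) atlas"
    and B :: "('b::{t2_space, second_countable_topology}, 'f::euclidean_space) atlas"
begin

text \<open>All \<open>c y\<close> lie in the cotangent space at the same point \<open>p\<close>, so
  the family has a derivative along \<open>w\<close> without any connection, taken for each argument
  \<open>u\<close> separately.\<close>

lemma covector_curve_derivative_cotangent:
  assumes w: "w \<in> tangent_space B q" and c: "\<And>y. c y \<in> cotangent_space A p"
    and s: "\<And>u. u \<in> tangent_space A p \<Longrightarrow> (\<lambda>y. c y u) \<in> smooth_funs B"
  shows "(\<lambda>u. w (\<lambda>y. c y u)) \<in> cotangent_space A p"
  unfolding cotangent_space_def
  by (auto simp: A.cotangent_add_vec[OF c] A.cotangent_scale_vec[OF c] A.cotangent_outside[OF c]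
      B.tangent_add_fun[OF w s s] B.tangent_scale_fun[OF w s] B.tangent_const[OF w])

text \<open>Since \<open>b\<close> and \<open>p\<close> are fixed, a frame at \<open>p\<close> turns
  \<open>b (c y) (d y)\<close> into a sum of products of coefficient functions of \<open>y\<close>
  with constants. Smoothness and the product rule follow term by term.\<close>

lemma bilinear_curve:
  assumes b: "A.cobilinear p b" and c: "\<And>y. c y \<in> cotangent_space A p" and d: "\<And>y. d y \<in> cotangent_space A p"
    and sc: "\<And>u. u \<in> tangent_space A p \<Longrightarrow> (\<lambda>y. c y u) \<in> smooth_funs B"
    and sd: "\<And>u. u \<in> tangent_space A p \<Longrightarrow> (\<lambda>y. d y u) \<in> smooth_funs B"
  shows bilinear_curve_smooth: "(\<lambda>y. b (c y) (d y)) \<in> smooth_funs B"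
    and bilinear_curve_derivative: "w \<in> tangent_space B q \<Longrightarrow>
      w (\<lambda>y. b (c y) (d y)) = b (\<lambda>u. w (\<lambda>y. c y u)) (d q) + b (c q) (\<lambda>u. w (\<lambda>y. d y u))"
proof -
  obtain W x X where F: "A.local_frame p W x X" using A.ex_local_frame .
  note D = A.local_frameD[OF F]
  let ?e = "\<lambda>i. differential A (x i) p"
  have tX: "X i p \<in> tangent_space A p" for i by (rule A.vector_field_tangent[OF D(4)])
  note dc = A.differential_cotangent
  have exp: "b a a' = (\<Sum>i\<in>Basis. \<Sum>j\<in>Basis. (a (X i p) * a' (X j p)) * b (?e i) (?e j))"
    if a: "a \<in> cotangent_space A p" "a' \<in> cotangent_space A p" for a a'
  proof -
    have "b a a' = b (\<lambda>v. \<Sum>i\<in>Basis. a (X i p) * ?e i v) a'"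
      using A.cotangent_frame[OF F D(2) a(1)] by (rule arg_cong)
    also have "\<dots> = (\<Sum>i\<in>Basis. a (X i p) * b (?e i) a')"
      by (rule A.cobilinear_sum(1)[OF b dc a(2)])
    also have "\<dots> = (\<Sum>i\<in>Basis. a (X i p) * b (?e i) (\<lambda>v. \<Sum>j\<in>Basis. a' (X j p) * ?e j v))"
      using A.cotangent_frame[OF F D(2) a(2)] by (rule arg_cong)
    also have "\<dots> = (\<Sum>i\<in>Basis. a (X i p) * (\<Sum>j\<in>Basis. a' (X j p) * b (?e i) (?e j)))"
      by (simp only: A.cobilinear_sum(2)[OF b dc dc])
    finally show ?thesis by (simp add: sum_distrib_left mult.assoc)
  qed
  have e: "(\<lambda>y. b (c y) (d y)) = (\<lambda>y. \<Sum>i\<in>Basis. \<Sum>j\<in>Basis. (c y (X i p) * d y (X j p)) * b (?e i) (?e j))"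
    by (simp only: exp[OF c d])
  have sm: "(\<lambda>y. (c y (X i p) * d y (X j p)) * b (?e i) (?e j)) \<in> smooth_funs B" for i j
    by (intro B.smooth_mult B.smooth_const sc sd tX)
  show "(\<lambda>y. b (c y) (d y)) \<in> smooth_funs B"
    unfolding e by (intro B.smooth_sum sm)
  assume w: "w \<in> tangent_space B q"
  have 1: "w (\<lambda>y. (c y (X i p) * d y (X j p)) * b (?e i) (?e j)) =
      (w (\<lambda>y. c y (X i p)) * d q (X j p) + c q (X i p) * w (\<lambda>y. d y (X j p))) * b (?e i) (?e j)" for i j
  proof -
    have 1: "w (\<lambda>y. (c y (X i p) * d y (X j p)) * b (?e i) (?e j)) =
        (c q (X i p) * d q (X j p)) * w (\<lambda>y. b (?e i) (?e j)) + b (?e i) (?e j) * w (\<lambda>y. c y (X i p) * d y (X j p))"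
      by (rule B.tangent_mult_fun[OF w B.smooth_mult[OF sc[OF tX] sd[OF tX]] B.smooth_const])
    have 2: "w (\<lambda>y. c y (X i p) * d y (X j p)) = c q (X i p) * w (\<lambda>y. d y (X j p)) + d q (X j p) * w (\<lambda>y. c y (X i p))"
      by (rule B.tangent_mult_fun[OF w sc[OF tX] sd[OF tX]])
    show ?thesis unfolding 1 2 B.tangent_const[OF w] by (simp add: algebra_simps)
  qed
  have "w (\<lambda>y. b (c y) (d y)) = (\<Sum>i\<in>Basis. \<Sum>j\<in>Basis.
      (w (\<lambda>y. c y (X i p)) * d q (X j p) + c q (X i p) * w (\<lambda>y. d y (X j p))) * b (?e i) (?e j))"
    unfolding e by (simp add: B.tangent_sum_fun[OF w] B.smooth_sum sm 1)
  also have "\<dots> = b (\<lambda>u. w (\<lambda>y. c y u)) (d q) + b (c q) (\<lambda>u. w (\<lambda>y. d y u))"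
    using exp[OF covector_curve_derivative_cotangent[of w q c p, OF w c sc] d]
      exp[OF c covector_curve_derivative_cotangent[of w q d p, OF w d sd]]
    by (simp add: distrib_right sum.distrib)
  finally show "w (\<lambda>y. b (c y) (d y)) = b (\<lambda>u. w (\<lambda>y. c y u)) (d q) + b (c q) (\<lambda>u. w (\<lambda>y. d y u))" .
qed

end

text \<open>The pairing \<open>mk\<close> is abstract so that the locale is symmetric in the two factors: every statement
  about \<open>A\<close> transfers to \<open>B\<close> by interpreting the locale with \<open>A\<close> and \<open>B\<close> exchanged.\<close>

locale product_manifold = A: smooth_manifold A + B: smooth_manifold B + M: smooth_manifold M
  for A :: "('a::{t2_space, second_countable_topology}, 'e::euclidean_space) atlas"
    and B :: "('b::{t2_space, second_countable_topology}, 'f::euclidean_space) atlas"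
    and M :: "('c::{t2_space, second_countable_topology}, 'g::euclidean_space) atlas" +
  fixes pA :: "'c \<Rightarrow> 'a" and pB :: "'c \<Rightarrow> 'b" and mk :: "'a \<Rightarrow> 'b \<Rightarrow> 'c"
  assumes pA_mk [simp]: "pA (mk x y) = x" and pB_mk [simp]: "pB (mk x y) = y" and mk_p [simp]: "mk (pA z) (pB z) = z"
    and smooth_pA: "smooth_map M A pA" and smooth_pB: "smooth_map M B pB"
    and smooth_mkA: "smooth_map A M (\<lambda>x. mk x y)" and smooth_mkB: "smooth_map B M (\<lambda>y. mk x y)"
    and tangent_split: "v \<in> tangent_space M z \<Longrightarrow> h \<in> smooth_funs M \<Longrightarrow>
      v h = v (\<lambda>z'. h (mk (pA z') (pB z))) + v (\<lambda>z'. h (mk (pA z) (pB z')))"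
    and smooth_liftA: "X \<in> vector_fields A \<Longrightarrow> h \<in> smooth_funs M \<Longrightarrow> (\<lambda>z. X (pA z) (\<lambda>x. h (mk x (pB z)))) \<in> smooth_funs M"
    and smooth_liftB: "Y \<in> vector_fields B \<Longrightarrow> h \<in> smooth_funs M \<Longrightarrow> (\<lambda>z. Y (pB z) (\<lambda>y. h (mk (pA z) y))) \<in> smooth_funs M"
begin

lemma swap: "product_manifold B A M pB pA (\<lambda>y x. mk x y)"
  using smooth_pA smooth_pB smooth_mkA smooth_mkB tangent_split smooth_liftA smooth_liftB
  by unfold_locales (simp_all add: add.commute)

sublocale PA: smooth_manifold_map M A pA by unfold_locales (rule smooth_pA)
sublocale PB: smooth_manifold_map M B pB by unfold_locales (rule smooth_pB)
sublocale IA: smooth_manifold_map A M "\<lambda>x. mk x y" for y by unfold_locales (rule smooth_mkA)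
sublocale IB: smooth_manifold_map B M "\<lambda>y. mk x y" for x by unfold_locales (rule smooth_mkB)
sublocale AB: two_manifolds A B ..
sublocale BA: two_manifolds B A ..

text \<open>Reading aid for the letters: v projects vectors, i includes vectors of a factor into the
  product along a slice, c restricts covectors, s takes slices of 1-forms and l lifts them. The
  capital letter names the factor.\<close>

abbreviation "vA \<equiv> pushforward A pA"
abbreviation "vB \<equiv> pushforward B pB"
abbreviation "iA y \<equiv> pushforward M (\<lambda>x. mk x y)"
abbreviation "iB x \<equiv> pushforward M (\<lambda>y. mk x y)"
abbreviation "cA z \<equiv> cpull A M (\<lambda>x. mk x (pB z)) (pA z)"
abbreviation "cB z \<equiv> cpull B M (\<lambda>y. mk (pA z) y) (pB z)"
abbreviation "sA y \<equiv> pullback A M (\<lambda>x. mk x y)"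
abbreviation "sB x \<equiv> pullback B M (\<lambda>y. mk x y)"
abbreviation "lA \<equiv> pullback M A pA"
abbreviation "lB \<equiv> pullback M B pB"

lemma iA_tangent: "u \<in> tangent_space A x \<Longrightarrow> iA y u \<in> tangent_space M (mk x y)"
  by (rule IA.pushforward_tangent)

lemma vA_iA: "u \<in> tangent_space A x \<Longrightarrow> vA (iA y u) = u"
  by (auto simp: fun_eq_iff pushforward_def o_def PA.smooth_comp A.tangent_nonsmooth)

lemma vB_iA: "u \<in> tangent_space A x \<Longrightarrow> vB (iA y u) = (\<lambda>h. 0)"
  by (auto simp: fun_eq_iff pushforward_def o_def PB.smooth_comp A.tangent_const)

lemma vA_tangent: "v \<in> tangent_space M z \<Longrightarrow> vA v \<in> tangent_space A (pA z)"
  by (rule PA.pushforward_tangent)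

lemma vector_split: "v \<in> tangent_space M z \<Longrightarrow> v = (\<lambda>h. iA (pB z) (vA v) h + iB (pA z) (vB v) h)"
  using tangent_split[of v z]
  by (auto simp: fun_eq_iff pushforward_def o_def IA.smooth_comp IB.smooth_comp M.tangent_nonsmooth)

lemma cA_cotangent: "a \<in> cotangent_space M z \<Longrightarrow> cA z a \<in> cotangent_space A (pA z)"
  by (rule IA.cpull_cotangent) simp

lemma sA_at: "sA (pB z) \<omega> (pA z) = cA z (\<omega> z)"
  by (simp add: pullback_eq_cpull)

lemma sA_one_form: "\<omega> \<in> one_forms M \<Longrightarrow> sA y \<omega> \<in> one_forms A"
  by (rule IA.pullback_one_form)

lemma lA_one_form: "\<alpha> \<in> one_forms A \<Longrightarrow> lA \<alpha> \<in> one_forms M"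
  by (rule PA.pullback_one_form)

lemma sA_lA: "\<alpha> \<in> one_forms A \<Longrightarrow> sA y (lA \<alpha>) = \<alpha>"
  by (auto simp: fun_eq_iff pullback_def iA_tangent vA_iA
      A.cotangent_outside[OF A.one_form_cotangent])

lemma sA_lB: "\<alpha> \<in> one_forms B \<Longrightarrow> sA y (lB \<alpha>) x = (\<lambda>v. 0)"
  by (auto simp: fun_eq_iff pullback_def iA_tangent vB_iA
      B.cotangent_zero_vec[OF B.one_form_cotangent])

lemma cA_lA: "\<alpha> \<in> one_forms A \<Longrightarrow> cA z (lA \<alpha> z) = \<alpha> (pA z)"
  using sA_lA[of \<alpha> "pB z"] sA_at[of z "lA \<alpha>"] by simp

lemma cA_lB: "\<alpha> \<in> one_forms B \<Longrightarrow> cA z (lB \<alpha> z) = (\<lambda>v. 0)"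
  using sA_lB[of \<alpha> "pB z" "pA z"] sA_at[of z "lB \<alpha>"] by simp

lemma lift_vector_field:
  assumes X: "X \<in> vector_fields A"
  shows "(\<lambda>z. iA (pB z) (X (pA z))) \<in> vector_fields M"
proof -
  have "iA (pB z) (X (pA z)) \<in> tangent_space M z" for z
    using iA_tangent[OF A.vector_field_tangent[OF X, of "pA z"], of "pB z"] by simp
  then show ?thesis using smooth_liftA[OF X] by (simp add: vector_fields_def pushforward_eval)
qed

text \<open>Extend \<open>u\<close> to a field on the factor and lift it. The pairing of \<omega>
  with the lifted field is smooth on the product, and the function in question is its restriction to
  the slice over \<open>x\<close>.\<close>

lemma slice_smooth:
  assumes \<omega>: "\<omega> \<in> one_forms M" and u: "u \<in> tangent_space A x"
  shows "(\<lambda>y. sA y \<omega> x u) \<in> smooth_funs B"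
proof -
  obtain X where X: "X \<in> vector_fields A" "X x = u" using A.vector_field_extend[OF u] .
  from IB.smooth_comp[OF M.one_form_smooth[OF \<omega> lift_vector_field[OF X(1)]], of x] X(2) u
  show ?thesis by (simp add: pullback_def)
qed

text \<open>A weighted orthogonal sum. Both weights are functions on the product, so the notion is
  symmetric in the factors although the warping functions live on the first one.\<close>

definition split_tensor ::
    "('c \<Rightarrow> 'c covec \<Rightarrow> 'c covec \<Rightarrow> real) \<Rightarrow> ('c \<Rightarrow> real) \<Rightarrow> ('a \<Rightarrow> 'a covec \<Rightarrow> 'a covec \<Rightarrow> real) \<Rightarrow>
     ('c \<Rightarrow> real) \<Rightarrow> ('b \<Rightarrow> 'b covec \<Rightarrow> 'b covec \<Rightarrow> real) \<Rightarrow> bool" where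
  "split_tensor T \<kappa>A TA \<kappa>B TB \<longleftrightarrow> (\<forall>z. \<forall>a\<in>cotangent_space M z. \<forall>b\<in>cotangent_space M z.
     T z a b = \<kappa>A z * TA (pA z) (cA z a) (cA z b) + \<kappa>B z * TB (pB z) (cB z a) (cB z b))"

end

section \<open>Covectors and tensors on the product through their restrictions\<close>

context product_manifold begin

interpretation S: product_manifold B A M pB pA "\<lambda>y x. mk x y" by (rule swap)

lemma covector_split:
  assumes a: "a \<in> cotangent_space M z" and v: "v \<in> tangent_space M z"
  shows "a v = cA z a (vA v) + cB z a (vB v)"
proof -
  have t: "iA (pB z) (vA v) \<in> tangent_space M z" "iB (pA z) (vB v) \<in> tangent_space M z"
    using iA_tangent[OF vA_tangent[OF v], of "pB z"] S.iA_tangent[OF S.vA_tangent[OF v], of "pA z"] by simp_all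
  have "a v = a (\<lambda>h. iA (pB z) (vA v) h + iB (pA z) (vB v) h)"
    using vector_split[OF v] by (rule arg_cong)
  then show ?thesis
    by (simp add: M.cotangent_add_vec[OF a t] cpull_eval vA_tangent[OF v] S.vA_tangent[OF v])
qed

lemma covector_eqI:
  assumes "a \<in> cotangent_space M z" "b \<in> cotangent_space M z" "cA z a = cA z b" "cB z a = cB z b"
  shows "a = b"
  using assms by (intro M.cotangent_eqI[OF assms(1,2)]) (simp add: covector_split)

lemma lift_extend:
  assumes a: "a \<in> cotangent_space M z"
  obtains \<alpha> \<beta> where "\<alpha> \<in> one_forms A" "\<beta> \<in> one_forms B" "a = (\<lambda>v. lA \<alpha> z v + lB \<beta> z v)"
    "cA z a = \<alpha> (pA z)" "cB z a = \<beta> (pB z)"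
proof -
  obtain \<alpha> where \<alpha>: "\<alpha> \<in> one_forms A" "\<alpha> (pA z) = cA z a" using A.one_form_extend[OF cA_cotangent[OF a]] .
  obtain \<beta> where \<beta>: "\<beta> \<in> one_forms B" "\<beta> (pB z) = cB z a" using B.one_form_extend[OF S.cA_cotangent[OF a]] .
  note l = M.one_form_cotangent[OF lA_one_form[OF \<alpha>(1)]] M.one_form_cotangent[OF S.lA_one_form[OF \<beta>(1)]]
  have "a = (\<lambda>v. lA \<alpha> z v + lB \<beta> z v)"
    by (rule covector_eqI[OF a M.cotangent_add[OF l]])
      (simp_all add: cpull_add cA_lA[OF \<alpha>(1)] cA_lB[OF \<beta>(1)] S.cA_lA[OF \<beta>(1)] S.cA_lB[OF \<alpha>(1)] \<alpha>(2) \<beta>(2))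
  then show thesis using that \<alpha> \<beta> by simp
qed

text \<open>The warped tensors are prescribed on lifts only, but by \<open>lift_extend\<close> every
  covector at a point is a sum of two lifted ones. The mixed values are asked for in both orders, so
  that one rule serves symmetric and antisymmetric tensors.\<close>

lemma split_tensorI:
  assumes T: "contravariant_tensor2 M T"
    and AA: "\<And>\<alpha> \<beta> z. \<alpha> \<in> one_forms A \<Longrightarrow> \<beta> \<in> one_forms A \<Longrightarrow> T z (lA \<alpha> z) (lA \<beta> z) = \<kappa>A z * TA (pA z) (\<alpha> (pA z)) (\<beta> (pA z))"
    and BB: "\<And>\<alpha> \<beta> z. \<alpha> \<in> one_forms B \<Longrightarrow> \<beta> \<in> one_forms B \<Longrightarrow> T z (lB \<alpha> z) (lB \<beta> z) = \<kappa>B z * TB (pB z) (\<alpha> (pB z)) (\<beta> (pB z))"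
    and AB: "\<And>\<alpha> \<beta> z. \<alpha> \<in> one_forms A \<Longrightarrow> \<beta> \<in> one_forms B \<Longrightarrow> T z (lA \<alpha> z) (lB \<beta> z) = 0"
    and BA: "\<And>\<alpha> \<beta> z. \<alpha> \<in> one_forms A \<Longrightarrow> \<beta> \<in> one_forms B \<Longrightarrow> T z (lB \<beta> z) (lA \<alpha> z) = 0"
  shows "split_tensor T \<kappa>A TA \<kappa>B TB"
  unfolding split_tensor_def
proof (intro allI ballI)
  fix z a b assume a: "a \<in> cotangent_space M z" and b: "b \<in> cotangent_space M z"
  obtain \<alpha> \<beta> where \<alpha>: "\<alpha> \<in> one_forms A" "\<beta> \<in> one_forms B" "a = (\<lambda>v. lA \<alpha> z v + lB \<beta> z v)"
    "cA z a = \<alpha> (pA z)" "cB z a = \<beta> (pB z)" using lift_extend[OF a] .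
  obtain \<gamma> \<delta> where \<gamma>: "\<gamma> \<in> one_forms A" "\<delta> \<in> one_forms B" "b = (\<lambda>v. lA \<gamma> z v + lB \<delta> z v)"
    "cA z b = \<gamma> (pA z)" "cB z b = \<delta> (pB z)" using lift_extend[OF b] .
  note bl = M.cobilinear_add[OF M.tensor_cobilinear[OF T, of z]]
  note l = M.one_form_cotangent[OF lA_one_form] M.one_form_cotangent[OF S.lA_one_form]
  have "T z a b = (T z (lA \<alpha> z) (lA \<gamma> z) + T z (lA \<alpha> z) (lB \<delta> z)) + (T z (lB \<beta> z) (lA \<gamma> z) + T z (lB \<beta> z) (lB \<delta> z))"
    using \<alpha>(1,2) \<gamma>(1,2) by (simp add: \<alpha>(3) \<gamma>(3) bl l M.cotangent_add)
  then show "T z a b = \<kappa>A z * TA (pA z) (cA z a) (cA z b) + \<kappa>B z * TB (pB z) (cB z a) (cB z b)"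
    using \<alpha>(1,2) \<gamma>(1,2) by (simp add: AA BB AB BA \<alpha>(4,5) \<gamma>(4,5))
qed

lemma split_tensorD:
  "split_tensor T \<kappa>A TA \<kappa>B TB \<Longrightarrow> a \<in> cotangent_space M z \<Longrightarrow> b \<in> cotangent_space M z \<Longrightarrow>
    T z a b = \<kappa>A z * TA (pA z) (cA z a) (cA z b) + \<kappa>B z * TB (pB z) (cB z a) (cB z b)"
  by (simp add: split_tensor_def)

lemma split_tensor_swap:
  assumes "split_tensor T \<kappa>A TA \<kappa>B TB"
  shows "product_manifold.split_tensor B A M pB pA (\<lambda>y x. mk x y) T \<kappa>B TB \<kappa>A TA"
  unfolding S.split_tensor_def
proof (intro allI ballI)
  fix z a b assume "a \<in> cotangent_space M z" "b \<in> cotangent_space M z"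
  from split_tensorD[OF assms this]
  show "T z a b = \<kappa>B z * TB (pB z) (cB z a) (cB z b) + \<kappa>A z * TA (pA z) (cA z a) (cA z b)" by linarith
qed

end

section \<open>The Koszul bracket on a product\<close>

context smooth_manifold begin

lemma anchor_lin:
  assumes P: "contravariant_tensor2 A P" and \<alpha>: "\<alpha> \<in> one_forms A" and \<beta>: "\<beta> \<in> one_forms A"
  shows "anchor A P (\<lambda>p v. r * \<alpha> p v + s * \<beta> p v) p h = r * anchor A P \<alpha> p h + s * anchor A P \<beta> p h"
  using tensor_cobilinear[OF P, of p] one_form_cotangent[OF \<alpha>] one_form_cotangent[OF \<beta>] differential_cotangent
  by (simp add: anchor_apply[OF P] \<alpha> \<beta> one_form_lin cobilinear_def)

lemma anchor_mult:
  assumes P: "contravariant_tensor2 A P" and \<alpha>: "\<alpha> \<in> one_forms A" and k: "k \<in> smooth_funs A"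
  shows "anchor A P (\<lambda>p v. k p * \<alpha> p v) p h = k p * anchor A P \<alpha> p h"
  by (simp add: anchor_apply[OF P] \<alpha> k one_form_mult
      cobilinear_scale[OF tensor_cobilinear[OF P] one_form_cotangent[OF \<alpha>] differential_cotangent])

end

lemma bivector_tensor: "bivector_field A P \<Longrightarrow> contravariant_tensor2 A P"
  by (simp add: bivector_field_def)

lemma bivector_antisym:
  "bivector_field A P \<Longrightarrow> a \<in> cotangent_space A p \<Longrightarrow> b \<in> cotangent_space A p \<Longrightarrow> P p a b = - P p b a"
  unfolding bivector_field_def by blast

context product_manifold begin

lemma sA_lin: "sA y (\<lambda>z v. r * \<alpha> z v + s * \<beta> z v) = (\<lambda>x v. r * sA y \<alpha> x v + s * sA y \<beta> x v)"
  by (auto simp: pullback_def fun_eq_iff)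

lemma sA_mult: "sA y (\<lambda>z v. h z * \<alpha> z v) = (\<lambda>x v. h (mk x y) * sA y \<alpha> x v)"
  by (auto simp: pullback_def fun_eq_iff)

lemma lA_lin: "lA (\<lambda>z v. r * \<alpha> z v + s * \<beta> z v) = (\<lambda>x v. r * lA \<alpha> x v + s * lA \<beta> x v)"
  by (auto simp: pullback_def fun_eq_iff)

lemma lA_mult: "lA (\<lambda>z v. h z * \<alpha> z v) = (\<lambda>x v. h (pA x) * lA \<alpha> x v)"
  by (auto simp: pullback_def fun_eq_iff)

lemma sA_cotangent: "\<alpha> \<in> one_forms M \<Longrightarrow> sA y \<alpha> x \<in> cotangent_space A x"
  using A.one_form_cotangent sA_one_form by blast

lemma sA_lift_field: "X \<in> vector_fields A \<Longrightarrow> sA y \<beta> x (X x) = \<beta> (mk x y) (iA y (X x))"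
  using A.vector_field_tangent by (simp add: pullback_def)

lemma slice_derivative_cotangent:
  "\<omega> \<in> one_forms M \<Longrightarrow> w \<in> tangent_space B y \<Longrightarrow> (\<lambda>u. w (\<lambda>y. sA y \<omega> x u)) \<in> cotangent_space A x"
  by (rule AB.covector_curve_derivative_cotangent) (auto intro: sA_cotangent slice_smooth)

lemma cA_cpull_pA: "c \<in> cotangent_space A (pA z) \<Longrightarrow> cA z (cpull M A pA z c) = c"
  using iA_tangent[of _ "pA z" "pB z"]
  by (auto simp: cpull_def fun_eq_iff vA_iA A.cotangent_outside)

lemma cA_cpull_pB: "c \<in> cotangent_space B (pB z) \<Longrightarrow> cA z (cpull M B pB z c) = (\<lambda>u. 0)"
  using iA_tangent[of _ "pA z" "pB z"]
  by (auto simp: cpull_def fun_eq_iff vB_iA B.cotangent_zero_vec)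

end

text \<open>In the theorem the weights are 1 and the lift of \<mu>. Being killed by all tangent
  vectors, they pass through every derivative in the bracket; imposing this on both keeps the locale
  symmetric.\<close>

locale product_bivector = product_manifold A B M pA pB mk
  for A :: "('a::{t2_space, second_countable_topology}, 'e::euclidean_space) atlas"
    and B :: "('b::{t2_space, second_countable_topology}, 'f::euclidean_space) atlas"
    and M :: "('c::{t2_space, second_countable_topology}, 'g::euclidean_space) atlas"
    and pA pB mk +
  fixes P PA PB and lamA lamB :: "'c \<Rightarrow> real"
  assumes biv: "bivector_field M P" and bivA: "bivector_field A PA" and bivB: "bivector_field B PB"
    and split: "split_tensor P lamA PA lamB PB"
    and lamA_smooth: "lamA \<in> smooth_funs M" and lamB_smooth: "lamB \<in> smooth_funs M"
    and lamA_const: "v \<in> tangent_space M z \<Longrightarrow> v lamA = 0" and lamB_const: "v \<in> tangent_space M z \<Longrightarrow> v lamB = 0"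
begin

lemma swap_bivector: "product_bivector B A M pB pA (\<lambda>y x. mk x y) P PB PA lamB lamA"
proof -
  interpret S: product_manifold B A M pB pA "\<lambda>y x. mk x y" by (rule swap)
  show ?thesis
    by unfold_locales (use biv bivA bivB split_tensor_swap[OF split] lamA_smooth lamB_smooth lamA_const lamB_const in auto)
qed

lemmas tens = bivector_tensor[OF biv]
lemmas tensA = bivector_tensor[OF bivA]
lemmas tensB = bivector_tensor[OF bivB]

text \<open>The component of the anchor of \<open>P\<close> along the factor, before multiplication
  by its weight. It uses the slice of \<alpha> through \<open>z\<close>, which changes with
  \<open>z\<close>.\<close>

abbreviation "aA \<alpha> z \<equiv> anchor A PA (sA (pB z) \<alpha>) (pA z)"
abbreviation "aB \<alpha> z \<equiv> anchor B PB (sB (pA z) \<alpha>) (pB z)"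

lemma aA_tangent: "\<alpha> \<in> one_forms M \<Longrightarrow> aA \<alpha> z \<in> tangent_space A (pA z)"
  by (rule A.anchor_tangent[OF tensA sA_one_form])

lemma aA_lin: "\<alpha> \<in> one_forms M \<Longrightarrow> \<beta> \<in> one_forms M \<Longrightarrow>
    aA (\<lambda>z v. r * \<alpha> z v + s * \<beta> z v) z h = r * aA \<alpha> z h + s * aA \<beta> z h"
  by (simp add: sA_lin A.anchor_lin[OF tensA] sA_one_form)

lemma aA_lA: "\<alpha> \<in> one_forms A \<Longrightarrow> aA (lA \<alpha>) z = anchor A PA \<alpha> (pA z)"
  by (simp add: sA_lA)

lemma aA_lB:
  assumes \<alpha>: "\<alpha> \<in> one_forms B"
  shows "aA (lB \<alpha>) z = (\<lambda>h. 0)"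
proof -
  interpret S: product_manifold B A M pB pA "\<lambda>y x. mk x y" by (rule swap)
  show ?thesis
    using A.cobilinear_scale(1)[OF A.tensor_cobilinear[OF tensA] A.cotangent_zero A.differential_cotangent, of _ 0]
    by (simp add: fun_eq_iff A.anchor_apply[OF tensA sA_one_form[OF S.lA_one_form[OF \<alpha>]]] sA_lB[OF \<alpha>])
qed

lemma lamA_slice: "u \<in> tangent_space A x \<Longrightarrow> u (\<lambda>x. lamA (mk x y)) = 0"
  using lamA_const[OF iA_tangent[of u x y]] by (simp add: pushforward_eval lamA_smooth)

lemma lamB_slice: "u \<in> tangent_space A x \<Longrightarrow> u (\<lambda>x. lamB (mk x y)) = 0"
  using lamB_const[OF iA_tangent[of u x y]] by (simp add: pushforward_eval lamB_smooth)

end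

context product_bivector begin

interpretation S: product_bivector B A M pB pA "\<lambda>y x. mk x y" P PB PA lamB lamA by (rule swap_bivector)

text \<open>Pair \<alpha> with the differential of \<open>h\<close> under \<open>P\<close>. The
  restrictions of that differential act on vectors of the factors as derivatives of the two slices
  of \<open>h\<close>.\<close>

lemma anchor_split:
  assumes \<alpha>: "\<alpha> \<in> one_forms M" and h: "h \<in> smooth_funs M"
  shows "anchor M P \<alpha> z h = lamA z * aA \<alpha> z (\<lambda>x. h (mk x (pB z))) + lamB z * aB \<alpha> z (\<lambda>y. h (mk (pA z) y))"
proof -
  let ?d = "differential M h z"
  note d = M.differential_cotangent[of h z]
  have a: "aA \<alpha> z (\<lambda>x. h (mk x (pB z))) = PA (pA z) (cA z (\<alpha> z)) (cA z ?d)"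
  proof -
    have "aA \<alpha> z (\<lambda>x. h (mk x (pB z))) = cA z ?d (aA \<alpha> z)"
      using aA_tangent[OF \<alpha>, of z] iA_tangent[OF aA_tangent[OF \<alpha>, of z], of "pB z"]
      by (simp add: cpull_eval M.differential_eval pushforward_eval h)
    also have "\<dots> = PA (pA z) (sA (pB z) \<alpha> (pA z)) (cA z ?d)"
      by (rule A.anchor_eval[OF tensA sA_one_form[OF \<alpha>] cA_cotangent[OF d]])
    finally show ?thesis by (simp add: sA_at)
  qed
  have b: "aB \<alpha> z (\<lambda>y. h (mk (pA z) y)) = PB (pB z) (cB z (\<alpha> z)) (cB z ?d)"
  proof -
    have "aB \<alpha> z (\<lambda>y. h (mk (pA z) y)) = cB z ?d (aB \<alpha> z)"
      using S.aA_tangent[OF \<alpha>, of z] S.iA_tangent[OF S.aA_tangent[OF \<alpha>, of z], of "pA z"]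
      by (simp add: cpull_eval M.differential_eval pushforward_eval h)
    also have "\<dots> = PB (pB z) (sB (pA z) \<alpha> (pB z)) (cB z ?d)"
      by (rule B.anchor_eval[OF tensB S.sA_one_form[OF \<alpha>] S.cA_cotangent[OF d]])
    finally show ?thesis by (simp add: S.sA_at)
  qed
  show ?thesis
    by (simp add: M.anchor_apply[OF tens \<alpha>] split_tensorD[OF split M.one_form_cotangent[OF \<alpha>] d] a b)
qed

text \<open>Both sides are tested on \<open>u\<close>, extended to a field on the first factor and
  lifted. The terms in which \<open>u\<close> differentiates slices in the second factor arise once
  from the Lie brackets (\<open>T2\<close>) and once from the differential of the pairing
  (\<open>T3\<close>), and cancel by antisymmetry of \<open>PB\<close>. What survives across the
  factors is the derivative of the first slices along the second anchor.\<close>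

lemma koszul_split:
  assumes \<alpha>: "\<alpha> \<in> one_forms M" and \<beta>: "\<beta> \<in> one_forms M"
  shows "cA z (koszul_bracket M P \<alpha> \<beta> z) =
    (\<lambda>u. lamA z * koszul_bracket A PA (sA (pB z) \<alpha>) (sA (pB z) \<beta>) (pA z) u +
      lamB z * (aB \<alpha> z (\<lambda>y. sA y \<beta> (pA z) u) - aB \<beta> z (\<lambda>y. sA y \<alpha> (pA z) u)))"
    (is "?L = ?R")
proof (rule A.cotangent_eqI)
  let ?x = "pA z" and ?y = "pB z"
  show "?L \<in> cotangent_space A ?x"
    by (rule cA_cotangent[OF M.koszul_bracket_cotangent[OF tens \<alpha> \<beta>]])
  have "(\<lambda>u. lamA z * koszul_bracket A PA (sA ?y \<alpha>) (sA ?y \<beta>) ?x u +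
      (lamB z * aB \<alpha> z (\<lambda>y. sA y \<beta> ?x u) + (- lamB z) * aB \<beta> z (\<lambda>y. sA y \<alpha> ?x u))) \<in> cotangent_space A ?x"
    by (intro A.cotangent_add A.cotangent_scale slice_derivative_cotangent[OF \<alpha> S.aA_tangent[OF \<beta>]]
        slice_derivative_cotangent[OF \<beta> S.aA_tangent[OF \<alpha>]] A.koszul_bracket_cotangent tensA sA_one_form \<alpha> \<beta>)
  then show "?R \<in> cotangent_space A ?x" by (simp add: algebra_simps)
  fix u assume u: "u \<in> tangent_space A ?x"
  obtain X where X: "X \<in> vector_fields A" "X ?x = u" using A.vector_field_extend[OF u] .
  let ?X = "\<lambda>z. iA (pB z) (X (pA z))"
  note tX = A.vector_field_tangent[OF X(1)]
  note X' = lift_vector_field[OF X(1)]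
  have Xk: "?X z' (\<lambda>z. k (pA z)) = X (pA z') k" if "k \<in> smooth_funs A" for k z'
    by (simp add: pushforward_eval PA.smooth_comp that)
  \<comment> \<open>The lifted field is tangent to the first factor, so functions coming from the
    second one are constant along it.\<close>
  have Xc: "?X z' (\<lambda>z. k (pB z)) = 0" if "k \<in> smooth_funs B" for k z'
    by (simp add: pushforward_eval PB.smooth_comp that A.tangent_const[OF tX])
  have T1: "anchor M P \<omega> z (\<lambda>z. \<eta> z (?X z)) =
      lamA z * aA \<omega> z (\<lambda>x. sA ?y \<eta> x (X x)) + lamB z * aB \<omega> z (\<lambda>y. sA y \<eta> ?x u)"
    if \<omega>: "\<omega> \<in> one_forms M" and \<eta>: "\<eta> \<in> one_forms M" for \<omega> \<eta>
    by (simp add: anchor_split[OF \<omega> M.one_form_smooth[OF \<eta> X']] sA_lift_field[OF X(1)] X(2)[symmetric])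
  have dot: "(\<lambda>w. u (\<lambda>x. sB x \<omega> ?y w)) \<in> cotangent_space B ?y" if "\<omega> \<in> one_forms M" for \<omega>
    by (rule S.slice_derivative_cotangent[OF that u])
  \<comment> \<open>At the fixed point \<open>?y\<close> the form \<open>PB ?y\<close> does not move
    with \<open>x\<close>; the second argument is a constant family, whose derivative is the zero
    covector.\<close>
  have frozen: "u (\<lambda>x. PB ?y (sB x \<omega> ?y) b) = PB ?y (\<lambda>w. u (\<lambda>x. sB x \<omega> ?y w)) b"
    if \<omega>: "\<omega> \<in> one_forms M" and b: "b \<in> cotangent_space B ?y" for \<omega> b
    using BA.bilinear_curve_derivative[OF B.tensor_cobilinear[OF tensB] S.sA_cotangent[OF \<omega>] b S.slice_smooth[OF \<omega>] A.smooth_const u]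
      A.tangent_const[OF u]
      B.cobilinear_scale(2)[OF B.tensor_cobilinear[OF tensB] B.cotangent_zero S.sA_cotangent[OF \<omega>], where r = 0]
    by simp
  \<comment> \<open>The lifted field is tangent to the first factor, yet its bracket with the anchor
    has a component along the second one, because that part of the anchor moves with
    \<open>x\<close>. This component gives the last term.\<close>
  have T2: "\<eta> z (lie_bracket M (anchor M P \<omega>) ?X z) =
      lamA z * sA ?y \<eta> ?x (lie_bracket A (anchor A PA (sA ?y \<omega>)) X ?x)
      - lamB z * PB ?y (\<lambda>w. u (\<lambda>x. sB x \<omega> ?y w)) (cB z (\<eta> z))"
    if \<omega>: "\<omega> \<in> one_forms M" and \<eta>: "\<eta> \<in> one_forms M" for \<omega> \<eta>
  proof -
    let ?V = "lie_bracket M (anchor M P \<omega>) ?X"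
    let ?aA = "anchor A PA (sA ?y \<omega>)"
    have aA: "?aA \<in> vector_fields A" by (rule A.anchor_vector_field[OF tensA sA_one_form[OF \<omega>]])
    have V: "?V z \<in> tangent_space M z"
      by (rule M.vector_field_tangent[OF M.lie_bracket_vector_field[OF M.anchor_vector_field[OF tens \<omega>] X']])
    have LA: "lie_bracket A ?aA X ?x \<in> tangent_space A ?x"
      by (rule A.vector_field_tangent[OF A.lie_bracket_vector_field[OF aA X(1)]])
    have "vA (?V z) = (\<lambda>k. lamA z * lie_bracket A ?aA X ?x k)"
    proof
      fix k
      show "vA (?V z) k = lamA z * lie_bracket A ?aA X ?x k"
      proof (cases "k \<in> smooth_funs A")
        case True
        have 1: "anchor M P \<omega> z (\<lambda>z. X (pA z) k) = lamA z * ?aA ?x (\<lambda>x. X x k)"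
          using anchor_split[OF \<omega> PA.smooth_comp[OF A.vector_field_smooth[OF X(1) True]], of z]
            B.tangent_const[OF S.aA_tangent[OF \<omega>]] by simp
        have 2: "?X z (\<lambda>z. anchor M P \<omega> z (\<lambda>z. k (pA z))) = lamA z * X ?x (\<lambda>x. ?aA x k)"
        proof -
          have sm: "(\<lambda>z. anchor M P \<omega> z (\<lambda>z. k (pA z))) \<in> smooth_funs M"
            by (rule M.vector_field_smooth[OF M.anchor_vector_field[OF tens \<omega>] PA.smooth_comp[OF True]])
          have "?X z (\<lambda>z. anchor M P \<omega> z (\<lambda>z. k (pA z))) = X ?x (\<lambda>x. anchor M P \<omega> (mk x ?y) (\<lambda>z. k (pA z)))"
            by (simp add: pushforward_eval sm)
          also have "\<dots> = X ?x (\<lambda>x. lamA (mk x ?y) * ?aA x k)"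
            using B.tangent_const[OF S.aA_tangent[OF \<omega>, of "mk _ ?y"]]
            by (simp add: anchor_split[OF \<omega> PA.smooth_comp[OF True]])
          also have "\<dots> = lamA z * X ?x (\<lambda>x. ?aA x k)"
            using A.tangent_mult_fun[OF tX[of ?x] IA.smooth_comp[OF lamA_smooth] A.vector_field_smooth[OF aA True]]
              lamA_slice[OF tX[of ?x]] by simp
          finally show ?thesis .
        qed
        show ?thesis
          using True by (simp add: pushforward_eval lie_bracket_def PA.smooth_comp[OF True] Xk[OF True] 1 2 algebra_simps)
      qed (simp add: pushforward_def lie_bracket_def)
    qed
    then have cA: "cA z (\<eta> z) (vA (?V z)) = lamA z * sA ?y \<eta> ?x (lie_bracket A ?aA X ?x)"
      using A.cotangent_scale_vec[OF cA_cotangent[OF M.one_form_cotangent[OF \<eta>]] LA] by (simp add: sA_at)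
    \<comment> \<open>\<open>anchor\<close> takes 1-forms, so the derivative of the slices of
      \<omega> along \<open>u\<close>, a single covector, is extended to one.\<close>
    obtain \<theta> where \<theta>: "\<theta> \<in> one_forms B" "\<theta> ?y = (\<lambda>w. u (\<lambda>x. sB x \<omega> ?y w))"
      using B.one_form_extend[OF dot[OF \<omega>]] .
    let ?t = "anchor B PB \<theta> ?y"
    have t: "?t \<in> tangent_space B ?y" by (rule B.anchor_tangent[OF tensB \<theta>(1)])
    have "vB (?V z) = (\<lambda>k. - lamB z * ?t k)"
    proof
      fix k
      show "vB (?V z) k = - lamB z * ?t k"
      proof (cases "k \<in> smooth_funs B")
        case True
        let ?dk = "differential B k ?y"
        have sm: "(\<lambda>z. anchor M P \<omega> z (\<lambda>z. k (pB z))) \<in> smooth_funs M"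
          by (rule M.vector_field_smooth[OF M.anchor_vector_field[OF tens \<omega>] PB.smooth_comp[OF True]])
        have "?X z (\<lambda>z. anchor M P \<omega> z (\<lambda>z. k (pB z))) = u (\<lambda>x. anchor M P \<omega> (mk x ?y) (\<lambda>z. k (pB z)))"
          by (simp add: pushforward_eval sm X(2))
        also have "\<dots> = u (\<lambda>x. lamB (mk x ?y) * PB ?y (sB x \<omega> ?y) ?dk)"
          using A.tangent_const[OF aA_tangent[OF \<omega>, of "mk _ ?y"]]
          by (simp add: anchor_split[OF \<omega> PB.smooth_comp[OF True]] B.anchor_apply[OF tensB S.sA_one_form[OF \<omega>]])
        also have "\<dots> = lamB z * u (\<lambda>x. PB ?y (sB x \<omega> ?y) ?dk)"
          using A.tangent_mult_fun[OF u IA.smooth_comp[OF lamB_smooth]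
            BA.bilinear_curve_smooth[OF B.tensor_cobilinear[OF tensB] S.sA_cotangent[OF \<omega>]
              B.differential_cotangent S.slice_smooth[OF \<omega>] A.smooth_const]]
            lamB_slice[OF u] by simp
        also have "\<dots> = lamB z * ?t k"
          by (simp add: frozen[OF \<omega> B.differential_cotangent] B.anchor_apply[OF tensB \<theta>(1)] \<theta>(2))
        finally show ?thesis
          using True M.tangent_const[OF M.anchor_tangent[OF tens \<omega>]]
          by (simp add: pushforward_eval lie_bracket_def PB.smooth_comp[OF True] Xc[OF True])
      qed (simp add: pushforward_def B.tangent_nonsmooth[OF t])
    qed
    then have "cB z (\<eta> z) (vB (?V z)) = - lamB z * PB ?y (\<lambda>w. u (\<lambda>x. sB x \<omega> ?y w)) (cB z (\<eta> z))"
      using B.cotangent_scale_vec[OF S.cA_cotangent[OF M.one_form_cotangent[OF \<eta>]] t, of "- lamB z"]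
        B.anchor_eval[OF tensB \<theta>(1) S.cA_cotangent[OF M.one_form_cotangent[OF \<eta>, of z]]]
      by (simp add: \<theta>(2))
    with cA show ?thesis
      using covector_split[OF M.one_form_cotangent[OF \<eta>] V] by simp
  qed
  have T3: "?X z (\<lambda>z. P z (\<alpha> z) (\<beta> z)) = lamA z * u (\<lambda>x. PA x (sA ?y \<alpha> x) (sA ?y \<beta> x)) +
      lamB z * (PB ?y (\<lambda>w. u (\<lambda>x. sB x \<alpha> ?y w)) (cB z (\<beta> z)) + PB ?y (cB z (\<alpha> z)) (\<lambda>w. u (\<lambda>x. sB x \<beta> ?y w)))"
  proof -
    have sA': "(\<lambda>x. PA x (sA ?y \<alpha> x) (sA ?y \<beta> x)) \<in> smooth_funs A"
      by (rule A.tensor_smooth[OF tensA sA_one_form[OF \<alpha>] sA_one_form[OF \<beta>]])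
    have sB': "(\<lambda>x. PB ?y (sB x \<alpha> ?y) (sB x \<beta> ?y)) \<in> smooth_funs A"
      by (rule BA.bilinear_curve_smooth[OF B.tensor_cobilinear[OF tensB] S.sA_cotangent[OF \<alpha>]
          S.sA_cotangent[OF \<beta>] S.slice_smooth[OF \<alpha>] S.slice_smooth[OF \<beta>]])
    have "?X z (\<lambda>z. P z (\<alpha> z) (\<beta> z)) = u (\<lambda>x. P (mk x ?y) (\<alpha> (mk x ?y)) (\<beta> (mk x ?y)))"
      by (simp add: pushforward_eval M.tensor_smooth[OF tens \<alpha> \<beta>] X(2))
    also have "\<dots> = u (\<lambda>x. lamA (mk x ?y) * PA x (sA ?y \<alpha> x) (sA ?y \<beta> x) + lamB (mk x ?y) * PB ?y (sB x \<alpha> ?y) (sB x \<beta> ?y))"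
      by (simp add: split_tensorD[OF split M.one_form_cotangent[OF \<alpha>] M.one_form_cotangent[OF \<beta>]] pullback_eq_cpull)
    also have "\<dots> = lamA z * u (\<lambda>x. PA x (sA ?y \<alpha> x) (sA ?y \<beta> x)) + lamB z * u (\<lambda>x. PB ?y (sB x \<alpha> ?y) (sB x \<beta> ?y))"
      using A.tangent_add_fun[OF u A.smooth_mult[OF IA.smooth_comp[OF lamA_smooth] sA'] A.smooth_mult[OF IA.smooth_comp[OF lamB_smooth] sB']]
        A.tangent_mult_fun[OF u IA.smooth_comp[OF lamA_smooth] sA'] A.tangent_mult_fun[OF u IA.smooth_comp[OF lamB_smooth] sB']
        lamA_slice[OF u] lamB_slice[OF u] by simp
    finally show ?thesis
      using BA.bilinear_curve_derivative[OF B.tensor_cobilinear[OF tensB] S.sA_cotangent[OF \<alpha>]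
          S.sA_cotangent[OF \<beta>] S.slice_smooth[OF \<alpha>] S.slice_smooth[OF \<beta>] u]
      by (simp add: S.sA_at)
  qed
  \<comment> \<open>Brings the derivative of \<beta> in \<open>T2\<close> into the position that it
    has in \<open>T3\<close>.\<close>
  have anti: "PB ?y (\<lambda>w. u (\<lambda>x. sB x \<beta> ?y w)) (cB z (\<alpha> z)) = - PB ?y (cB z (\<alpha> z)) (\<lambda>w. u (\<lambda>x. sB x \<beta> ?y w))"
    by (rule bivector_antisym[OF bivB dot[OF \<beta>] S.cA_cotangent[OF M.one_form_cotangent[OF \<alpha>]]])
  note K = A.koszul_bracket_eval[OF tensA sA_one_form[OF \<alpha>] sA_one_form[OF \<beta>] X(1),
      of ?y ?y ?x, unfolded X(2)]
  have "?L u = koszul_bracket M P \<alpha> \<beta> z (?X z)" using u X(2) by (simp add: cpull_eval)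
  also have "\<dots> = ?R u"
    unfolding M.koszul_bracket_eval[OF tens \<alpha> \<beta> X'] T1[OF \<alpha> \<beta>] T1[OF \<beta> \<alpha>] T2[OF \<alpha> \<beta>] T2[OF \<beta> \<alpha>] T3 anti K
    by (simp add: algebra_simps)
  finally show "?L u = ?R u" .
qed

end

section \<open>The product connection\<close>

context smooth_manifold begin

context
  fixes P D
  assumes D: "contravariant_connection A P D"
begin

lemma connection_one_form: "\<alpha> \<in> one_forms A \<Longrightarrow> \<beta> \<in> one_forms A \<Longrightarrow> D \<alpha> \<beta> \<in> one_forms A"
  using D unfolding contravariant_connection_def by blast

lemma connection_lin:
  assumes "\<alpha> \<in> one_forms A" "\<beta> \<in> one_forms A" "\<gamma> \<in> one_forms A"
  shows "D (\<lambda>p v. r * \<alpha> p v + s * \<beta> p v) \<gamma> = (\<lambda>p v. r * D \<alpha> \<gamma> p v + s * D \<beta> \<gamma> p v)"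
    and "D \<gamma> (\<lambda>p v. r * \<alpha> p v + s * \<beta> p v) = (\<lambda>p v. r * D \<gamma> \<alpha> p v + s * D \<gamma> \<beta> p v)"
  using D assms unfolding contravariant_connection_def by blast+

lemma connection_mult:
  assumes "h \<in> smooth_funs A" "\<alpha> \<in> one_forms A" "\<beta> \<in> one_forms A"
  shows "D (\<lambda>p v. h p * \<alpha> p v) \<beta> = (\<lambda>p v. h p * D \<alpha> \<beta> p v)"
    and "D \<alpha> (\<lambda>p v. h p * \<beta> p v) = (\<lambda>p v. h p * D \<alpha> \<beta> p v + anchor A P \<alpha> p h * \<beta> p v)"
  using D assms unfolding contravariant_connection_def by blast+

lemma connection_sum:
  assumes "finite I" "\<And>i. c i \<in> smooth_funs A" "\<And>i. \<alpha> i \<in> one_forms A" "\<beta> \<in> one_forms A"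
  shows "D (\<lambda>p v. \<Sum>i\<in>I. c i p * \<alpha> i p v) \<beta> = (\<lambda>p v. \<Sum>i\<in>I. c i p * D (\<alpha> i) \<beta> p v)"
    and "D \<beta> (\<lambda>p v. \<Sum>i\<in>I. c i p * \<alpha> i p v) =
      (\<lambda>p v. \<Sum>i\<in>I. c i p * D \<beta> (\<alpha> i) p v + anchor A P \<beta> p (c i) * \<alpha> i p v)"
proof -
  have "D (\<lambda>p v. \<Sum>i\<in>I. c i p * \<alpha> i p v) \<beta> = (\<lambda>p v. \<Sum>i\<in>I. c i p * D (\<alpha> i) \<beta> p v) \<and>
    D \<beta> (\<lambda>p v. \<Sum>i\<in>I. c i p * \<alpha> i p v) =
      (\<lambda>p v. \<Sum>i\<in>I. c i p * D \<beta> (\<alpha> i) p v + anchor A P \<beta> p (c i) * \<alpha> i p v)"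
    using assms(1)
  proof (induction I rule: finite_induct)
    case empty
    then show ?case using connection_lin[OF assms(4,4,4), of 0 0] by simp
  next
    case (insert i I)
    have m: "(\<lambda>p v. c i p * \<alpha> i p v) \<in> one_forms A" by (rule one_form_mult[OF assms(3,2)])
    have s: "(\<lambda>p v. \<Sum>i\<in>I. c i p * \<alpha> i p v) \<in> one_forms A" by (intro one_form_sum assms)
    show ?case
      using insert.hyps insert.IH connection_lin[OF m s assms(4), of 1 1]
        connection_mult[OF assms(2) assms(3,4), of i i] connection_mult[OF assms(2,4,3), of i i]
      by (simp add: add.assoc)
  qed
  then show "D (\<lambda>p v. \<Sum>i\<in>I. c i p * \<alpha> i p v) \<beta> = (\<lambda>p v. \<Sum>i\<in>I. c i p * D (\<alpha> i) \<beta> p v)"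
    and "D \<beta> (\<lambda>p v. \<Sum>i\<in>I. c i p * \<alpha> i p v) =
      (\<lambda>p v. \<Sum>i\<in>I. c i p * D \<beta> (\<alpha> i) p v + anchor A P \<beta> p (c i) * \<alpha> i p v)" by blast+
qed

text \<open>Multiplying by \<rho> makes the forms globally equal. In the second argument the Leibniz
  rule then adds the derivative of \<rho> times the value of the form at \<open>p\<close>, and that
  value is the same for \<beta> and \<open>\<beta>'\<close>.\<close>

lemma connection_local:
  assumes \<alpha>: "\<alpha> \<in> one_forms A" "\<alpha>' \<in> one_forms A" and \<beta>: "\<beta> \<in> one_forms A" "\<beta>' \<in> one_forms A"
    and W: "open W" "p \<in> W" and e: "\<And>q. q \<in> W \<Longrightarrow> \<alpha> q = \<alpha>' q" "\<And>q. q \<in> W \<Longrightarrow> \<beta> q = \<beta>' q"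
  shows "D \<alpha> \<beta> p = D \<alpha>' \<beta>' p"
proof -
  obtain \<rho> where \<rho>: "\<rho> \<in> smooth_funs A" "\<rho> p = 1" "\<And>q. q \<notin> W \<Longrightarrow> \<rho> q = 0"
    using bump[OF W] by metis
  have e1: "(\<lambda>q v. \<rho> q * \<alpha> q v) = (\<lambda>q v. \<rho> q * \<alpha>' q v)"
  proof (intro ext)
    fix q v show "\<rho> q * \<alpha> q v = \<rho> q * \<alpha>' q v" using e(1)[of q] \<rho>(3)[of q] by (cases "q \<in> W") auto
  qed
  have e2: "(\<lambda>q v. \<rho> q * \<beta> q v) = (\<lambda>q v. \<rho> q * \<beta>' q v)"
  proof (intro ext)
    fix q v show "\<rho> q * \<beta> q v = \<rho> q * \<beta>' q v" using e(2)[of q] \<rho>(3)[of q] by (cases "q \<in> W") auto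
  qed
  have "D \<alpha> \<beta> p = D (\<lambda>q v. \<rho> q * \<alpha> q v) \<beta> p" using connection_mult(1)[OF \<rho>(1) \<alpha>(1) \<beta>(1)] \<rho>(2) by simp
  also have "\<dots> = D \<alpha>' \<beta> p" using connection_mult(1)[OF \<rho>(1) \<alpha>(2) \<beta>(1)] \<rho>(2) by (simp add: e1)
  also have "\<dots> = D \<alpha>' \<beta>' p"
  proof
    fix v
    let ?X = "D \<alpha>' (\<lambda>q v. \<rho> q * \<beta> q v)"
    have "?X p v = D \<alpha>' \<beta> p v + anchor A P \<alpha>' p \<rho> * \<beta> p v"
      by (simp add: connection_mult(2)[OF \<rho>(1) \<alpha>(2) \<beta>(1)] \<rho>(2))
    moreover have "?X p v = D \<alpha>' \<beta>' p v + anchor A P \<alpha>' p \<rho> * \<beta>' p v"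
      unfolding e2 by (simp add: connection_mult(2)[OF \<rho>(1) \<alpha>(2) \<beta>(2)] \<rho>(2))
    ultimately have "D \<alpha>' \<beta> p v + anchor A P \<alpha>' p \<rho> * \<beta> p v = D \<alpha>' \<beta>' p v + anchor A P \<alpha>' p \<rho> * \<beta>' p v"
      by simp
    then show "D \<alpha>' \<beta> p v = D \<alpha>' \<beta>' p v" using e(2)[OF W(2)] by simp
  qed
  finally show ?thesis .
qed

end

end

context product_bivector begin

text \<open>The slice of \<alpha> depends on the point of the second factor, so this is not the
  anchor field of one form. Antisymmetry shifts the dependence: the coefficients are minus the
  pairings of \<alpha> with the lifts of the fixed fields \<open>?Z i\<close>.\<close>

lemma aA_smooth:
  assumes \<alpha>: "\<alpha> \<in> one_forms M" and h: "h \<in> smooth_funs M"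
  shows "(\<lambda>z. aA \<alpha> z (\<lambda>x. h (mk x (pB z)))) \<in> smooth_funs M"
proof (rule M.smooth_funs_local)
  fix z0
  obtain W x X where fr: "A.local_frame (pA z0) W x X" using A.ex_local_frame .
  note F = A.local_frameD[OF fr]
  let ?Z = "\<lambda>i. anchor A PA (differential A (x i))"
  have Z: "?Z i \<in> vector_fields A" for i by (rule A.anchor_vector_field[OF tensA A.differential_one_form[OF F(3)]])
  let ?g = "\<lambda>z. \<Sum>i\<in>Basis. (- 1 * \<alpha> z (iA (pB z) (?Z i (pA z)))) * X i (pA z) (\<lambda>x. h (mk x (pB z)))"
  have "open (pA -` W)"
    using PA.smooth_map F(1) by (auto simp: smooth_map_def continuous_on_open_vimage)
  moreover have "?g \<in> smooth_funs M"
    by (intro M.smooth_sum M.smooth_mult M.smooth_const M.one_form_smooth[OF \<alpha> lift_vector_field[OF Z]]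
        smooth_liftA F(4) h)
  moreover have "aA \<alpha> z (\<lambda>x. h (mk x (pB z))) = ?g z" if "z \<in> pA -` W" for z
  proof -
    have "aA \<alpha> z (x i) = - 1 * \<alpha> z (iA (pB z) (?Z i (pA z)))" for i
    proof -
      have "aA \<alpha> z (x i) = PA (pA z) (sA (pB z) \<alpha> (pA z)) (differential A (x i) (pA z))"
        by (rule A.anchor_apply[OF tensA sA_one_form[OF \<alpha>]])
      also have "\<dots> = - PA (pA z) (differential A (x i) (pA z)) (sA (pB z) \<alpha> (pA z))"
        by (rule bivector_antisym[OF bivA sA_cotangent[OF \<alpha>] A.differential_cotangent])
      also have "PA (pA z) (differential A (x i) (pA z)) (sA (pB z) \<alpha> (pA z)) = sA (pB z) \<alpha> (pA z) (?Z i (pA z))"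
        by (rule A.anchor_eval[OF tensA A.differential_one_form[OF F(3)] sA_cotangent[OF \<alpha>], symmetric])
      finally show ?thesis using sA_lift_field[OF Z, of "pB z" \<alpha> "pA z" i] by simp
    qed
    moreover have "aA \<alpha> z (\<lambda>x. h (mk x (pB z))) = (\<Sum>i\<in>Basis. aA \<alpha> z (x i) * X i (pA z) (\<lambda>x. h (mk x (pB z))))"
      by (rule F(6)[OF _ aA_tangent[OF \<alpha>]]) (use that in auto)
    ultimately show ?thesis by simp
  qed
  ultimately show "\<exists>W g. open W \<and> z0 \<in> W \<and> g \<in> smooth_funs M \<and> (\<forall>z\<in>W. aA \<alpha> z (\<lambda>x. h (mk x (pB z))) = g z)"
    using F(2) by (intro exI[of _ "pA -` W"] exI[of _ ?g]) auto
qed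

end

locale product_connection = product_bivector A B M pA pB mk P PA PB lamA lamB
  for A :: "('a::{t2_space, second_countable_topology}, 'e::euclidean_space) atlas"
    and B :: "('b::{t2_space, second_countable_topology}, 'f::euclidean_space) atlas"
    and M :: "('c::{t2_space, second_countable_topology}, 'g::euclidean_space) atlas"
    and pA pB mk P PA PB lamA lamB +
  fixes DA DB
  assumes connA: "contravariant_connection A PA DA" and connB: "contravariant_connection B PB DB"
begin

lemma swap_connection: "product_connection B A M pB pA (\<lambda>y x. mk x y) P PB PA lamB lamA DB DA"
proof -
  interpret S: product_bivector B A M pB pA "\<lambda>y x. mk x y" P PB PA lamB lamA by (rule swap_bivector)
  show ?thesis by unfold_locales (use connA connB in auto)
qed

abbreviation "EA \<alpha> \<beta> z \<equiv> (\<lambda>u. lamA z * DA (sA (pB z) \<alpha>) (sA (pB z) \<beta>) (pA z) u +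
    lamB z * aB \<alpha> z (\<lambda>y. sA y \<beta> (pA z) u))"
abbreviation "EB \<alpha> \<beta> z \<equiv> (\<lambda>w. lamB z * DB (sB (pA z) \<alpha>) (sB (pA z) \<beta>) (pB z) w +
    lamA z * aA \<alpha> z (\<lambda>x. sB x \<beta> (pB z) w))"

text \<open>On the slices through \<open>z\<close> the connection is the one of the factor, and a slice depending on
  the other factor is differentiated along the anchor in that factor.\<close>

definition prod_conn :: "('c \<Rightarrow> 'c covec) \<Rightarrow> ('c \<Rightarrow> 'c covec) \<Rightarrow> 'c \<Rightarrow> 'c covec" where
  "prod_conn \<alpha> \<beta> z = (\<lambda>v. cpull M A pA z (EA \<alpha> \<beta> z) v + cpull M B pB z (EB \<alpha> \<beta> z) v)"

end

context product_connection begin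

interpretation S: product_bivector B A M pB pA "\<lambda>y x. mk x y" P PB PA lamB lamA by (rule swap_bivector)

lemma EA_cotangent:
  assumes "\<alpha> \<in> one_forms M" "\<beta> \<in> one_forms M"
  shows "EA \<alpha> \<beta> z \<in> cotangent_space A (pA z)"
  by (intro A.cotangent_add A.cotangent_scale slice_derivative_cotangent[OF assms(2) S.aA_tangent[OF assms(1)]]
      A.one_form_cotangent A.connection_one_form[OF connA] sA_one_form assms)

text \<open>The arguments of \<open>DA\<close> change with \<open>z\<close>. Near a point the slices
  are combinations of a fixed coframe with coefficients smooth on the product; the connection axioms
  then express everything through the finitely many forms \<open>DA (?e i) (?e j)\<close>.\<close>

lemma EA_smooth:
  assumes \<alpha>: "\<alpha> \<in> one_forms M" and \<beta>: "\<beta> \<in> one_forms M" and V: "V \<in> vector_fields M"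
  shows "(\<lambda>z. EA \<alpha> \<beta> z (vA (V z))) \<in> smooth_funs M"
proof (rule M.smooth_funs_local)
  fix z0
  obtain W x X where fr: "A.local_frame (pA z0) W x X" using A.ex_local_frame .
  note F = A.local_frameD[OF fr]
  let ?e = "\<lambda>i. differential A (x i)"
  have e: "?e i \<in> one_forms A" for i by (rule A.differential_one_form[OF F(3)])
  \<comment> \<open>The coefficients of the slices of \<omega> in the coframe \<open>?e\<close>, as
    functions on the whole product.\<close>
  let ?c = "\<lambda>\<omega> i z. \<omega> z (iA (pB z) (X i (pA z)))"
  have c: "?c \<omega> i \<in> smooth_funs M" if "\<omega> \<in> one_forms M" for \<omega> i
    by (rule M.one_form_smooth[OF that lift_vector_field[OF F(4)]])
  let ?G = "\<lambda>k z. \<Sum>i\<in>Basis. ?c \<alpha> i z * (\<Sum>j\<in>Basis. ?c \<beta> j z * DA (?e i) (?e j) (pA z) (X k (pA z)) +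
      anchor A PA (?e i) (pA z) (\<lambda>x. ?c \<beta> j (mk x (pB z))) * ?e j (pA z) (X k (pA z)))"
  let ?H = "\<lambda>k z. aB \<alpha> z (\<lambda>y. ?c \<beta> k (mk (pA z) y))"
  let ?g = "\<lambda>z. \<Sum>k\<in>Basis. V z (\<lambda>z. x k (pA z)) * (lamA z * ?G k z + lamB z * ?H k z)"
  have G: "?G k \<in> smooth_funs M" for k
    by (intro M.smooth_sum M.smooth_mult M.smooth_add c \<alpha> \<beta>
        PA.smooth_comp[OF A.one_form_smooth[OF A.connection_one_form[OF connA e e] F(4)]]
        smooth_liftA[OF A.anchor_vector_field[OF tensA e] c[OF \<beta>]]
        PA.smooth_comp[OF A.one_form_smooth[OF e F(4)]])
  have H: "?H k \<in> smooth_funs M" for k by (rule S.aA_smooth[OF \<alpha> c[OF \<beta>]])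
  have Vx: "(\<lambda>z. V z (\<lambda>z. x k (pA z))) \<in> smooth_funs M" for k
    by (rule M.vector_field_smooth[OF V PA.smooth_comp[OF F(3)]])
  have "?g \<in> smooth_funs M"
    by (intro M.smooth_sum M.smooth_mult M.smooth_add Vx G H lamA_smooth lamB_smooth)
  moreover have "open (pA -` W)"
    using PA.smooth_map F(1) by (auto simp: smooth_map_def continuous_on_open_vimage)
  moreover have "EA \<alpha> \<beta> z (vA (V z)) = ?g z" if "z \<in> pA -` W" for z
  proof -
    have zW: "pA z \<in> W" using that by simp
    let ?s = "\<lambda>\<omega> x v. \<Sum>i\<in>Basis. ?c \<omega> i (mk x (pB z)) * ?e i x v"
    have s: "?s \<omega> \<in> one_forms A" if "\<omega> \<in> one_forms M" for \<omega>
      by (intro A.one_form_sum e IA.smooth_comp[OF c[OF that]])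
    have se: "sA (pB z) \<omega> q = ?s \<omega> q" if "\<omega> \<in> one_forms M" "q \<in> W" for \<omega> q
      using A.cotangent_frame[OF fr that(2) sA_cotangent[OF that(1)], of "pB z"]
      by (simp add: sA_lift_field[OF F(4)])
    \<comment> \<open>The slices agree with their expansions over \<open>W\<close> only, which
      suffices by locality of the connection.\<close>
    have DA: "DA (sA (pB z) \<alpha>) (sA (pB z) \<beta>) (pA z) = DA (?s \<alpha>) (?s \<beta>) (pA z)"
      by (rule A.connection_local[OF connA sA_one_form[OF \<alpha>] s[OF \<alpha>] sA_one_form[OF \<beta>] s[OF \<beta>] F(1) zW])
        (use se \<alpha> \<beta> in blast)+
    have "DA (?s \<alpha>) (?s \<beta>) = (\<lambda>q v. \<Sum>i\<in>Basis. ?c \<alpha> i (mk q (pB z)) * DA (?e i) (?s \<beta>) q v)"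
      by (rule A.connection_sum(1)[OF connA finite_Basis IA.smooth_comp[OF c[OF \<alpha>]] e s[OF \<beta>]])
    moreover have "DA (?e i) (?s \<beta>) = (\<lambda>q v. \<Sum>j\<in>Basis. ?c \<beta> j (mk q (pB z)) * DA (?e i) (?e j) q v +
        anchor A PA (?e i) q (\<lambda>x. ?c \<beta> j (mk x (pB z))) * ?e j q v)" for i
      by (rule A.connection_sum(2)[OF connA finite_Basis IA.smooth_comp[OF c[OF \<beta>]] e e])
    ultimately have DAG: "DA (sA (pB z) \<alpha>) (sA (pB z) \<beta>) (pA z) (X k (pA z)) = ?G k z" for k
      by (simp add: DA)
    have v: "vA (V z) \<in> tangent_space A (pA z)" by (rule vA_tangent[OF M.vector_field_tangent[OF V]])
    have "vA (V z) = (\<lambda>h. \<Sum>k\<in>Basis. vA (V z) (x k) * X k (pA z) h)"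
      by (intro ext) (rule F(6)[OF zW v])
    then have "EA \<alpha> \<beta> z (vA (V z)) = EA \<alpha> \<beta> z (\<lambda>h. \<Sum>k\<in>Basis. vA (V z) (x k) * X k (pA z) h)"
      by (rule arg_cong)
    also have "\<dots> = (\<Sum>k\<in>Basis. vA (V z) (x k) * EA \<alpha> \<beta> z (X k (pA z)))"
      by (rule A.cotangent_sum_vec[OF EA_cotangent[OF \<alpha> \<beta>] A.vector_field_tangent[OF F(4)]])
    also have "\<dots> = ?g z"
      by (simp only: DAG sA_lift_field[OF F(4)] pushforward_eval[OF F(3)] pA_mk pB_mk)
    finally show ?thesis .
  qed
  ultimately show "\<exists>W g. open W \<and> z0 \<in> W \<and> g \<in> smooth_funs M \<and> (\<forall>z\<in>W. EA \<alpha> \<beta> z (vA (V z)) = g z)"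
    using F(2) by (intro exI[of _ "pA -` W"] exI[of _ ?g]) auto
qed

lemma EA_lin1:
  assumes "\<alpha> \<in> one_forms M" "\<beta> \<in> one_forms M" "\<gamma> \<in> one_forms M"
  shows "EA (\<lambda>z v. r * \<alpha> z v + s * \<beta> z v) \<gamma> z = (\<lambda>u. r * EA \<alpha> \<gamma> z u + s * EA \<beta> \<gamma> z u)"
  by (rule ext)
    (simp add: sA_lin A.connection_lin(1)[OF connA] S.aA_lin sA_one_form assms algebra_simps
      B.anchor_lin[OF tensB] S.sA_lin S.sA_one_form)

lemma EA_lin2:
  assumes "\<alpha> \<in> one_forms M" "\<beta> \<in> one_forms M" "\<gamma> \<in> one_forms M"
  shows "EA \<gamma> (\<lambda>z v. r * \<alpha> z v + s * \<beta> z v) z = (\<lambda>u. r * EA \<gamma> \<alpha> z u + s * EA \<gamma> \<beta> z u)"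
proof (rule A.cotangent_eqI)
  let ?\<omega> = "\<lambda>z v. r * \<alpha> z v + s * \<beta> z v"
  show "EA \<gamma> ?\<omega> z \<in> cotangent_space A (pA z)" by (intro EA_cotangent M.one_form_lin assms)
  show "(\<lambda>u. r * EA \<gamma> \<alpha> z u + s * EA \<gamma> \<beta> z u) \<in> cotangent_space A (pA z)"
    by (rule A.cotangent_add[OF A.cotangent_scale A.cotangent_scale]) (rule EA_cotangent assms)+
  fix u assume u: "u \<in> tangent_space A (pA z)"
  note t = S.aA_tangent[OF assms(3), of z]
  have "aB \<gamma> z (\<lambda>y. r * sA y \<alpha> (pA z) u + s * sA y \<beta> (pA z) u) =
      r * aB \<gamma> z (\<lambda>y. sA y \<alpha> (pA z) u) + s * aB \<gamma> z (\<lambda>y. sA y \<beta> (pA z) u)"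
    using slice_smooth[OF assms(1) u] slice_smooth[OF assms(2) u]
    by (simp add: B.tangent_add_fun[OF t] B.tangent_scale_fun[OF t] B.smooth_mult)
  then show "EA \<gamma> ?\<omega> z u = r * EA \<gamma> \<alpha> z u + s * EA \<gamma> \<beta> z u"
    by (simp add: sA_lin A.connection_lin(2)[OF connA] sA_one_form assms algebra_simps)
qed

lemma EA_mult1:
  assumes "\<alpha> \<in> one_forms M" "\<beta> \<in> one_forms M" "h \<in> smooth_funs M"
  shows "EA (\<lambda>z v. h z * \<alpha> z v) \<beta> z = (\<lambda>u. h z * EA \<alpha> \<beta> z u)"
  by (rule ext)
    (simp add: sA_mult A.connection_mult(1)[OF connA] sA_one_form assms IA.smooth_comp algebra_simps
      B.anchor_mult[OF tensB] S.sA_mult S.sA_one_form IB.smooth_comp)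

text \<open>The derivative of \<open>h\<close> comes in two parts: the Leibniz rule of
  \<open>DA\<close> gives the one along the first anchor, the derivative of the slices the one along
  the second. Their weighted sum is \<open>anchor_split\<close>.\<close>

lemma EA_mult2:
  assumes "\<alpha> \<in> one_forms M" "\<beta> \<in> one_forms M" "h \<in> smooth_funs M"
  shows "EA \<alpha> (\<lambda>z v. h z * \<beta> z v) z = (\<lambda>u. h z * EA \<alpha> \<beta> z u + anchor M P \<alpha> z h * cA z (\<beta> z) u)"
proof (rule A.cotangent_eqI)
  let ?\<omega> = "\<lambda>z v. h z * \<beta> z v"
  show "EA \<alpha> ?\<omega> z \<in> cotangent_space A (pA z)" by (intro EA_cotangent M.one_form_mult assms)
  show "(\<lambda>u. h z * EA \<alpha> \<beta> z u + anchor M P \<alpha> z h * cA z (\<beta> z) u) \<in> cotangent_space A (pA z)"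
    by (rule A.cotangent_add[OF A.cotangent_scale A.cotangent_scale])
      (rule EA_cotangent assms cA_cotangent M.one_form_cotangent)+
  fix u assume u: "u \<in> tangent_space A (pA z)"
  have "aB \<alpha> z (\<lambda>y. h (mk (pA z) y) * sA y \<beta> (pA z) u) =
      h z * aB \<alpha> z (\<lambda>y. sA y \<beta> (pA z) u) + sA (pB z) \<beta> (pA z) u * aB \<alpha> z (\<lambda>y. h (mk (pA z) y))"
    using B.tangent_mult_fun[OF S.aA_tangent[OF assms(1)] IB.smooth_comp[OF assms(3)] slice_smooth[OF assms(2) u]]
    by simp
  then show "EA \<alpha> ?\<omega> z u = h z * EA \<alpha> \<beta> z u + anchor M P \<alpha> z h * cA z (\<beta> z) u"
    by (simp add: sA_mult A.connection_mult(2)[OF connA] sA_one_form assms IA.smooth_comp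
        anchor_split algebra_simps sA_at)
qed

end

text \<open>One notion covers metric compatibility (\<open>T\<close> the cometric) and parallelism
  of the bivector (\<open>T\<close> equal to \<open>P\<close>), so that each transfer between
  factors and product is proved once.\<close>

definition parallel_tensor ::
    "('a, 'e::euclidean_space) atlas \<Rightarrow> ('a \<Rightarrow> 'a covec \<Rightarrow> 'a covec \<Rightarrow> real) \<Rightarrow>
     (('a \<Rightarrow> 'a covec) \<Rightarrow> ('a \<Rightarrow> 'a covec) \<Rightarrow> 'a \<Rightarrow> 'a covec) \<Rightarrow> ('a \<Rightarrow> 'a covec \<Rightarrow> 'a covec \<Rightarrow> real) \<Rightarrow> bool" where
  "parallel_tensor A P D T \<longleftrightarrow> (\<forall>\<alpha>\<in>one_forms A. \<forall>\<beta>\<in>one_forms A. \<forall>\<gamma>\<in>one_forms A. \<forall>p.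
     anchor A P \<alpha> p (contra_eval T \<beta> \<gamma>) = contra_eval T (D \<alpha> \<beta>) \<gamma> p + contra_eval T \<beta> (D \<alpha> \<gamma>) p)"

lemma parallel_tensorD:
  "parallel_tensor A P D T \<Longrightarrow> \<alpha> \<in> one_forms A \<Longrightarrow> \<beta> \<in> one_forms A \<Longrightarrow> \<gamma> \<in> one_forms A \<Longrightarrow>
    anchor A P \<alpha> p (contra_eval T \<beta> \<gamma>) = contra_eval T (D \<alpha> \<beta>) \<gamma> p + contra_eval T \<beta> (D \<alpha> \<gamma>) p"
  by (simp add: parallel_tensor_def)

context product_connection begin

interpretation S: product_connection B A M pB pA "\<lambda>y x. mk x y" P PB PA lamB lamA DB DA by (rule swap_connection)

lemma prod_conn_cotangent:
  "\<alpha> \<in> one_forms M \<Longrightarrow> \<beta> \<in> one_forms M \<Longrightarrow> prod_conn \<alpha> \<beta> z \<in> cotangent_space M z"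
  unfolding prod_conn_def
  by (intro M.cotangent_add PA.cpull_cotangent PB.cpull_cotangent EA_cotangent S.EA_cotangent)

lemma cA_prod_conn:
  assumes "\<alpha> \<in> one_forms M" "\<beta> \<in> one_forms M"
  shows "cA z (prod_conn \<alpha> \<beta> z) = EA \<alpha> \<beta> z"
proof -
  have "cA z (prod_conn \<alpha> \<beta> z) =
      (\<lambda>u. cA z (cpull M A pA z (EA \<alpha> \<beta> z)) u + cA z (cpull M B pB z (EB \<alpha> \<beta> z)) u)"
    unfolding prod_conn_def by (rule cpull_add)
  then show ?thesis
    by (simp only: cA_cpull_pA[OF EA_cotangent[OF assms]] cA_cpull_pB[OF S.EA_cotangent[OF assms]] add_0_right)
qed

lemma cB_prod_conn:
  assumes "\<alpha> \<in> one_forms M" "\<beta> \<in> one_forms M"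
  shows "cB z (prod_conn \<alpha> \<beta> z) = EB \<alpha> \<beta> z"
proof -
  have "cB z (prod_conn \<alpha> \<beta> z) =
      (\<lambda>u. cB z (cpull M A pA z (EA \<alpha> \<beta> z)) u + cB z (cpull M B pB z (EB \<alpha> \<beta> z)) u)"
    unfolding prod_conn_def by (rule cpull_add)
  then show ?thesis
    by (simp only: S.cA_cpull_pB[OF EA_cotangent[OF assms]] S.cA_cpull_pA[OF S.EA_cotangent[OF assms]] add_0_left)
qed

text \<open>Reduces an equation for the product connection to one identity for \<open>EA\<close> and
  one for \<open>EB\<close>.\<close>

lemma prod_conn_eqI:
  assumes "\<alpha> \<in> one_forms M" "\<beta> \<in> one_forms M" "a \<in> cotangent_space M z"
    and "EA \<alpha> \<beta> z = cA z a" "EB \<alpha> \<beta> z = cB z a"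
  shows "prod_conn \<alpha> \<beta> z = a"
  by (rule covector_eqI[OF prod_conn_cotangent[OF assms(1,2)] assms(3)])
    (simp_all only: cA_prod_conn[OF assms(1,2)] cB_prod_conn[OF assms(1,2)] assms(4,5))

lemma prod_conn_one_form:
  assumes "\<alpha> \<in> one_forms M" "\<beta> \<in> one_forms M"
  shows "prod_conn \<alpha> \<beta> \<in> one_forms M"
proof -
  have "(\<lambda>z. prod_conn \<alpha> \<beta> z (X z)) \<in> smooth_funs M" if X: "X \<in> vector_fields M" for X
    using M.smooth_add[OF EA_smooth[OF assms X] S.EA_smooth[OF assms X]] M.vector_field_tangent[OF X]
    by (simp add: prod_conn_def cpull_eval)
  then show ?thesis by (simp add: one_forms_def prod_conn_cotangent[OF assms])
qed

lemma prod_conn_connection: "contravariant_connection M P prod_conn"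
  unfolding contravariant_connection_def
proof (intro conjI ballI allI)
  fix \<alpha> \<beta> assume \<alpha>\<beta>: "\<alpha> \<in> one_forms M" "\<beta> \<in> one_forms M"
  show "prod_conn \<alpha> \<beta> \<in> one_forms M" by (rule prod_conn_one_form[OF \<alpha>\<beta>])
  note pc = prod_conn_cotangent
  {
    fix \<gamma> and r s :: real assume \<gamma>: "\<gamma> \<in> one_forms M"
    show "prod_conn (\<lambda>p v. r * \<alpha> p v + s * \<beta> p v) \<gamma> = (\<lambda>p v. r * prod_conn \<alpha> \<gamma> p v + s * prod_conn \<beta> \<gamma> p v)"
      by (rule ext, rule prod_conn_eqI)
        (simp_all only: M.one_form_lin \<alpha>\<beta> \<gamma> M.cotangent_add M.cotangent_scale pc cpull_add cpull_scale
          cA_prod_conn cB_prod_conn EA_lin1 S.EA_lin1)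
    show "prod_conn \<gamma> (\<lambda>p v. r * \<alpha> p v + s * \<beta> p v) = (\<lambda>p v. r * prod_conn \<gamma> \<alpha> p v + s * prod_conn \<gamma> \<beta> p v)"
      by (rule ext, rule prod_conn_eqI)
        (simp_all only: M.one_form_lin \<alpha>\<beta> \<gamma> M.cotangent_add M.cotangent_scale pc cpull_add cpull_scale
          cA_prod_conn cB_prod_conn EA_lin2 S.EA_lin2)
  }
  fix h assume h: "h \<in> smooth_funs M"
  show "prod_conn (\<lambda>p v. h p * \<alpha> p v) \<beta> = (\<lambda>p v. h p * prod_conn \<alpha> \<beta> p v)"
    by (rule ext, rule prod_conn_eqI)
      (simp_all only: M.one_form_mult \<alpha>\<beta> h M.cotangent_scale pc cpull_scale
        cA_prod_conn cB_prod_conn EA_mult1 S.EA_mult1)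
  show "prod_conn \<alpha> (\<lambda>p v. h p * \<beta> p v) = (\<lambda>p v. h p * prod_conn \<alpha> \<beta> p v + anchor M P \<alpha> p h * \<beta> p v)"
    by (rule ext, rule prod_conn_eqI)
      (simp_all only: M.one_form_mult \<alpha>\<beta> h M.cotangent_add M.cotangent_scale pc M.one_form_cotangent cpull_add cpull_scale
        cA_prod_conn cB_prod_conn EA_mult2 S.EA_mult2)
qed

text \<open>On each factor the difference consists of the bracket of the factor and of the cross
  derivatives, which is what \<open>koszul_split\<close> finds for the bracket of the
  product.\<close>

lemma prod_conn_torsion:
  assumes A: "\<And>\<alpha> \<beta>. \<alpha> \<in> one_forms A \<Longrightarrow> \<beta> \<in> one_forms A \<Longrightarrow> (\<lambda>p v. DA \<alpha> \<beta> p v - DA \<beta> \<alpha> p v) = koszul_bracket A PA \<alpha> \<beta>"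
    and B: "\<And>\<alpha> \<beta>. \<alpha> \<in> one_forms B \<Longrightarrow> \<beta> \<in> one_forms B \<Longrightarrow> (\<lambda>p v. DB \<alpha> \<beta> p v - DB \<beta> \<alpha> p v) = koszul_bracket B PB \<alpha> \<beta>"
    and \<alpha>\<beta>: "\<alpha> \<in> one_forms M" "\<beta> \<in> one_forms M"
  shows "(\<lambda>p v. prod_conn \<alpha> \<beta> p v - prod_conn \<beta> \<alpha> p v) = koszul_bracket M P \<alpha> \<beta>"
proof
  fix z
  note A' = A[OF sA_one_form[OF \<alpha>\<beta>(1)] sA_one_form[OF \<alpha>\<beta>(2)], symmetric]
  note B' = B[OF S.sA_one_form[OF \<alpha>\<beta>(1)] S.sA_one_form[OF \<alpha>\<beta>(2)], symmetric]
  have "(\<lambda>v. prod_conn \<alpha> \<beta> z v + (- 1) * prod_conn \<beta> \<alpha> z v) \<in> cotangent_space M z"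
    by (intro M.cotangent_add M.cotangent_scale prod_conn_cotangent \<alpha>\<beta>)
  then have c: "(\<lambda>v. prod_conn \<alpha> \<beta> z v - prod_conn \<beta> \<alpha> z v) \<in> cotangent_space M z" by simp
  show "(\<lambda>v. prod_conn \<alpha> \<beta> z v - prod_conn \<beta> \<alpha> z v) = koszul_bracket M P \<alpha> \<beta> z"
  proof (rule covector_eqI[OF c M.koszul_bracket_cotangent[OF tens \<alpha>\<beta>]])
    show "cA z (\<lambda>v. prod_conn \<alpha> \<beta> z v - prod_conn \<beta> \<alpha> z v) = cA z (koszul_bracket M P \<alpha> \<beta> z)"
      by (simp only: cpull_diff cA_prod_conn \<alpha>\<beta> koszul_split A') (simp add: algebra_simps)
    show "cB z (\<lambda>v. prod_conn \<alpha> \<beta> z v - prod_conn \<beta> \<alpha> z v) = cB z (koszul_bracket M P \<alpha> \<beta> z)"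
      by (simp only: cpull_diff cB_prod_conn \<alpha>\<beta> S.koszul_split B') (simp add: algebra_simps)
  qed
qed

text \<open>Along the first anchor the summand with \<open>TA\<close> is governed by parallelism in
  the first factor, while the summand with \<open>TB\<close> is a fixed form at \<open>pB z\<close>
  on moving slices, so \<open>bilinear_curve\<close> applies. The derivatives of the weights are
  kept, since they need not vanish in each factor separately.\<close>

lemma slice_tensor_derivative:
  assumes TA: "contravariant_tensor2 A TA" and TB: "contravariant_tensor2 B TB"
    and T: "split_tensor T kapA TA kapB TB"
    and k: "kapA \<in> smooth_funs M" "kapB \<in> smooth_funs M"
    and A: "parallel_tensor A PA DA TA"
    and \<alpha>: "\<alpha> \<in> one_forms M" and \<beta>: "\<beta> \<in> one_forms M" and \<gamma>: "\<gamma> \<in> one_forms M"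
  shows "aA \<alpha> z (\<lambda>x. contra_eval T \<beta> \<gamma> (mk x (pB z))) =
    TA (pA z) (cA z (\<beta> z)) (cA z (\<gamma> z)) * aA \<alpha> z (\<lambda>x. kapA (mk x (pB z))) +
    TB (pB z) (cB z (\<beta> z)) (cB z (\<gamma> z)) * aA \<alpha> z (\<lambda>x. kapB (mk x (pB z))) +
    kapA z * (TA (pA z) (DA (sA (pB z) \<alpha>) (sA (pB z) \<beta>) (pA z)) (cA z (\<gamma> z)) +
      TA (pA z) (cA z (\<beta> z)) (DA (sA (pB z) \<alpha>) (sA (pB z) \<gamma>) (pA z))) +
    kapB z * (TB (pB z) (\<lambda>w. aA \<alpha> z (\<lambda>x. sB x \<beta> (pB z) w)) (cB z (\<gamma> z)) +
      TB (pB z) (cB z (\<beta> z)) (\<lambda>w. aA \<alpha> z (\<lambda>x. sB x \<gamma> (pB z) w)))"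
proof -
  let ?x = "pA z" and ?y = "pB z"
  let ?FA = "\<lambda>x. TA x (sA ?y \<beta> x) (sA ?y \<gamma> x)" and ?FB = "\<lambda>x. TB ?y (sB x \<beta> ?y) (sB x \<gamma> ?y)"
  note t = aA_tangent[OF \<alpha>, of z]
  note k' = IA.smooth_comp[OF k(1), of ?y] IA.smooth_comp[OF k(2), of ?y]
  have FA: "?FA \<in> smooth_funs A" by (rule A.tensor_smooth[OF TA sA_one_form[OF \<beta>] sA_one_form[OF \<gamma>]])
  note bil = B.tensor_cobilinear[OF TB] S.sA_cotangent[OF \<beta>] S.sA_cotangent[OF \<gamma>] S.slice_smooth[OF \<beta>] S.slice_smooth[OF \<gamma>]
  have FB: "?FB \<in> smooth_funs A" by (rule BA.bilinear_curve_smooth[OF bil])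
  have "(\<lambda>x. contra_eval T \<beta> \<gamma> (mk x ?y)) = (\<lambda>x. kapA (mk x ?y) * ?FA x + kapB (mk x ?y) * ?FB x)"
    by (simp add: contra_eval_def split_tensorD[OF T M.one_form_cotangent[OF \<beta>] M.one_form_cotangent[OF \<gamma>]] pullback_eq_cpull)
  then have "aA \<alpha> z (\<lambda>x. contra_eval T \<beta> \<gamma> (mk x ?y)) =
      (kapA z * aA \<alpha> z ?FA + ?FA ?x * aA \<alpha> z (\<lambda>x. kapA (mk x ?y))) +
      (kapB z * aA \<alpha> z ?FB + ?FB ?x * aA \<alpha> z (\<lambda>x. kapB (mk x ?y)))"
    using A.tangent_add_fun[OF t A.smooth_mult[OF k'(1) FA] A.smooth_mult[OF k'(2) FB]]
      A.tangent_mult_fun[OF t k'(1) FA] A.tangent_mult_fun[OF t k'(2) FB] by simp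
  moreover have "aA \<alpha> z ?FA = TA ?x (DA (sA ?y \<alpha>) (sA ?y \<beta>) ?x) (cA z (\<gamma> z)) + TA ?x (cA z (\<beta> z)) (DA (sA ?y \<alpha>) (sA ?y \<gamma>) ?x)"
    using parallel_tensorD[OF A sA_one_form[OF \<alpha>, of ?y] sA_one_form[OF \<beta>, of ?y] sA_one_form[OF \<gamma>, of ?y], of ?x]
    by (simp add: contra_eval_def sA_at)
  moreover have "aA \<alpha> z ?FB = TB ?y (\<lambda>w. aA \<alpha> z (\<lambda>x. sB x \<beta> ?y w)) (cB z (\<gamma> z)) + TB ?y (cB z (\<beta> z)) (\<lambda>w. aA \<alpha> z (\<lambda>x. sB x \<gamma> ?y w))"
    using BA.bilinear_curve_derivative[OF bil t] by (simp add: S.sA_at)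
  ultimately show ?thesis by (simp add: sA_at S.sA_at algebra_simps)
qed

end

context product_connection begin

interpretation S: product_connection B A M pB pA "\<lambda>y x. mk x y" P PB PA lamB lamA DB DA by (rule swap_connection)

text \<open>Applied to the cometric with weights 1 and the lift of f, and to the bivector with its
  own weights. The derivative along the anchor is the weighted sum of the formula above for both
  factors; apart from derivatives of the weights its terms recombine into \<open>EA\<close> and
  \<open>EB\<close> inside \<open>T\<close>.\<close>

lemma prod_conn_tensor:
  assumes TM: "contravariant_tensor2 M T" and TA: "contravariant_tensor2 A TA" and TB: "contravariant_tensor2 B TB"
    and T: "split_tensor T kapA TA kapB TB"
    and k: "kapA \<in> smooth_funs M" "kapB \<in> smooth_funs M"
    and k0: "anchor M P \<alpha> z kapA = 0" "anchor M P \<alpha> z kapB = 0"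
    and A: "parallel_tensor A PA DA TA"
    and B: "parallel_tensor B PB DB TB"
    and \<alpha>: "\<alpha> \<in> one_forms M" and \<beta>: "\<beta> \<in> one_forms M" and \<gamma>: "\<gamma> \<in> one_forms M"
  shows "anchor M P \<alpha> z (contra_eval T \<beta> \<gamma>) =
    contra_eval T (prod_conn \<alpha> \<beta>) \<gamma> z + contra_eval T \<beta> (prod_conn \<alpha> \<gamma>) z"
proof -
  let ?x = "pA z" and ?y = "pB z"
  let ?TA = "TA ?x" and ?TB = "TB ?y"
  have sm: "contra_eval T \<beta> \<gamma> \<in> smooth_funs M"
    using M.tensor_smooth[OF TM \<beta> \<gamma>] by (simp add: contra_eval_def[abs_def])
  note hA = slice_tensor_derivative[OF TA TB T k A \<alpha> \<beta> \<gamma>, of z]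
  note hB = S.slice_tensor_derivative[OF TB TA split_tensor_swap[OF T] k(2,1) B \<alpha> \<beta> \<gamma>, of z]
  note cot = M.one_form_cotangent[OF \<beta>, of z] M.one_form_cotangent[OF \<gamma>, of z]
  note ca = cA_cotangent[OF cot(1)] cA_cotangent[OF cot(2)]
  note cb = S.cA_cotangent[OF cot(1)] S.cA_cotangent[OF cot(2)]
  note da = A.one_form_cotangent[OF A.connection_one_form[OF connA sA_one_form[OF \<alpha>, of ?y] sA_one_form[OF \<beta>, of ?y]], of ?x]
    A.one_form_cotangent[OF A.connection_one_form[OF connA sA_one_form[OF \<alpha>, of ?y] sA_one_form[OF \<gamma>, of ?y]], of ?x]
  note db = B.one_form_cotangent[OF B.connection_one_form[OF connB S.sA_one_form[OF \<alpha>, of ?x] S.sA_one_form[OF \<beta>, of ?x]], of ?y]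
    B.one_form_cotangent[OF B.connection_one_form[OF connB S.sA_one_form[OF \<alpha>, of ?x] S.sA_one_form[OF \<gamma>, of ?x]], of ?y]
  note va = slice_derivative_cotangent[OF \<beta> S.aA_tangent[OF \<alpha>, of z], of ?x]
    slice_derivative_cotangent[OF \<gamma> S.aA_tangent[OF \<alpha>, of z], of ?x]
  note vb = S.slice_derivative_cotangent[OF \<beta> aA_tangent[OF \<alpha>, of z], of ?y]
    S.slice_derivative_cotangent[OF \<gamma> aA_tangent[OF \<alpha>, of z], of ?y]
  note bA = A.tensor_cobilinear[OF TA, of ?x, unfolded A.cobilinear_def, rule_format]
  note bB = B.tensor_cobilinear[OF TB, of ?y, unfolded B.cobilinear_def, rule_format]
  have E: "contra_eval T (prod_conn \<alpha> \<beta>) \<gamma> z = kapA z * ?TA (EA \<alpha> \<beta> z) (cA z (\<gamma> z)) + kapB z * ?TB (EB \<alpha> \<beta> z) (cB z (\<gamma> z))"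
    "contra_eval T \<beta> (prod_conn \<alpha> \<gamma>) z = kapA z * ?TA (cA z (\<beta> z)) (EA \<alpha> \<gamma> z) + kapB z * ?TB (cB z (\<beta> z)) (EB \<alpha> \<gamma> z)"
    by (simp_all only: contra_eval_def split_tensorD[OF T] prod_conn_cotangent \<alpha> \<beta> \<gamma> cot cA_prod_conn cB_prod_conn)
  have E': "?TA (EA \<alpha> \<beta> z) (cA z (\<gamma> z)) = lamA z * ?TA (DA (sA ?y \<alpha>) (sA ?y \<beta>) ?x) (cA z (\<gamma> z)) +
      lamB z * ?TA (\<lambda>u. aB \<alpha> z (\<lambda>y. sA y \<beta> ?x u)) (cA z (\<gamma> z))"
    "?TB (EB \<alpha> \<beta> z) (cB z (\<gamma> z)) = lamB z * ?TB (DB (sB ?x \<alpha>) (sB ?x \<beta>) ?y) (cB z (\<gamma> z)) +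
      lamA z * ?TB (\<lambda>w. aA \<alpha> z (\<lambda>x. sB x \<beta> ?y w)) (cB z (\<gamma> z))"
    "?TA (cA z (\<beta> z)) (EA \<alpha> \<gamma> z) = lamA z * ?TA (cA z (\<beta> z)) (DA (sA ?y \<alpha>) (sA ?y \<gamma>) ?x) +
      lamB z * ?TA (cA z (\<beta> z)) (\<lambda>u. aB \<alpha> z (\<lambda>y. sA y \<gamma> ?x u))"
    "?TB (cB z (\<beta> z)) (EB \<alpha> \<gamma> z) = lamB z * ?TB (cB z (\<beta> z)) (DB (sB ?x \<alpha>) (sB ?x \<gamma>) ?y) +
      lamA z * ?TB (cB z (\<beta> z)) (\<lambda>w. aA \<alpha> z (\<lambda>x. sB x \<gamma> ?y w))"
    by (rule conjunct1[OF bA[OF da(1) va(1) ca(2)]] conjunct1[OF bB[OF db(1) vb(1) cb(2)]]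
        conjunct2[OF bA[OF da(2) va(2) ca(1)]] conjunct2[OF bB[OF db(2) vb(2) cb(1)]])+
  \<comment> \<open>\<open>k0\<close> makes only the weighted sum of the two factor derivatives of
    each weight vanish. Multiplied by \<open>KA\<close> and \<open>KB\<close>, these sums are
    exactly the terms left over.\<close>
  define KA KB where "KA = ?TA (cA z (\<beta> z)) (cA z (\<gamma> z))" and "KB = ?TB (cB z (\<beta> z)) (cB z (\<gamma> z))"
  have "lamA z * aA \<alpha> z (\<lambda>x. kapA (mk x ?y)) + lamB z * aB \<alpha> z (\<lambda>y. kapA (mk ?x y)) = 0"
    "lamA z * aA \<alpha> z (\<lambda>x. kapB (mk x ?y)) + lamB z * aB \<alpha> z (\<lambda>y. kapB (mk ?x y)) = 0"
    using k0 anchor_split[OF \<alpha> k(1), of z] anchor_split[OF \<alpha> k(2), of z] by simp_all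
  then have "KA * (lamA z * aA \<alpha> z (\<lambda>x. kapA (mk x ?y)) + lamB z * aB \<alpha> z (\<lambda>y. kapA (mk ?x y))) = 0"
    "KB * (lamA z * aA \<alpha> z (\<lambda>x. kapB (mk x ?y)) + lamB z * aB \<alpha> z (\<lambda>y. kapB (mk ?x y))) = 0"
    by simp_all
  then show ?thesis
    unfolding anchor_split[OF \<alpha> sm] hA hB E E' KA_def[symmetric] KB_def[symmetric]
    by (simp add: algebra_simps)
qed

end

section \<open>From the product down to a factor\<close>

context product_manifold begin

text \<open>Over one slice \<open>T\<close> determines \<open>TA\<close> through lifts up to the
  nonzero factor \<open>e\<close>. This yields the tensoriality of the cometrics of the factors from
  that of the warped cometric.\<close>

lemma tensor_of_lifts:
  assumes T: "contravariant_tensor2 M T" and e: "e \<noteq> 0"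
    and TA: "\<And>\<alpha> \<beta> x. \<alpha> \<in> one_forms A \<Longrightarrow> \<beta> \<in> one_forms A \<Longrightarrow>
      T (mk x y) (lA \<alpha> (mk x y)) (lA \<beta> (mk x y)) = e * TA x (\<alpha> x) (\<beta> x)"
  shows "contravariant_tensor2 A TA"
  unfolding contravariant_tensor2_def
proof (intro conjI allI ballI)
  fix x a b c and r s :: real
  assume abc: "a \<in> cotangent_space A x" "b \<in> cotangent_space A x" "c \<in> cotangent_space A x"
  obtain \<alpha> where \<alpha>: "\<alpha> \<in> one_forms A" "\<alpha> x = a" using A.one_form_extend[OF abc(1)] .
  obtain \<beta> where \<beta>: "\<beta> \<in> one_forms A" "\<beta> x = b" using A.one_form_extend[OF abc(2)] .
  obtain \<gamma> where \<gamma>: "\<gamma> \<in> one_forms A" "\<gamma> x = c" using A.one_form_extend[OF abc(3)] .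
  note bil = M.tensor_cobilinear[OF T, of "mk x y", unfolded M.cobilinear_def, rule_format,
      OF M.one_form_cotangent[OF lA_one_form[OF \<alpha>(1)]] M.one_form_cotangent[OF lA_one_form[OF \<beta>(1)]]
        M.one_form_cotangent[OF lA_one_form[OF \<gamma>(1)]], of r s]
  note l = A.one_form_lin[OF \<alpha>(1) \<beta>(1), of r s]
  have "e * TA x (\<lambda>v. r * a v + s * b v) c = e * (r * TA x a c + s * TA x b c)"
    using bil[THEN conjunct1] TA[OF l \<gamma>(1), of x] TA[OF \<alpha>(1) \<gamma>(1), of x] TA[OF \<beta>(1) \<gamma>(1), of x] \<alpha>(2) \<beta>(2) \<gamma>(2)
    by (simp add: lA_lin algebra_simps)
  then show "TA x (\<lambda>v. r * a v + s * b v) c = r * TA x a c + s * TA x b c" using e by simp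
  have "e * TA x c (\<lambda>v. r * a v + s * b v) = e * (r * TA x c a + s * TA x c b)"
    using bil[THEN conjunct2] TA[OF \<gamma>(1) l, of x] TA[OF \<gamma>(1) \<alpha>(1), of x] TA[OF \<gamma>(1) \<beta>(1), of x] \<alpha>(2) \<beta>(2) \<gamma>(2)
    by (simp add: lA_lin algebra_simps)
  then show "TA x c (\<lambda>v. r * a v + s * b v) = r * TA x c a + s * TA x c b" using e by simp
next
  fix \<alpha> \<beta> assume \<alpha>\<beta>: "\<alpha> \<in> one_forms A" "\<beta> \<in> one_forms A"
  have "(\<lambda>x. (1 / e) * T (mk x y) (lA \<alpha> (mk x y)) (lA \<beta> (mk x y))) \<in> smooth_funs A"
    by (intro A.smooth_mult A.smooth_const IA.smooth_comp[OF M.tensor_smooth[OF T lA_one_form[OF \<alpha>\<beta>(1)] lA_one_form[OF \<alpha>\<beta>(2)]]])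
  then show "contra_eval TA \<alpha> \<beta> \<in> smooth_funs A"
    using e by (simp add: TA[OF \<alpha>\<beta>] contra_eval_def[abs_def])
qed

end

context product_bivector begin

interpretation S: product_bivector B A M pB pA "\<lambda>y x. mk x y" P PB PA lamB lamA by (rule swap_bivector)

context
  fixes D y0 c
  assumes D: "contravariant_connection M P D" and c: "c \<noteq> 0" and lam: "\<And>x. lamA (mk x y0) = c"
begin

text \<open>The factor \<open>1 / c\<close> is forced by the Leibniz rule: on the slice the anchor
  of a lifted form is \<open>c\<close> times its anchor in the factor (\<open>anchor_lift\<close>),
  and the restricted connection differentiates functions along the former.\<close>

definition slice_conn :: "('a \<Rightarrow> 'a covec) \<Rightarrow> ('a \<Rightarrow> 'a covec) \<Rightarrow> 'a \<Rightarrow> 'a covec" where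
  "slice_conn \<alpha> \<beta> = (\<lambda>x v. (1 / c) * sA y0 (D (lA \<alpha>) (lA \<beta>)) x v)"

lemma anchor_lift:
  assumes \<alpha>: "\<alpha> \<in> one_forms A" and h: "h \<in> smooth_funs M"
  shows "anchor M P (lA \<alpha>) (mk x y0) h = c * anchor A PA \<alpha> x (\<lambda>x. h (mk x y0))"
  using anchor_split[OF lA_one_form[OF \<alpha>] h, of "mk x y0"] aA_lA[OF \<alpha>, of "mk x y0"] S.aA_lB[OF \<alpha>, of "mk x y0"] lam
  by simp

lemma slice_conn_connection: "contravariant_connection A PA slice_conn"
  unfolding contravariant_connection_def
proof (intro conjI ballI allI)
  fix \<alpha> \<beta> assume \<alpha>\<beta>: "\<alpha> \<in> one_forms A" "\<beta> \<in> one_forms A"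
  note l\<alpha> = lA_one_form[OF \<alpha>\<beta>(1)] and l\<beta> = lA_one_form[OF \<alpha>\<beta>(2)]
  show "slice_conn \<alpha> \<beta> \<in> one_forms A"
    unfolding slice_conn_def
    by (intro A.one_form_mult A.smooth_const sA_one_form M.connection_one_form[OF D] l\<alpha> l\<beta>)
  {
    fix \<gamma> and r s :: real assume "\<gamma> \<in> one_forms A"
    then have l\<gamma>: "lA \<gamma> \<in> one_forms M" by (rule lA_one_form)
    show "slice_conn (\<lambda>p v. r * \<alpha> p v + s * \<beta> p v) \<gamma> = (\<lambda>p v. r * slice_conn \<alpha> \<gamma> p v + s * slice_conn \<beta> \<gamma> p v)"
      unfolding slice_conn_def lA_lin M.connection_lin[OF D l\<alpha> l\<beta> l\<gamma>] sA_lin by (simp add: algebra_simps)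
    show "slice_conn \<gamma> (\<lambda>p v. r * \<alpha> p v + s * \<beta> p v) = (\<lambda>p v. r * slice_conn \<gamma> \<alpha> p v + s * slice_conn \<gamma> \<beta> p v)"
      unfolding slice_conn_def lA_lin M.connection_lin[OF D l\<alpha> l\<beta> l\<gamma>] sA_lin by (simp add: algebra_simps)
  }
  fix h assume h: "h \<in> smooth_funs A"
  note h' = PA.smooth_comp[OF h]
  show "slice_conn (\<lambda>p v. h p * \<alpha> p v) \<beta> = (\<lambda>p v. h p * slice_conn \<alpha> \<beta> p v)"
    unfolding slice_conn_def lA_mult M.connection_mult(1)[OF D h' l\<alpha> l\<beta>] sA_mult by (simp add: algebra_simps)
  show "slice_conn \<alpha> (\<lambda>p v. h p * \<beta> p v) = (\<lambda>p v. h p * slice_conn \<alpha> \<beta> p v + anchor A PA \<alpha> p h * \<beta> p v)"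
  proof (intro ext)
    fix x v
    let ?\<omega> = "D (lA \<alpha>) (lA \<beta>)"
    have "sA y0 (D (lA \<alpha>) (lA (\<lambda>p v. h p * \<beta> p v))) x v = h x * sA y0 ?\<omega> x v + c * anchor A PA \<alpha> x h * sA y0 (lA \<beta>) x v"
      unfolding lA_mult M.connection_mult(2)[OF D h' l\<alpha> l\<beta>]
      using anchor_lift[OF \<alpha>\<beta>(1) h', of x] by (simp add: pullback_def)
    then show "slice_conn \<alpha> (\<lambda>p v. h p * \<beta> p v) x v = h x * slice_conn \<alpha> \<beta> x v + anchor A PA \<alpha> x h * \<beta> x v"
      using c by (simp add: slice_conn_def sA_lA[OF \<alpha>\<beta>(2)] field_simps)
  qed
qed

lemma slice_conn_torsion:
  assumes M: "\<And>\<alpha> \<beta>. \<alpha> \<in> one_forms M \<Longrightarrow> \<beta> \<in> one_forms M \<Longrightarrow> (\<lambda>p v. D \<alpha> \<beta> p v - D \<beta> \<alpha> p v) = koszul_bracket M P \<alpha> \<beta>"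
    and \<alpha>\<beta>: "\<alpha> \<in> one_forms A" "\<beta> \<in> one_forms A"
  shows "(\<lambda>p v. slice_conn \<alpha> \<beta> p v - slice_conn \<beta> \<alpha> p v) = koszul_bracket A PA \<alpha> \<beta>"
proof
  fix x
  let ?z = "mk x y0"
  have "cA ?z (\<lambda>v. D (lA \<alpha>) (lA \<beta>) ?z v - D (lA \<beta>) (lA \<alpha>) ?z v) = cA ?z (koszul_bracket M P (lA \<alpha>) (lA \<beta>) ?z)"
    by (simp add: M[symmetric] lA_one_form \<alpha>\<beta>)
  \<comment> \<open>The cross terms vanish: forms lifted from the first factor have zero slices in
    the second, hence zero anchor there.\<close>
  also have "\<dots> = (\<lambda>u. c * koszul_bracket A PA \<alpha> \<beta> x u)"
    unfolding koszul_split[OF lA_one_form[OF \<alpha>\<beta>(1)] lA_one_form[OF \<alpha>\<beta>(2)]]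
    by (simp add: lam sA_lA \<alpha>\<beta> S.aA_lB[OF \<alpha>\<beta>(1), of ?z, simplified] S.aA_lB[OF \<alpha>\<beta>(2), of ?z, simplified])
  finally have "(\<lambda>u. sA y0 (D (lA \<alpha>) (lA \<beta>)) x u - sA y0 (D (lA \<beta>) (lA \<alpha>)) x u) = (\<lambda>u. c * koszul_bracket A PA \<alpha> \<beta> x u)"
    by (simp add: cpull_diff pullback_eq_cpull)
  from fun_cong[OF this]
  show "(\<lambda>v. slice_conn \<alpha> \<beta> x v - slice_conn \<beta> \<alpha> x v) = koszul_bracket A PA \<alpha> \<beta> x"
    using c by (auto simp: slice_conn_def fun_eq_iff field_simps)
qed

text \<open>Evaluated on lifts along the slice, both sides of the equation for \<open>T\<close>
  carry the constant \<open>e\<close>, and the anchor carries \<open>c\<close>. Cancelling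
  \<open>e\<close> and then \<open>c\<close> leaves the equation for \<open>TA\<close>.\<close>

lemma slice_conn_tensor:
  assumes TM: "contravariant_tensor2 M T" and TA: "contravariant_tensor2 A TA" and TB: "contravariant_tensor2 B TB"
    and T: "split_tensor T kapA TA kapB TB" and e: "e \<noteq> 0" "\<And>x. kapA (mk x y0) = e"
    and M: "parallel_tensor M P D T"
    and \<alpha>: "\<alpha> \<in> one_forms A" and \<beta>: "\<beta> \<in> one_forms A" and \<gamma>: "\<gamma> \<in> one_forms A"
  shows "anchor A PA \<alpha> x (contra_eval TA \<beta> \<gamma>) = contra_eval TA (slice_conn \<alpha> \<beta>) \<gamma> x + contra_eval TA \<beta> (slice_conn \<alpha> \<gamma>) x"
proof -
  let ?z = "\<lambda>x. mk x y0"
  note l = lA_one_form[OF \<alpha>] lA_one_form[OF \<beta>] lA_one_form[OF \<gamma>]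
  have zB: "TB y b (\<lambda>v. 0) = 0" "TB y (\<lambda>v. 0) b = 0" if "b \<in> cotangent_space B y" for y b
    using B.cobilinear_scale[OF B.tensor_cobilinear[OF TB] B.cotangent_zero that, where r = 0]
      B.cobilinear_scale[OF B.tensor_cobilinear[OF TB] that B.cotangent_zero, where r = 0] by simp_all
  \<comment> \<open>Here \<omega> will be the connection applied to lifts, which may have a
    component in the second factor. It meets the restriction of a lift from the first factor, which
    is zero there.\<close>
  have 1: "contra_eval T \<omega> (lA \<eta>) (?z x) = e * TA x (sA y0 \<omega> x) (\<eta> x)"
    "contra_eval T (lA \<eta>) \<omega> (?z x) = e * TA x (\<eta> x) (sA y0 \<omega> x)"
    if \<omega>: "\<omega> \<in> one_forms M" and \<eta>: "\<eta> \<in> one_forms A" for \<omega> \<eta> x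
    using split_tensorD[OF T M.one_form_cotangent[OF \<omega>] M.one_form_cotangent[OF lA_one_form[OF \<eta>]], of "?z x"]
      split_tensorD[OF T M.one_form_cotangent[OF lA_one_form[OF \<eta>]] M.one_form_cotangent[OF \<omega>], of "?z x"]
      cA_lA[OF \<eta>, of "?z x"] S.cA_lB[OF \<eta>, of "?z x"]
      zB[OF S.cA_cotangent[OF M.one_form_cotangent[OF \<omega>, of "?z x"]]]
    by (simp_all add: contra_eval_def e pullback_eq_cpull)
  have sm: "contra_eval T (lA \<beta>) (lA \<gamma>) \<in> smooth_funs M"
    using M.tensor_smooth[OF TM l(2,3)] by (simp add: contra_eval_def[abs_def])
  have smA: "contra_eval TA \<beta> \<gamma> \<in> smooth_funs A"
    using A.tensor_smooth[OF TA \<beta> \<gamma>] by (simp add: contra_eval_def[abs_def])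
  have "(\<lambda>x. contra_eval T (lA \<beta>) (lA \<gamma>) (?z x)) = (\<lambda>x. e * contra_eval TA \<beta> \<gamma> x)"
    using 1(1)[OF l(2) \<gamma>] by (simp add: contra_eval_def sA_lA[OF \<beta>])
  then have "anchor M P (lA \<alpha>) (?z x) (contra_eval T (lA \<beta>) (lA \<gamma>)) = c * (e * anchor A PA \<alpha> x (contra_eval TA \<beta> \<gamma>))"
    using anchor_lift[OF \<alpha> sm, of x] A.tangent_scale_fun[OF A.anchor_tangent[OF tensA \<alpha>] smA] by simp
  moreover have "anchor M P (lA \<alpha>) (?z x) (contra_eval T (lA \<beta>) (lA \<gamma>)) =
      e * TA x (sA y0 (D (lA \<alpha>) (lA \<beta>)) x) (\<gamma> x) + e * TA x (\<beta> x) (sA y0 (D (lA \<alpha>) (lA \<gamma>)) x)"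
    using parallel_tensorD[OF M l, of "?z x"] 1(1)[OF M.connection_one_form[OF D l(1,2)] \<gamma>]
      1(2)[OF M.connection_one_form[OF D l(1,3)] \<beta>] by simp
  ultimately have "c * anchor A PA \<alpha> x (contra_eval TA \<beta> \<gamma>) =
      TA x (sA y0 (D (lA \<alpha>) (lA \<beta>)) x) (\<gamma> x) + TA x (\<beta> x) (sA y0 (D (lA \<alpha>) (lA \<gamma>)) x)"
    using e(1) by (simp add: distrib_left[symmetric] mult.left_commute[of c e])
  moreover have "TA x (slice_conn \<alpha> \<beta> x) (\<gamma> x) = (1 / c) * TA x (sA y0 (D (lA \<alpha>) (lA \<beta>)) x) (\<gamma> x)"
    "TA x (\<beta> x) (slice_conn \<alpha> \<gamma> x) = (1 / c) * TA x (\<beta> x) (sA y0 (D (lA \<alpha>) (lA \<gamma>)) x)"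
    unfolding slice_conn_def
    by (rule A.cobilinear_scale[OF A.tensor_cobilinear[OF TA]];
        intro sA_cotangent M.connection_one_form[OF D] l A.one_form_cotangent \<beta> \<gamma>)+
  ultimately have "c * anchor A PA \<alpha> x (contra_eval TA \<beta> \<gamma>) =
      c * (TA x (slice_conn \<alpha> \<beta> x) (\<gamma> x) + TA x (\<beta> x) (slice_conn \<alpha> \<gamma> x))"
    using c by (simp add: distrib_left)
  then show ?thesis using c by (simp add: contra_eval_def)
qed

end

end

section \<open>The product atlas and the theorem\<close>

locale two_atlases = A: smooth_manifold A + B: smooth_manifold B
  for A :: "('a::{t2_space, second_countable_topology}, 'e::euclidean_space) atlas"
    and B :: "('b::{t2_space, second_countable_topology}, 'f::euclidean_space) atlas"
begin

abbreviation "M \<equiv> prod_atlas A B"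

lemma prod_atlas_cases:
  assumes "(W, \<theta>) \<in> M"
  obtains U \<phi> V \<psi> where "(U, \<phi>) \<in> A" "(V, \<psi>) \<in> B" "W = U \<times> V" "\<theta> = map_prod \<phi> \<psi>"
  using assms by (auto simp: prod_atlas_def)

lemma prod_chart: "(U, \<phi>) \<in> A \<Longrightarrow> (V, \<psi>) \<in> B \<Longrightarrow> (U \<times> V, map_prod \<phi> \<psi>) \<in> M"
  by (auto simp: prod_atlas_def)

lemma prod_chart_inv:
  assumes "(U, \<phi>) \<in> A" "(V, \<psi>) \<in> B" "w \<in> (\<phi> ` U) \<times> (\<psi> ` V)"
  shows "inv_into (U \<times> V) (map_prod \<phi> \<psi>) w = (inv_into U \<phi> (fst w), inv_into V \<psi> (snd w))"
proof -
  obtain p q where pq: "p \<in> U" "q \<in> V" "w = (\<phi> p, \<psi> q)" using assms(3) by auto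
  have "inj_on (map_prod \<phi> \<psi>) (U \<times> V)"
    using A.chart_inv[OF assms(1)] B.chart_inv[OF assms(2)]
    by (intro map_prod_inj_on) (metis inj_on_def)+
  then have "inv_into (U \<times> V) (map_prod \<phi> \<psi>) (map_prod \<phi> \<psi> (p, q)) = (p, q)"
    using pq by (intro inv_into_f_f) auto
  then show ?thesis using pq assms by simp
qed

lemma prod_chart_image: "map_prod \<phi> \<psi> ` (U \<times> V) = (\<phi> ` U) \<times> (\<psi> ` V)"
  by (rule map_prod_surj_on) auto

lemma smooth_prod_atlas: "smooth_atlas M"
  unfolding smooth_atlas_def
proof (intro conjI ballI)
  fix c assume "c \<in> M"
  then obtain U \<phi> V \<psi> where UV: "(U, \<phi>) \<in> A" "(V, \<psi>) \<in> B" and c: "c = (U \<times> V, map_prod \<phi> \<psi>)"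
    using prod_atlas_cases[of "fst c" "snd c"] by (metis prod.collapse)
  note o = A.chart_open[OF UV(1)] B.chart_open[OF UV(2)] A.chart_image_open[OF UV(1)] B.chart_image_open[OF UV(2)]
  note hA = A.chart_homeo[OF UV(1)] and hB = B.chart_homeo[OF UV(2)]
  have "homeomorphism (U \<times> V) ((\<phi> ` U) \<times> (\<psi> ` V)) (map_prod \<phi> \<psi>) (inv_into (U \<times> V) (map_prod \<phi> \<psi>))"
  proof (rule homeomorphismI)
    have "continuous_on U \<phi>" "continuous_on V \<psi>" using hA hB by (auto simp: homeomorphism_def)
    then have "continuous_on (U \<times> V) (\<lambda>z. (\<phi> (fst z), \<psi> (snd z)))"
      by (intro continuous_on_Pair) (auto intro!: continuous_on_compose2[of U \<phi>] continuous_on_compose2[of V \<psi>] continuous_intros)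
    then show "continuous_on (U \<times> V) (map_prod \<phi> \<psi>)" by (simp add: map_prod_def split_beta)
    have "continuous_on (\<phi> ` U) (inv_into U \<phi>)" "continuous_on (\<psi> ` V) (inv_into V \<psi>)"
      using hA hB by (auto simp: homeomorphism_def)
    then have "continuous_on ((\<phi> ` U) \<times> (\<psi> ` V)) (\<lambda>w. (inv_into U \<phi> (fst w), inv_into V \<psi> (snd w)))"
      by (intro continuous_on_Pair)
        (auto intro!: continuous_on_compose2[of "\<phi> ` U" "inv_into U \<phi>"] continuous_on_compose2[of "\<psi> ` V" "inv_into V \<psi>"] continuous_intros)
    then show "continuous_on ((\<phi> ` U) \<times> (\<psi> ` V)) (inv_into (U \<times> V) (map_prod \<phi> \<psi>))"
      by (rule continuous_on_eq) (simp add: prod_chart_inv[OF UV])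
    show "map_prod \<phi> \<psi> ` (U \<times> V) \<subseteq> (\<phi> ` U) \<times> (\<psi> ` V)" by auto
    show "inv_into (U \<times> V) (map_prod \<phi> \<psi>) ` ((\<phi> ` U) \<times> (\<psi> ` V)) \<subseteq> U \<times> V"
      using UV by (auto simp: prod_chart_inv[OF UV])
    show "inv_into (U \<times> V) (map_prod \<phi> \<psi>) (map_prod \<phi> \<psi> z) = z" if "z \<in> U \<times> V" for z
      using that UV by (auto simp: prod_chart_inv[OF UV])
    show "map_prod \<phi> \<psi> (inv_into (U \<times> V) (map_prod \<phi> \<psi>) w) = w" if "w \<in> (\<phi> ` U) \<times> (\<psi> ` V)" for w
      using that UV by (auto simp: prod_chart_inv[OF UV that])
  qed
  then show "case c of (U, \<phi>) \<Rightarrow> open U \<and> open (\<phi> ` U) \<and> homeomorphism U (\<phi> ` U) \<phi> (inv_into U \<phi>)"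
    using o by (simp add: c prod_chart_image open_Times)
next
  show "(\<Union>(U, \<phi>)\<in>M. U) = UNIV"
  proof (rule UNIV_eq_I[symmetric])
    fix z :: "'a \<times> 'b"
    obtain U \<phi> where U: "(U, \<phi>) \<in> A" "fst z \<in> U" using A.ex_chart by blast
    obtain V \<psi> where V: "(V, \<psi>) \<in> B" "snd z \<in> V" using B.ex_chart by blast
    show "z \<in> (\<Union>(U, \<phi>)\<in>M. U)"
      using prod_chart[OF U(1) V(1)] U(2) V(2) by (intro UN_I[where a = "(U \<times> V, map_prod \<phi> \<psi>)"]) (auto simp: mem_Times_iff)
  qed
next
  fix c assume "c \<in> M"
  then obtain U \<phi> V \<psi> where UV: "(U, \<phi>) \<in> A" "(V, \<psi>) \<in> B" and c: "c = (U \<times> V, map_prod \<phi> \<psi>)"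
    using prod_atlas_cases[of "fst c" "snd c"] by (metis prod.collapse)
  show "case c of (U, \<phi>) \<Rightarrow> \<forall>(V, \<psi>)\<in>M. smooth_on (\<phi> ` (U \<inter> V)) (\<psi> \<circ> inv_into U \<phi>)"
    unfolding c prod.case
  proof (rule ballI)
    fix c' assume "c' \<in> M"
    then obtain U' \<phi>' V' \<psi>' where UV': "(U', \<phi>') \<in> A" "(V', \<psi>') \<in> B" and c': "c' = (U' \<times> V', map_prod \<phi>' \<psi>')"
      using prod_atlas_cases[of "fst c'" "snd c'"] by (metis prod.collapse)
    let ?S = "\<phi> ` (U \<inter> U')" and ?T = "\<psi> ` (V \<inter> V')"
    have o: "open ?S" "open ?T"
      using A.chart_image_sub_open[OF UV(1) A.chart_open[OF UV'(1)]] B.chart_image_sub_open[OF UV(2) B.chart_open[OF UV'(2)]] .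
    have ST: "open (?S \<times> ?T)" using o by (rule open_Times)
    have im: "map_prod \<phi> \<psi> ` (U \<times> V \<inter> U' \<times> V') = ?S \<times> ?T"
      by (simp add: Times_Int_Times prod_chart_image)
    have "smooth_on (?S \<times> ?T) (\<lambda>w. (\<phi>' (inv_into U \<phi> (fst w)), \<psi>' (inv_into V \<psi> (snd w))))"
    proof (rule smooth_on_Pair[OF ST])
      show "smooth_on (?S \<times> ?T) (\<lambda>w. \<phi>' (inv_into U \<phi> (fst w)))"
        by (rule smooth_on_compose[OF ST o(1) _ A.chart_transition[OF UV(1) UV'(1)] smooth_on_linear[OF bounded_linear_fst ST]]) auto
      show "smooth_on (?S \<times> ?T) (\<lambda>w. \<psi>' (inv_into V \<psi> (snd w)))"
        by (rule smooth_on_compose[OF ST o(2) _ B.chart_transition[OF UV(2) UV'(2)] smooth_on_linear[OF bounded_linear_snd ST]]) auto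
    qed
    then have "smooth_on (?S \<times> ?T) (map_prod \<phi>' \<psi>' \<circ> inv_into (U \<times> V) (map_prod \<phi> \<psi>))"
      by (rule smooth_on_cong[OF ST]) (auto simp: prod_chart_inv[OF UV])
    then show "case c' of (W, \<theta>) \<Rightarrow> smooth_on (map_prod \<phi> \<psi> ` (U \<times> V \<inter> W)) (\<theta> \<circ> inv_into (U \<times> V) (map_prod \<phi> \<psi>))"
      by (simp add: c' im)
  qed
qed

sublocale M: smooth_manifold M by unfold_locales (rule smooth_prod_atlas)

lemma smooth_fst:
  assumes h: "h \<in> smooth_funs A" shows "(\<lambda>z. h (fst z)) \<in> smooth_funs M"
proof (rule M.smooth_funsI)
  fix W \<theta> assume "(W, \<theta>) \<in> M"
  then obtain U \<phi> V \<psi> where UV: "(U, \<phi>) \<in> A" "(V, \<psi>) \<in> B" and W: "W = U \<times> V" "\<theta> = map_prod \<phi> \<psi>"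
    by (rule prod_atlas_cases)
  let ?S = "\<phi> ` U" and ?T = "\<psi> ` V"
  note o = A.chart_image_open[OF UV(1)] B.chart_image_open[OF UV(2)]
  have ST: "open (?S \<times> ?T)" using o by (rule open_Times)
  have "smooth_on (?S \<times> ?T) (\<lambda>w. h (inv_into U \<phi> (fst w)))"
    by (rule smooth_on_compose[OF ST o(1) _ A.smooth_chart[OF h UV(1)] smooth_on_linear[OF bounded_linear_fst ST]]) auto
  then have "smooth_on (?S \<times> ?T) (\<lambda>w. h (fst (inv_into W \<theta> w)))"
    by (rule smooth_on_cong[OF ST]) (simp add: W prod_chart_inv[OF UV])
  then show "smooth_on (\<theta> ` W) (\<lambda>w. h (fst (inv_into W \<theta> w)))" by (simp add: W prod_chart_image)
qed

lemma smooth_slice1: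
  assumes h: "h \<in> smooth_funs M" shows "(\<lambda>x. h (x, q)) \<in> smooth_funs A"
proof (rule A.smooth_funsI)
  fix U \<phi> assume U: "(U, \<phi>) \<in> A"
  obtain V \<psi> where V: "(V, \<psi>) \<in> B" "q \<in> V" using B.ex_chart by blast
  let ?S = "\<phi> ` U" and ?T = "\<psi> ` V"
  note o = A.chart_image_open[OF U] B.chart_image_open[OF V(1)]
  have ST: "open (?S \<times> ?T)" using o by (rule open_Times)
  have hs: "smooth_on (?S \<times> ?T) (\<lambda>w. h (inv_into (U \<times> V) (map_prod \<phi> \<psi>) w))"
    using M.smooth_chart[OF h prod_chart[OF U V(1)]] by (simp add: prod_chart_image)
  have "smooth_on ?S (\<lambda>x. h (inv_into (U \<times> V) (map_prod \<phi> \<psi>) (x, \<psi> q)))"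
    by (rule smooth_on_compose[OF o(1) ST _ hs smooth_on_Pair[OF o(1) smooth_on_linear[OF bounded_linear_ident o(1)] smooth_on_const]])
      (use V(2) in auto)
  then show "smooth_on ?S (\<lambda>x. h (inv_into U \<phi> x, q))"
    by (rule smooth_on_cong[OF o(1)]) (use V in \<open>simp add: prod_chart_inv[OF U V(1)]\<close>)
qed

lemma smooth_swap:
  assumes h: "h \<in> smooth_funs M"
  shows "(\<lambda>z. h (snd z, fst z)) \<in> smooth_funs (prod_atlas B A)"
proof -
  interpret S: two_atlases B A ..
  show ?thesis
  proof (rule S.M.smooth_funsI)
    fix W \<theta> assume "(W, \<theta>) \<in> prod_atlas B A"
    then obtain V \<psi> U \<phi> where VU: "(V, \<psi>) \<in> B" "(U, \<phi>) \<in> A" and W: "W = V \<times> U" "\<theta> = map_prod \<psi> \<phi>"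
      by (rule S.prod_atlas_cases)
    let ?S = "\<phi> ` U" and ?T = "\<psi> ` V"
    note o = A.chart_image_open[OF VU(2)] B.chart_image_open[OF VU(1)]
    have TS: "open (?T \<times> ?S)" and ST: "open (?S \<times> ?T)" using o by (auto intro: open_Times)
    have hs: "smooth_on (?S \<times> ?T) (\<lambda>w. h (inv_into (U \<times> V) (map_prod \<phi> \<psi>) w))"
      using M.smooth_chart[OF h prod_chart[OF VU(2,1)]] by (simp add: prod_chart_image)
    have "smooth_on (?T \<times> ?S) (\<lambda>w. h (inv_into (U \<times> V) (map_prod \<phi> \<psi>) (snd w, fst w)))"
      by (rule smooth_on_compose[OF TS ST _ hs smooth_on_Pair[OF TS smooth_on_linear[OF bounded_linear_snd TS]
              smooth_on_linear[OF bounded_linear_fst TS]]]) auto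
    then have "smooth_on (?T \<times> ?S) (\<lambda>w. h (snd (inv_into W \<theta> w), fst (inv_into W \<theta> w)))"
      by (rule smooth_on_cong[OF TS]) (auto simp: W prod_chart_inv[OF VU(2,1)] S.prod_chart_inv[OF VU])
    then show "smooth_on (\<theta> ` W) (\<lambda>w. h (snd (inv_into W \<theta> w), fst (inv_into W \<theta> w)))"
      by (simp add: W S.prod_chart_image)
  qed
qed

end

section \<open>Tangent vectors of the product in product charts\<close>

context two_atlases begin

interpretation S: two_atlases B A ..

lemma smooth_snd: "h \<in> smooth_funs B \<Longrightarrow> (\<lambda>z. h (snd z)) \<in> smooth_funs M"
  using S.smooth_swap[OF S.smooth_fst] by simp

lemma smooth_slice2: "h \<in> smooth_funs M \<Longrightarrow> (\<lambda>y. h (p, y)) \<in> smooth_funs B"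
  using S.smooth_slice1[OF smooth_swap] by simp

lemma partial_derivatives:
  assumes h: "h \<in> smooth_funs M" and UV: "(U, \<phi>) \<in> A" "(V, \<psi>) \<in> B" and pq: "p \<in> U" "q \<in> V"
  defines "H \<equiv> \<lambda>w. h (inv_into (U \<times> V) (map_prod \<phi> \<psi>) w)"
  shows "frechet_derivative (\<lambda>x. h (inv_into U \<phi> x, q)) (at (\<phi> p)) b = frechet_derivative H (at (\<phi> p, \<psi> q)) (b, 0)"
    and "frechet_derivative (\<lambda>y. h (p, inv_into V \<psi> y)) (at (\<psi> q)) b' = frechet_derivative H (at (\<phi> p, \<psi> q)) (0, b')"
    and "linear (frechet_derivative H (at (\<phi> p, \<psi> q)))"
proof -
  note o = A.chart_image_open[OF UV(1)] B.chart_image_open[OF UV(2)]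
  have H: "(H has_derivative frechet_derivative H (at (\<phi> p, \<psi> q))) (at (\<phi> p, \<psi> q))"
    unfolding H_def
    by (rule smooth_on_has_derivative[OF M.smooth_chart[OF h prod_chart[OF UV]]]) (use pq in \<open>auto simp: prod_chart_image\<close>)
  have "((\<lambda>x. H (x, \<psi> q)) has_derivative (\<lambda>b. frechet_derivative H (at (\<phi> p, \<psi> q)) (b, 0))) (at (\<phi> p))"
  proof -
    have "((\<lambda>x. (x, \<psi> q)) has_derivative (\<lambda>b. (b, 0))) (at (\<phi> p))" by (auto intro!: derivative_eq_intros)
    from has_derivative_compose[OF this H] show ?thesis .
  qed
  then have "((\<lambda>x. h (inv_into U \<phi> x, q)) has_derivative (\<lambda>b. frechet_derivative H (at (\<phi> p, \<psi> q)) (b, 0))) (at (\<phi> p))"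
    by (rule has_derivative_transform_within_open[OF _ o(1)])
      (use pq UV in \<open>auto simp: H_def prod_chart_inv[OF UV]\<close>)
  from fun_cong[OF frechet_derivative_at[OF this], of b]
  show "frechet_derivative (\<lambda>x. h (inv_into U \<phi> x, q)) (at (\<phi> p)) b = frechet_derivative H (at (\<phi> p, \<psi> q)) (b, 0)"
    by simp
  have "((\<lambda>y. H (\<phi> p, y)) has_derivative (\<lambda>b. frechet_derivative H (at (\<phi> p, \<psi> q)) (0, b))) (at (\<psi> q))"
  proof -
    have "((\<lambda>y. (\<phi> p, y)) has_derivative (\<lambda>b. (0, b))) (at (\<psi> q))" by (auto intro!: derivative_eq_intros)
    from has_derivative_compose[OF this H] show ?thesis .
  qed
  then have "((\<lambda>y. h (p, inv_into V \<psi> y)) has_derivative (\<lambda>b. frechet_derivative H (at (\<phi> p, \<psi> q)) (0, b))) (at (\<psi> q))"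
    by (rule has_derivative_transform_within_open[OF _ o(2)])
      (use pq UV in \<open>auto simp: H_def prod_chart_inv[OF UV]\<close>)
  from fun_cong[OF frechet_derivative_at[OF this], of b']
  show "frechet_derivative (\<lambda>y. h (p, inv_into V \<psi> y)) (at (\<psi> q)) b' = frechet_derivative H (at (\<phi> p, \<psi> q)) (0, b')"
    by simp
  show "linear (frechet_derivative H (at (\<phi> p, \<psi> q)))" by (rule has_derivative_linear[OF H])
qed

text \<open>In a product chart \<open>v h\<close> is linear in the partial derivatives of
  \<open>h\<close> at \<open>z\<close>. Freezing one coordinate keeps the partial derivatives in the
  other and makes the remaining ones zero.\<close>

lemma tangent_split:
  assumes v: "v \<in> tangent_space M z" and h: "h \<in> smooth_funs M"
  shows "v h = v (\<lambda>z'. h (fst z', snd z)) + v (\<lambda>z'. h (fst z, snd z'))"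
proof -
  obtain U \<phi> where U: "(U, \<phi>) \<in> A" "fst z \<in> U" using A.ex_chart by blast
  obtain V \<psi> where V: "(V, \<psi>) \<in> B" "snd z \<in> V" using B.ex_chart by blast
  let ?\<theta> = "map_prod \<phi> \<psi>"
  have c: "(U \<times> V, ?\<theta>) \<in> M" "z \<in> U \<times> V" using prod_chart[OF U(1) V(1)] U(2) V(2) by (auto simp: mem_Times_iff)
  obtain W x where "M.chart_coordinates (U \<times> V) ?\<theta> z W x" using M.ex_chart_coordinates[OF c] .
  note W = M.chart_coordinatesD[OF this]
  let ?D = "\<lambda>h. frechet_derivative (\<lambda>w. h (inv_into (U \<times> V) ?\<theta> w)) (at (\<phi> (fst z), \<psi> (snd z)))"
  let ?h1 = "\<lambda>z'. h (fst z', snd z)" and ?h2 = "\<lambda>z'. h (fst z, snd z')"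
  have sm: "?h1 \<in> smooth_funs M" "?h2 \<in> smooth_funs M"
    by (rule smooth_fst[OF smooth_slice1[OF h]], rule smooth_snd[OF smooth_slice2[OF h]])
  note pd = partial_derivatives[OF _ U(1) V(1) U(2) V(2)]
  have spl: "?D k (b, b') = ?D k (b, 0) + ?D k (0, b')" if "k \<in> smooth_funs M" for k b b'
    using linear_add[OF pd(3)[OF that], of "(b, 0)" "(0, b')"] by simp
  have D1: "?D ?h1 (b, b') = ?D h (b, 0)" for b b'
    using pd(1)[OF sm(1), of b] pd(1)[OF h, of b] pd(2)[OF sm(1), of b'] spl[OF sm(1), of b b'] by simp
  have D2: "?D ?h2 (b, b') = ?D h (0, b')" for b b'
    using pd(2)[OF sm(2), of b'] pd(2)[OF h, of b'] pd(1)[OF sm(2), of b] spl[OF sm(2), of b b'] by simp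
  have D: "?D h b = ?D ?h1 b + ?D ?h2 b" for b
    using spl[OF h, of "fst b" "snd b"] D1[of "fst b" "snd b"] D2[of "fst b" "snd b"] by simp
  have e: "?\<theta> z = (\<phi> (fst z), \<psi> (snd z))" by (cases z) simp
  have ev: "v k = (\<Sum>b\<in>Basis. v (x b) * ?D k b)" if "k \<in> smooth_funs M" for k
    using W(6)[OF W(2) v that] by (simp add: e)
  show ?thesis
    unfolding ev[OF h] ev[OF sm(1)] ev[OF sm(2)] sum.distrib[symmetric] by (simp add: D distrib_left)
qed

text \<open>In coordinates the function is a sum of the components of \<open>X\<close>, which are
  smooth on the first factor, times partial derivatives of \<open>h\<close>, which are smooth on a
  product chart and made global by a cutoff.\<close>

lemma smooth_lift1:
  assumes X: "X \<in> vector_fields A" and h: "h \<in> smooth_funs M"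
  shows "(\<lambda>z. X (fst z) (\<lambda>x. h (x, snd z))) \<in> smooth_funs M"
proof (rule M.smooth_funs_local)
  fix z0 :: "'a \<times> 'b"
  obtain U \<phi> where U: "(U, \<phi>) \<in> A" "fst z0 \<in> U" using A.ex_chart by blast
  obtain V \<psi> where V: "(V, \<psi>) \<in> B" "snd z0 \<in> V" using B.ex_chart by blast
  let ?\<theta> = "map_prod \<phi> \<psi>"
  have c: "(U \<times> V, ?\<theta>) \<in> M" "z0 \<in> U \<times> V" using prod_chart[OF U(1) V(1)] U(2) V(2) by (auto simp: mem_Times_iff)
  obtain W x where "A.chart_coordinates U \<phi> (fst z0) W x" using A.ex_chart_coordinates[OF U] .
  note W = A.chart_coordinatesD[OF this]
  obtain \<eta> N where "M.chart_cutoff (U \<times> V) ?\<theta> z0 \<eta> N" using M.ex_chart_cutoff[OF c] .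
  note N = M.chart_cutoffD[OF this]
  let ?D = "\<lambda>b w. frechet_derivative (\<lambda>w. h (inv_into (U \<times> V) ?\<theta> w)) (at w) (b, 0)"
  let ?g = "\<lambda>z. \<Sum>b\<in>Basis. X (fst z) (x b) * (if z \<in> U \<times> V then \<eta> (?\<theta> z) * ?D b (?\<theta> z) else 0)"
  let ?W = "W \<times> UNIV \<inter> {z \<in> U \<times> V. ?\<theta> z \<in> N}"
  have "open ?W" using M.chart_preimage_open[OF c(1) N(1)] W(1) by (auto intro: open_Times)
  moreover have "z0 \<in> ?W" using W(2) c(2) N(2) by (auto simp: mem_Times_iff)
  moreover have "?g \<in> smooth_funs M"
    by (intro M.smooth_sum M.smooth_mult smooth_fst[OF A.vector_field_smooth[OF X W(4)]] N(5)
        smooth_on_frechet_derivative M.smooth_chart[OF h c(1)])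
  moreover have "X (fst z) (\<lambda>x. h (x, snd z)) = ?g z" if z: "z \<in> ?W" for z
  proof -
    have *: "fst z \<in> W" "fst z \<in> U" "snd z \<in> V" "\<eta> (?\<theta> z) = 1" "?\<theta> z = (\<phi> (fst z), \<psi> (snd z))"
      using z N(4) by (auto simp: mem_Times_iff map_prod_def split_beta)
    have "X (fst z) (\<lambda>x. h (x, snd z)) = (\<Sum>b\<in>Basis. X (fst z) (x b) *
        frechet_derivative (\<lambda>x. h (inv_into U \<phi> x, snd z)) (at (\<phi> (fst z))) b)"
      by (rule W(6)[OF *(1) A.vector_field_tangent[OF X] smooth_slice1[OF h]])
    then show ?thesis
      using * by (simp add: partial_derivatives(1)[OF h U(1) V(1) *(2,3)] mem_Times_iff)
  qed
  ultimately show "\<exists>W g. open W \<and> z0 \<in> W \<and> g \<in> smooth_funs M \<and> (\<forall>z\<in>W. X (fst z) (\<lambda>x. h (x, snd z)) = g z)"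
    by (intro exI[of _ ?W] exI[of _ ?g]) blast
qed

end

context two_atlases begin

interpretation S: two_atlases B A ..

lemma smooth_lift2:
  "Y \<in> vector_fields B \<Longrightarrow> h \<in> smooth_funs M \<Longrightarrow> (\<lambda>z. Y (snd z) (\<lambda>y. h (fst z, y))) \<in> smooth_funs M"
  using S.smooth_swap[OF S.smooth_lift1[OF _ smooth_swap]] by simp

lemma product_manifold: "product_manifold A B M fst snd Pair"
proof unfold_locales
  show "smooth_map M A fst" "smooth_map M B snd"
    by (auto simp: smooth_map_def smooth_fst smooth_snd intro: continuous_intros)
  show "smooth_map A M (\<lambda>x. (x, y))" for y
    by (auto simp: smooth_map_def smooth_slice1 intro!: continuous_intros)
  show "smooth_map B M (Pair x)" for x
    by (auto simp: smooth_map_def smooth_slice2 intro!: continuous_intros)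
qed (auto simp: smooth_lift1 smooth_lift2 intro: tangent_split)

end

section \<open>The two implications for general weights\<close>

lemma pseudo_riemannian_poisson_iff:
  "pseudo_riemannian_poisson A g P \<longleftrightarrow> (\<exists>D. contravariant_connection A P D \<and> parallel_tensor A P D g \<and>
    (\<forall>\<alpha>\<in>one_forms A. \<forall>\<beta>\<in>one_forms A. (\<lambda>p v. D \<alpha> \<beta> p v - D \<beta> \<alpha> p v) = koszul_bracket A P \<alpha> \<beta>) \<and>
    parallel_tensor A P D P)"
proof -
  have "parallel_bivector A P D \<longleftrightarrow> parallel_tensor A P D P" for D
    unfolding parallel_bivector_def parallel_tensor_def by (simp add: algebra_simps)
  then show ?thesis
    unfolding pseudo_riemannian_poisson_def levi_civita_connection_def
    by (simp add: parallel_tensor_def)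
qed

context product_bivector begin

text \<open>Only the weights belonging to the factor have to be nonzero constants, and only on one
  slice. This leaves the freedom to choose the slice.\<close>

lemma pseudo_riemannian_poisson_factor:
  assumes M: "pseudo_riemannian_poisson M g P" and c: "c \<noteq> 0" "\<And>x. lamA (mk x y0) = c"
    and g: "contravariant_tensor2 M g" "contravariant_tensor2 A gA" "contravariant_tensor2 B gB"
    and gs: "split_tensor g kapA gA kapB gB" and e: "e \<noteq> 0" "\<And>x. kapA (mk x y0) = e"
  shows "pseudo_riemannian_poisson A gA PA"
proof -
  obtain D where D: "contravariant_connection M P D" "parallel_tensor M P D g" "parallel_tensor M P D P"
    and t: "\<And>\<alpha> \<beta>. \<alpha> \<in> one_forms M \<Longrightarrow> \<beta> \<in> one_forms M \<Longrightarrow> (\<lambda>p v. D \<alpha> \<beta> p v - D \<beta> \<alpha> p v) = koszul_bracket M P \<alpha> \<beta>"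
    using M unfolding pseudo_riemannian_poisson_iff by blast
  let ?D = "slice_conn D y0 c"
  \<comment> \<open>The bivector is a split tensor too, with weight \<open>lamA\<close>, so in its
    case the constant \<open>e\<close> is again \<open>c\<close>.\<close>
  have "parallel_tensor A PA ?D gA" "parallel_tensor A PA ?D PA"
    unfolding parallel_tensor_def
    using slice_conn_tensor[OF D(1) c g gs e D(2)] slice_conn_tensor[OF D(1) c tens tensA tensB split c D(3)] by blast+
  then show ?thesis
    unfolding pseudo_riemannian_poisson_iff
    using slice_conn_connection[OF D(1) c] slice_conn_torsion[OF D(1) c t] by blast
qed

text \<open>The weights of the cometric are asked to be annihilated by the anchor, those of the
  bivector by all tangent vectors. This is the difference between f being Casimir and \<mu> being
  essentially constant.\<close>

lemma pseudo_riemannian_poisson_product: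
  assumes A: "pseudo_riemannian_poisson A gA PA" and B: "pseudo_riemannian_poisson B gB PB"
    and g: "contravariant_tensor2 M g" "contravariant_tensor2 A gA" "contravariant_tensor2 B gB"
    and gs: "split_tensor g kapA gA kapB gB" and k: "kapA \<in> smooth_funs M" "kapB \<in> smooth_funs M"
    and k0: "\<And>\<alpha> z. \<alpha> \<in> one_forms M \<Longrightarrow> anchor M P \<alpha> z kapA = 0" "\<And>\<alpha> z. \<alpha> \<in> one_forms M \<Longrightarrow> anchor M P \<alpha> z kapB = 0"
  shows "pseudo_riemannian_poisson M g P"
proof -
  obtain DA where DA: "contravariant_connection A PA DA" "parallel_tensor A PA DA gA" "parallel_tensor A PA DA PA"
    and tA: "\<And>\<alpha> \<beta>. \<alpha> \<in> one_forms A \<Longrightarrow> \<beta> \<in> one_forms A \<Longrightarrow> (\<lambda>p v. DA \<alpha> \<beta> p v - DA \<beta> \<alpha> p v) = koszul_bracket A PA \<alpha> \<beta>"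
    using A unfolding pseudo_riemannian_poisson_iff by blast
  obtain DB where DB: "contravariant_connection B PB DB" "parallel_tensor B PB DB gB" "parallel_tensor B PB DB PB"
    and tB: "\<And>\<alpha> \<beta>. \<alpha> \<in> one_forms B \<Longrightarrow> \<beta> \<in> one_forms B \<Longrightarrow> (\<lambda>p v. DB \<alpha> \<beta> p v - DB \<beta> \<alpha> p v) = koszul_bracket B PB \<alpha> \<beta>"
    using B unfolding pseudo_riemannian_poisson_iff by blast
  interpret C: product_connection A B M pA pB mk P PA PB lamA lamB DA DB
    by unfold_locales (rule DA(1) DB(1))+
  have l0: "anchor M P \<alpha> z lamA = 0" "anchor M P \<alpha> z lamB = 0" if "\<alpha> \<in> one_forms M" for \<alpha> z
    using lamA_const lamB_const M.anchor_tangent[OF tens that] by blast+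
  have "parallel_tensor M P C.prod_conn g" "parallel_tensor M P C.prod_conn P"
    unfolding parallel_tensor_def
    using C.prod_conn_tensor[OF g gs k k0 DA(2) DB(2)]
      C.prod_conn_tensor[OF tens tensA tensB split lamA_smooth lamB_smooth l0 DA(3) DB(3)] by blast+
  then show ?thesis
    unfolding pseudo_riemannian_poisson_iff
    using C.prod_conn_connection C.prod_conn_torsion[OF tA tB] by blast
qed

end

theorem theorem5p2:
  fixes A1 :: "('a::{t2_space, second_countable_topology}, 'e::euclidean_space) atlas"
    and A2 :: "('b::{t2_space, second_countable_topology}, 'f::euclidean_space) atlas"
    and G1 :: "'a \<Rightarrow> 'a tvec \<Rightarrow> 'a tvec \<Rightarrow> real"
    and G2 :: "'b \<Rightarrow> 'b tvec \<Rightarrow> 'b tvec \<Rightarrow> real"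
    and g1 \<Pi>1 :: "'a \<Rightarrow> 'a covec \<Rightarrow> 'a covec \<Rightarrow> real"
    and g2 \<Pi>2 :: "'b \<Rightarrow> 'b covec \<Rightarrow> 'b covec \<Rightarrow> real"
    and gf \<Pi>\<mu> :: "'a \<times> 'b \<Rightarrow> ('a \<times> 'b) covec \<Rightarrow> ('a \<times> 'b) covec \<Rightarrow> real"
    and f \<mu> :: "'a \<Rightarrow> real"
  assumes "smooth_atlas A1" and "smooth_atlas A2"
    and "pseudo_riemannian_metric A1 G1" and "pseudo_riemannian_metric A2 G2"
    and "g1 = cometric A1 G1" and "g2 = cometric A2 G2"
    and "bivector_field A1 \<Pi>1" and "bivector_field A2 \<Pi>2"
    and "f \<in> smooth_funs A1" and "\<forall>x. f x > 0"
    and "\<mu> \<in> smooth_funs A1"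
    and "is_warped_cometric A1 A2 f g1 g2 gf"
    and "is_warped_bivector A1 A2 \<mu> \<Pi>1 \<Pi>2 \<Pi>\<mu>"
    and "casimir A1 \<Pi>1 f"
    and "essentially_constant \<mu>" and "\<mu> \<noteq> (\<lambda>x. 0)"
  shows "pseudo_riemannian_poisson (prod_atlas A1 A2) gf \<Pi>\<mu> \<longleftrightarrow>
         pseudo_riemannian_poisson A1 g1 \<Pi>1 \<and> pseudo_riemannian_poisson A2 g2 \<Pi>2"
proof -
  let ?M = "prod_atlas A1 A2"
  interpret two_atlases A1 A2 by unfold_locales (rule assms(1,2))+
  interpret product_manifold A1 A2 ?M fst snd Pair by (rule product_manifold)
  interpret S: product_manifold A2 A1 ?M snd fst "\<lambda>y x. (x, y)" by (rule swap)
  have g: "contravariant_tensor2 ?M gf"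
    and gsym: "\<And>z a b. a \<in> cotangent_space ?M z \<Longrightarrow> b \<in> cotangent_space ?M z \<Longrightarrow> gf z a b = gf z b a"
    and g11: "\<And>\<alpha> \<beta>. \<alpha> \<in> one_forms A1 \<Longrightarrow> \<beta> \<in> one_forms A1 \<Longrightarrow> contra_eval gf (lA \<alpha>) (lA \<beta>) = contra_eval g1 \<alpha> \<beta> \<circ> fst"
    and g22: "\<And>\<alpha> \<beta>. \<alpha> \<in> one_forms A2 \<Longrightarrow> \<beta> \<in> one_forms A2 \<Longrightarrow> contra_eval gf (lB \<alpha>) (lB \<beta>) = (\<lambda>z. (f \<circ> fst) z * (contra_eval g2 \<alpha> \<beta> \<circ> snd) z)"
    and g12: "\<And>\<alpha> \<beta>. \<alpha> \<in> one_forms A1 \<Longrightarrow> \<beta> \<in> one_forms A2 \<Longrightarrow> contra_eval gf (lA \<alpha>) (lB \<beta>) = (\<lambda>z. 0)"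
    using assms(12) unfolding is_warped_cometric_def contravariant_metric_def hlift_form_def vlift_form_def by blast+
  have P: "bivector_field ?M \<Pi>\<mu>"
    and P11: "\<And>\<alpha> \<beta>. \<alpha> \<in> one_forms A1 \<Longrightarrow> \<beta> \<in> one_forms A1 \<Longrightarrow> contra_eval \<Pi>\<mu> (lA \<alpha>) (lA \<beta>) = contra_eval \<Pi>1 \<alpha> \<beta> \<circ> fst"
    and P22: "\<And>\<alpha> \<beta>. \<alpha> \<in> one_forms A2 \<Longrightarrow> \<beta> \<in> one_forms A2 \<Longrightarrow> contra_eval \<Pi>\<mu> (lB \<alpha>) (lB \<beta>) = (\<lambda>z. (\<mu> \<circ> fst) z * (contra_eval \<Pi>2 \<alpha> \<beta> \<circ> snd) z)"
    and P12: "\<And>\<alpha> \<beta>. \<alpha> \<in> one_forms A1 \<Longrightarrow> \<beta> \<in> one_forms A2 \<Longrightarrow> contra_eval \<Pi>\<mu> (lA \<alpha>) (lB \<beta>) = (\<lambda>z. 0)"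
    using assms(13) unfolding is_warped_bivector_def hlift_form_def vlift_form_def by blast+
  note g' = fun_cong[OF g11, unfolded contra_eval_def o_def] fun_cong[OF g22, unfolded contra_eval_def o_def]
    fun_cong[OF g12, unfolded contra_eval_def o_def]
  note P' = fun_cong[OF P11, unfolded contra_eval_def o_def] fun_cong[OF P22, unfolded contra_eval_def o_def]
    fun_cong[OF P12, unfolded contra_eval_def o_def]
  note cot = M.one_form_cotangent[OF lA_one_form] M.one_form_cotangent[OF S.lA_one_form]
  \<comment> \<open>The warped cometric prescribes the mixed values in one order; symmetry gives the
    other, as antisymmetry does for the bivector below.\<close>
  have gs: "split_tensor gf (\<lambda>z. 1) g1 (\<lambda>z. f (fst z)) g2"
    using g' gsym[OF cot(2,1)] by (intro split_tensorI[OF g]) simp_all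
  have Ps: "split_tensor \<Pi>\<mu> (\<lambda>z. 1) \<Pi>1 (\<lambda>z. \<mu> (fst z)) \<Pi>2"
    using P' bivector_antisym[OF P cot(2,1)]
    by (intro split_tensorI[OF bivector_tensor[OF P]]) simp_all
  have m0: "v (\<lambda>z. \<mu> (fst z)) = 0" if "v \<in> tangent_space ?M z" for v z
    using A.essentially_constant_derivative[OF assms(15,11) vA_tangent[OF that]]
    by (simp add: pushforward_eval assms(11))
  interpret product_bivector A1 A2 ?M fst snd Pair \<Pi>\<mu> \<Pi>1 \<Pi>2 "\<lambda>z. 1" "\<lambda>z. \<mu> (fst z)"
    by unfold_locales (auto intro: P assms Ps PA.smooth_comp m0 M.tangent_const)
  interpret T: product_bivector A2 A1 ?M snd fst "\<lambda>y x. (x, y)" \<Pi>\<mu> \<Pi>2 \<Pi>1 "\<lambda>z. \<mu> (fst z)" "\<lambda>z. 1"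
    by (rule swap_bivector)
  \<comment> \<open>Essentially constant functions may vanish on some components, so a base point
    with nonzero \<mu> is fixed.\<close>
  obtain x0 where x0: "\<mu> x0 \<noteq> 0" using assms(16) by auto
  have fx0: "f x0 \<noteq> 0" using assms(10) by (metis less_irrefl)
  have g1: "contravariant_tensor2 A1 g1"
    using g' by (intro tensor_of_lifts[OF g, of 1]) simp_all
  have g2: "contravariant_tensor2 A2 g2"
    using g' by (intro S.tensor_of_lifts[OF g fx0, where y = x0]) simp_all
  \<comment> \<open>The Casimir condition speaks of the anchor of the differential of f.
    Antisymmetry turns it into the vanishing of the derivative of f along the anchor of any form;
    along the second factor the lift of f is constant.\<close>
  have f0: "anchor ?M \<Pi>\<mu> \<alpha> z (\<lambda>z. f (fst z)) = 0" if \<alpha>: "\<alpha> \<in> one_forms ?M" for \<alpha> z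
  proof -
    let ?a = "sA (snd z) \<alpha>"
    have a: "?a (fst z) \<in> cotangent_space A1 (fst z)" by (rule sA_cotangent[OF \<alpha>])
    have "aA \<alpha> z f = \<Pi>1 (fst z) (?a (fst z)) (differential A1 f (fst z))"
      by (rule A.anchor_apply[OF tensA sA_one_form[OF \<alpha>]])
    also have "\<dots> = - \<Pi>1 (fst z) (differential A1 f (fst z)) (?a (fst z))"
      by (rule bivector_antisym[OF bivA a A.differential_cotangent])
    also have "\<dots> = - ?a (fst z) (anchor A1 \<Pi>1 (differential A1 f) (fst z))"
      by (simp add: A.anchor_eval[OF tensA A.differential_one_form[OF assms(9)] a])
    also have "\<dots> = 0"
      using assms(14) A.cotangent_zero_vec[OF a] by (simp add: casimir_def)
    finally show ?thesis
      using anchor_split[OF \<alpha> PA.smooth_comp[OF assms(9)], of z] B.tangent_const[OF T.aA_tangent[OF \<alpha>]] by simp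
  qed
  show ?thesis
  proof (intro iffI conjI; (elim conjE)?)
    assume Q: "pseudo_riemannian_poisson ?M gf \<Pi>\<mu>"
    \<comment> \<open>On the first factor both weights are 1, so any slice will do.\<close>
    show "pseudo_riemannian_poisson A1 g1 \<Pi>1"
      by (rule pseudo_riemannian_poisson_factor[where c = 1 and e = 1, OF Q _ _ g g1 g2 gs]) simp_all
    \<comment> \<open>With the factors exchanged, the slice over \<open>x0\<close> carries the
      constant weights \<open>\<mu> x0\<close> and \<open>f x0\<close>, both nonzero.\<close>
    show "pseudo_riemannian_poisson A2 g2 \<Pi>2"
      by (rule T.pseudo_riemannian_poisson_factor[OF Q x0 _ g g2 g1 split_tensor_swap[OF gs] fx0]) simp_all
  next
    assume "pseudo_riemannian_poisson A1 g1 \<Pi>1" "pseudo_riemannian_poisson A2 g2 \<Pi>2"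
    then show "pseudo_riemannian_poisson ?M gf \<Pi>\<mu>"
      by (rule pseudo_riemannian_poisson_product[OF _ _ g g1 g2 gs])
        (auto intro: f0 PA.smooth_comp assms M.tangent_const M.anchor_tangent[OF tens])
  qed
qed

end
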